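(* Let $\mu$ be a positive finite Borel measure on $\mathbb D$ and $k\ge0$ an integer. Then $T^{(k)}_\mu$ is (bounded and) compact on $A^2$ if and only if $\mu$ is a vanishing Carleson measure.
   Context: $\mathbb D$ open unit disc, $dA$ normalized area measure, $A^2$ Bergman space with $\langle f,g\rangle=\int f\bar g\,dA$. $\varphi_z(w)=(z-w)/(1-\bar zw)$, $U_zf=(f\circ\varphi_z)\varphi_z'$, $e_k(w)=\sqrt{k+1}\,w^k$. For a finite measure $\mu$, $T^{(k)}_\mu$ is given by $\langle T^{(k)}_\mu f,g\rangle=\int\langle f,U_ze_k\rangle\overline{\langle g,U_ze_k\rangle}(1-|z|^2)^{-2}d\mu(z)$ for polynomials $f,g$. A positive measure $\mu$ on $\mathbb D$ is Carleson if $A^2\subset L^2(d\mu)$, and vanishing Carleson if moreover this inclusion is a compact operator. *)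

theory Defs
  imports "HOL-Analysis.Analysis" "HOL-Computational_Algebra.Polynomial"
begin

definition disc :: "complex set" where
  "disc = ball 0 1"

definition dA :: "complex measure" where
  "dA = density lborel (\<lambda>z. ennreal (indicator disc z / pi))"

definition A2 :: "(complex \<Rightarrow> complex) set" where
  "A2 = {f. f holomorphic_on disc \<and> integrable dA (\<lambda>z. (cmod (f z))^2)}"

definition inner_A2 :: "(complex \<Rightarrow> complex) \<Rightarrow> (complex \<Rightarrow> complex) \<Rightarrow> complex" where
  "inner_A2 f g = integral\<^sup>L dA (\<lambda>z. f z * cnj (g z))"

definition norm_A2 :: "(complex \<Rightarrow> complex) \<Rightarrow> real" where
  "norm_A2 f = sqrt (integral\<^sup>L dA (\<lambda>z. (cmod (f z))^2))"

definition norm_L2 :: "complex measure \<Rightarrow> (complex \<Rightarrow> complex) \<Rightarrow> real" where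
  "norm_L2 \<mu> f = sqrt (integral\<^sup>L \<mu> (\<lambda>z. (cmod (f z))^2))"

definition phi :: "complex \<Rightarrow> complex \<Rightarrow> complex" where
  "phi z w = (z - w) / (1 - cnj z * w)"

definition U :: "complex \<Rightarrow> (complex \<Rightarrow> complex) \<Rightarrow> (complex \<Rightarrow> complex)" where
  "U z f = (\<lambda>w. f (phi z w) * deriv (phi z) w)"

definition e :: "nat \<Rightarrow> complex \<Rightarrow> complex" where
  "e k = (\<lambda>w. complex_of_real (sqrt (real k + 1)) * w ^ k)"

definition Tk_integrand :: "nat \<Rightarrow> (complex \<Rightarrow> complex) \<Rightarrow> (complex \<Rightarrow> complex) \<Rightarrow> complex \<Rightarrow> complex" where
  "Tk_integrand k f g z =
     inner_A2 f (U z (e k)) * cnj (inner_A2 g (U z (e k))) / complex_of_real ((1 - (cmod z)^2)^2)"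

definition carleson :: "complex measure \<Rightarrow> bool" where
  "carleson \<mu> \<longleftrightarrow> (\<forall>f\<in>A2. f \<in> borel_measurable \<mu> \<and> integrable \<mu> (\<lambda>z. (cmod (f z))^2))"

text \<open>Vanishing Carleson: moreover the inclusion A^2 into L^2(mu) is compact, i.e. maps the
  unit ball to a relatively compact set of the (complete) space L^2(mu): every sequence in the
  unit ball of A^2 has a subsequence that is Cauchy in L^2(mu).\<close>
definition vanishing_carleson :: "complex measure \<Rightarrow> bool" where
  "vanishing_carleson \<mu> \<longleftrightarrow> carleson \<mu> \<and>
     (\<forall>fs. (\<forall>n. fs n \<in> A2 \<and> norm_A2 (fs n) \<le> 1) \<longrightarrow>
        (\<exists>r :: nat \<Rightarrow> nat. strict_mono r \<and>
           (\<forall>\<epsilon>>0. \<exists>N. \<forall>m\<ge>N. \<forall>n\<ge>N. norm_L2 \<mu> (\<lambda>z. fs (r m) z - fs (r n) z) < \<epsilon>)))"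

definition Tk_bounded_compact :: "complex measure \<Rightarrow> nat \<Rightarrow> bool" where
  "Tk_bounded_compact \<mu> k \<longleftrightarrow>
    (\<exists>T :: (complex \<Rightarrow> complex) \<Rightarrow> (complex \<Rightarrow> complex).
       (\<forall>f\<in>A2. T f \<in> A2)
     \<and> (\<forall>f\<in>A2. \<forall>g\<in>A2. \<forall>z\<in>disc. T (\<lambda>w. f w + g w) z = T f z + T g z)
     \<and> (\<forall>f\<in>A2. \<forall>c. \<forall>z\<in>disc. T (\<lambda>w. c * f w) z = c * T f z)
     \<and> (\<exists>C. \<forall>f\<in>A2. norm_A2 (T f) \<le> C * norm_A2 f)
     \<and> (\<forall>fs. (\<forall>n. fs n \<in> A2 \<and> norm_A2 (fs n) \<le> 1) \<longrightarrow>
          (\<exists>r :: nat \<Rightarrow> nat. strict_mono r \<and>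
             (\<forall>\<epsilon>>0. \<exists>N. \<forall>m\<ge>N. \<forall>n\<ge>N. norm_A2 (\<lambda>z. T (fs (r m)) z - T (fs (r n)) z) < \<epsilon>)))
     \<and> (\<forall>p q :: complex poly.
          integrable \<mu> (Tk_integrand k (poly p) (poly q)) \<and>
          inner_A2 (T (poly p)) (poly q) = integral\<^sup>L \<mu> (Tk_integrand k (poly p) (poly q))))"

end

theory Submission
  imports Defs "HOL-Complex_Analysis.Complex_Analysis"
begin

text \<open>
  Put \<open>F f z = \<langle>f, U\<^sub>z e\<^sub>k\<rangle> / (1 - \<bar>z\<bar>\<^sup>2)\<close>, so that \<open>\<langle>T f, g\<rangle> = \<integral> F f \<cdot> cnj (F g) d\<mu>\<close>, and let
  \<open>\<rho>(w) = \<mu>(B(w, t(1 - \<bar>w\<bar>))) / (1 - \<bar>w\<bar>)\<^sup>2\<close>. Both properties of \<open>\<mu>\<close> are equivalent to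
  \<open>\<rho>(w) \<rightarrow> 0\<close> as \<open>\<bar>w\<bar> \<rightarrow> 1\<close>, for some \<open>t\<close> in \<open>(0, 1)\<close>.

  The function \<open>F f\<close> is a combination of the terms \<open>(1 - \<bar>z\<bar>\<^sup>2)^j f\<^sup>(\<^sup>j\<^sup>)(z)\<close> with \<open>j \<le> k\<close>, whence
  \<open>\<bar>F f z\<bar>\<^sup>2\<close> is bounded by the mean of \<open>\<bar>f\<bar>\<^sup>2\<close> over a Euclidean disc of radius comparable to
  \<open>1 - \<bar>z\<bar>\<close>. By Fubini, \<open>\<integral> \<bar>F f\<bar>\<^sup>2 d\<mu> \<le> C \<integral> \<bar>f\<bar>\<^sup>2 \<rho> dA\<close>, so with Montel's theorem \<open>F\<close> is compact
  into \<open>L\<^sup>2(\<mu>)\<close> when \<open>\<rho> \<rightarrow> 0\<close>. For \<open>k = 0\<close> this is the inclusion of \<open>A\<^sup>2\<close> up to sign, and in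
  general \<open>T\<close> is \<open>F\<close> followed by its adjoint.

  Conversely the functions \<open>U\<^sub>w e\<^sub>k\<close> tend weakly to \<open>0\<close> as \<open>\<bar>w\<bar> \<rightarrow> 1\<close>, while
  \<open>\<bar>F (U\<^sub>w e\<^sub>k)\<bar> \<ge> c / (1 - \<bar>w\<bar>)\<close> on a disc \<open>B(w, t(1 - \<bar>w\<bar>))\<close>; hence either compactness forces
  \<open>\<rho>(w) \<rightarrow> 0\<close>. As the form of \<open>T\<close> is only given on polynomials, \<open>U\<^sub>w e\<^sub>k\<close> is replaced by a polynomial
  that is uniformly close to it on the disc.
\<close>

section \<open>Rotation invariance of planar Lebesgue measure and monomial integrals\<close>

text \<open>For k > 0 the function \<open>U w (e k)\<close> vanishes at w to order k, so it is not
  itself large near w, and \<open>F f\<close> is not pointwise comparable with f. The lower bound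
  works because \<open>F (U w (e k))\<close> at w is the squared norm of \<open>U w (e k)\<close>
  divided by 1 - |w|^2; a Lipschitz estimate for the kernels carries it to nearby z and dictates how
  small t must be. For k = 0 the kernel has no zero, and t = 1/2 is small enough. Sufficiency is
  proved for every t in (0, 1), so each necessity argument is free to choose its own t. Weak
  convergence comes from the same local bound as sufficiency: the inner product of g with
  \<open>U w (e k)\<close> is controlled by the mass of |g|^2 on a disc around w that leaves every
  compact set as |w| tends to 1. All reproducing formulas are derived from the orthogonality of the
  monomials, which rests on the rotation invariance of area; this explains the first section.
  Elements of \<open>A2\<close> have arbitrary values off the disc. Hence most integrals are taken
  over a measure living on the disc only, and the operator constructed produces functions extended
  by 0.\<close>

lemma measurable_cnj [measurable]: "cnj \<in> borel_measurable borel"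
  by (intro borel_measurable_continuous_onI continuous_intros)

lemma measurable_Complex [measurable]:
  "(\<lambda>p. Complex (fst p) (snd p)) \<in> borel_measurable (lborel \<Otimes>\<^sub>M lborel)"
  unfolding Complex_eq by measurable

text \<open>Both measures give a box the product of its side lengths. The product form allows a
  shear to be treated one coordinate at a time.\<close>

lemma lborel_complex_eq_distr:
  "(lborel :: complex measure) = distr (lborel \<Otimes>\<^sub>M lborel) borel (\<lambda>p. Complex (fst p) (snd p))"
proof (rule lborel_eqI)
  fix l u :: complex
  assume "\<And>b. b \<in> Basis \<Longrightarrow> l \<bullet> b \<le> u \<bullet> b"
  then have le: "Re l \<le> Re u" "Im l \<le> Im u"
    by (auto simp: Basis_complex_def dest: meta_spec[of _ 1] meta_spec[of _ \<i>])
  have "(\<lambda>p. Complex (fst p) (snd p)) -` box l u = {Re l<..<Re u} \<times> {Im l<..<Im u}"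
    by (auto simp: in_box_complex_iff)
  then show "emeasure (distr (lborel \<Otimes>\<^sub>M lborel) borel (\<lambda>p. Complex (fst p) (snd p))) (box l u)
      = ennreal (\<Prod>b\<in>Basis. (u - l) \<bullet> b)"
    using le
    by (subst emeasure_distr)
       (auto simp: Basis_complex_def space_pair_measure lborel.emeasure_pair_measure_Times ennreal_mult)
qed simp

lemma nn_integral_lborel_complex:
  fixes f :: "complex \<Rightarrow> ennreal"
  assumes [measurable]: "f \<in> borel_measurable borel"
  shows "(\<integral>\<^sup>+z. f z \<partial>lborel) = (\<integral>\<^sup>+x. \<integral>\<^sup>+y. f (Complex x y) \<partial>lborel \<partial>lborel)"
    and "(\<integral>\<^sup>+z. f z \<partial>lborel) = (\<integral>\<^sup>+y. \<integral>\<^sup>+x. f (Complex x y) \<partial>lborel \<partial>lborel)"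
proof -
  have *: "(\<integral>\<^sup>+z. f z \<partial>lborel) = (\<integral>\<^sup>+p. f (Complex (fst p) (snd p)) \<partial>(lborel \<Otimes>\<^sub>M lborel))"
    by (subst lborel_complex_eq_distr, subst nn_integral_distr) auto
  have m: "(\<lambda>(x, y). f (Complex x y)) \<in> borel_measurable (lborel \<Otimes>\<^sub>M lborel)"
    using measurable_compose[OF measurable_Complex assms] by (simp add: case_prod_unfold)
  show "(\<integral>\<^sup>+z. f z \<partial>lborel) = (\<integral>\<^sup>+x. \<integral>\<^sup>+y. f (Complex x y) \<partial>lborel \<partial>lborel)"
    unfolding * using lborel.nn_integral_fst[OF m] by (simp add: case_prod_unfold)
  show "(\<integral>\<^sup>+z. f z \<partial>lborel) = (\<integral>\<^sup>+y. \<integral>\<^sup>+x. f (Complex x y) \<partial>lborel \<partial>lborel)"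
    unfolding * using lborel_pair.nn_integral_snd[OF m] by (simp add: case_prod_unfold)
qed

text \<open>For fixed imaginary part y the shear is the translation of the real part by a * y, which
  the inner integral ignores.\<close>

lemma nn_integral_shear_Re:
  fixes f :: "complex \<Rightarrow> ennreal"
  assumes [measurable]: "f \<in> borel_measurable borel"
  shows "(\<integral>\<^sup>+z. f (z + of_real (a * Im z)) \<partial>lborel) = (\<integral>\<^sup>+z. f z \<partial>lborel)"
proof -
  have eq: "Complex x y + of_real (a * Im (Complex x y)) = Complex (a * y + 1 * x) y" for x y
    by (simp add: complex_eq_iff)
  have m: "(\<lambda>x. f (Complex x y)) \<in> borel_measurable borel" for y
    unfolding Complex_eq by measurable
  have "(\<integral>\<^sup>+z. f (z + of_real (a * Im z)) \<partial>lborel)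
      = (\<integral>\<^sup>+y. \<integral>\<^sup>+x. f (Complex (a * y + 1 * x) y) \<partial>lborel \<partial>lborel)"
    by (subst nn_integral_lborel_complex(2)) (simp_all only: eq, measurable)
  also have "\<dots> = (\<integral>\<^sup>+y. \<integral>\<^sup>+x. f (Complex x y) \<partial>lborel \<partial>lborel)"
    using nn_integral_real_affine[OF m, of 1] by simp
  finally show ?thesis
    by (simp add: nn_integral_lborel_complex(2))
qed

lemma nn_integral_shear_Im:
  fixes f :: "complex \<Rightarrow> ennreal"
  assumes [measurable]: "f \<in> borel_measurable borel"
  shows "(\<integral>\<^sup>+z. f (z + \<i> * of_real (a * Re z)) \<partial>lborel) = (\<integral>\<^sup>+z. f z \<partial>lborel)"
proof -
  have eq: "Complex x y + \<i> * of_real (a * Re (Complex x y)) = Complex x (a * x + 1 * y)" for x y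
    by (simp add: complex_eq_iff)
  have m: "(\<lambda>y. f (Complex x y)) \<in> borel_measurable borel" for x
    unfolding Complex_eq by measurable
  have "(\<integral>\<^sup>+z. f (z + \<i> * of_real (a * Re z)) \<partial>lborel)
      = (\<integral>\<^sup>+x. \<integral>\<^sup>+y. f (Complex x (a * x + 1 * y)) \<partial>lborel \<partial>lborel)"
    by (subst nn_integral_lborel_complex(1)) (simp_all only: eq, measurable)
  also have "\<dots> = (\<integral>\<^sup>+x. \<integral>\<^sup>+y. f (Complex x y) \<partial>lborel \<partial>lborel)"
    using nn_integral_real_affine[OF m, of 1] by simp
  finally show ?thesis
    by (simp add: nn_integral_lborel_complex(1))
qed

text \<open>A rotation is a composition of three shears.\<close>

lemma lborel_distr_rotation:
  assumes "sin \<alpha> \<noteq> 0"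
  shows "distr lborel borel ((*) (cis \<alpha>)) = lborel"
proof (rule measure_eqI)
  fix A assume "A \<in> sets (distr lborel borel ((*) (cis \<alpha>)))"
  then have [measurable]: "A \<in> sets borel" by simp
  \<comment> \<open>This is - tan (\<open>\<alpha>\<close> / 2), the usual parameter of the outer
    shears; the middle one has parameter sin \<open>\<alpha>\<close>. Matching matrix entries
    requires a * (cos \<open>\<alpha>\<close> + 1) = - sin \<open>\<alpha>\<close>, which is sin^2 +
    cos^2 = 1.\<close>
  define a where "a = (cos \<alpha> - 1) / sin \<alpha>"
  let ?f = "indicator A :: complex \<Rightarrow> ennreal"
  let ?S = "\<lambda>z. z + of_real (a * Im z)"
  let ?T = "\<lambda>z. z + \<i> * of_real (sin \<alpha> * Re z)"
  have as: "a * sin \<alpha> = cos \<alpha> - 1" using assms by (simp add: a_def)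
  have "a * (cos \<alpha> + 1) * sin \<alpha> = - sin \<alpha> * sin \<alpha>"
    using as sin_cos_squared_add[of \<alpha>] by (simp add: power2_eq_square) algebra
  then have ac: "a * (cos \<alpha> + 1) = - sin \<alpha>"
    using assms mult_right_cancel[of "sin \<alpha>" "a * (cos \<alpha> + 1)" "- sin \<alpha>"] by simp
  have rot: "cis \<alpha> * z = ?S (?T (?S z))" for z
  proof (rule complex_eqI)
    have "Re (?S (?T (?S z))) = (1 + a * sin \<alpha>) * Re z + (a * (1 + a * sin \<alpha>) + a) * Im z"
      by (simp add: algebra_simps)
    also have "\<dots> = Re (cis \<alpha> * z)"
      using as ac by (simp add: algebra_simps)
    finally show "Re (cis \<alpha> * z) = Re (?S (?T (?S z)))" by simp
    have "Im (?S (?T (?S z))) = sin \<alpha> * Re z + (1 + a * sin \<alpha>) * Im z"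
      by (simp add: algebra_simps)
    then show "Im (cis \<alpha> * z) = Im (?S (?T (?S z)))"
      using as by simp
  qed
  have "emeasure (distr lborel borel ((*) (cis \<alpha>))) A = (\<integral>\<^sup>+z. ?f z \<partial>distr lborel borel ((*) (cis \<alpha>)))"
    by (simp add: nn_integral_indicator)
  also have "\<dots> = (\<integral>\<^sup>+z. ?f (cis \<alpha> * z) \<partial>lborel)"
    by (subst nn_integral_distr) auto
  also have "\<dots> = (\<integral>\<^sup>+z. ?f (?S (?T (?S z))) \<partial>lborel)"
    by (simp only: rot)
  also have "\<dots> = (\<integral>\<^sup>+z. ?f (?S (?T z)) \<partial>lborel)"
    by (rule nn_integral_shear_Re[where f="\<lambda>z. ?f (?S (?T z))"]) measurable
  also have "\<dots> = (\<integral>\<^sup>+z. ?f (?S z) \<partial>lborel)"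
    by (rule nn_integral_shear_Im[where f="\<lambda>z. ?f (?S z)"]) measurable
  also have "\<dots> = (\<integral>\<^sup>+z. ?f z \<partial>lborel)"
    by (rule nn_integral_shear_Re) measurable
  finally show "emeasure (distr lborel borel ((*) (cis \<alpha>))) A = emeasure lborel A"
    by (simp add: nn_integral_indicator)
qed simp

lemma integrable_indicator_ball:
  fixes f :: "complex \<Rightarrow> 'b::{banach, second_countable_topology}"
  assumes "continuous_on (cball z r) f"
  shows "integrable lborel (\<lambda>w. indicator (ball z r) w *\<^sub>R f w)"
proof -
  have "set_integrable lborel (cball z r) f"
    by (rule borel_integrable_compact[OF compact_cball assms, folded set_integrable_def])
  then show ?thesis
    by (subst set_integrable_def[symmetric], rule set_integrable_subset) auto
qed

text \<open>Rotation by \<open>\<alpha>\<close> preserves the integral but multiplies the integrand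
  by \<open>cis (\<alpha> * d)\<close>, where d = n - m. The angle is chosen so that this factor is
  i or -i, hence different from 1. It also lies in (0, pi / 2], where the sine is nonzero, as the
  rotation lemma demands.\<close>

lemma integral_ball_monomial_neq:
  assumes "n \<noteq> m"
  shows "(LINT w|lborel. indicator (ball 0 r) w *\<^sub>R (w ^ n * cnj w ^ m)) = (0 :: complex)"
proof -
  let ?f = "\<lambda>w::complex. indicator (ball 0 r) w *\<^sub>R (w ^ n * cnj w ^ m)"
  define d where "d = real n - real m"
  define \<alpha> where "\<alpha> = pi / (2 * \<bar>d\<bar>)"
  have d: "\<bar>d\<bar> \<ge> 1" using assms unfolding d_def by linarith
  have \<alpha>: "0 < \<alpha>" "\<alpha> \<le> pi / 2"
    using d by (auto simp: \<alpha>_def field_simps mult_left_le)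
  then have s: "sin \<alpha> \<noteq> 0"
    using sin_gt_zero[of \<alpha>] pi_gt_zero by simp
  have [measurable]: "?f \<in> borel_measurable borel"
    by (intro borel_measurable_scaleR borel_measurable_indicator) measurable
  have "integral\<^sup>L lborel ?f = integral\<^sup>L (distr lborel borel ((*) (cis \<alpha>))) ?f"
    by (simp add: lborel_distr_rotation[OF s])
  also have "\<dots> = (LINT w|lborel. ?f (cis \<alpha> * w))"
    by (rule integral_distr) auto
  also have "\<dots> = (LINT w|lborel. cis (\<alpha> * d) * ?f w)"
  proof (rule Bochner_Integration.integral_cong[OF refl])
    fix w :: complex
    have 1: "cis \<alpha> ^ n * cnj (cis \<alpha>) ^ m = cis (\<alpha> * d)"
      by (simp only: cis_cnj Complex.DeMoivre cis_mult d_def, rule arg_cong[of _ _ cis], simp add: algebra_simps)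
    have "?f (cis \<alpha> * w) = indicator (ball 0 r) w *\<^sub>R ((cis \<alpha> ^ n * cnj (cis \<alpha>) ^ m) * (w ^ n * cnj w ^ m))"
      by (simp add: indicator_def norm_mult power_mult_distrib mult_ac)
    also have "\<dots> = cis (\<alpha> * d) * ?f w"
      unfolding 1 by simp
    finally show "?f (cis \<alpha> * w) = cis (\<alpha> * d) * ?f w" .
  qed
  also have "\<dots> = cis (\<alpha> * d) * integral\<^sup>L lborel ?f"
    by (rule integral_mult_right_zero)
  finally have *: "(1 - cis (\<alpha> * d)) * integral\<^sup>L lborel ?f = 0"
    by (simp add: algebra_simps)
  have "\<alpha> * d = pi / 2 \<or> \<alpha> * d = - (pi / 2)"
    using d by (cases "d > 0") (auto simp: \<alpha>_def)
  then have "sin (\<alpha> * d) \<noteq> 0"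
    by (elim disjE; simp only:) simp_all
  then have "cis (\<alpha> * d) \<noteq> 1"
    by (auto simp: complex_eq_iff)
  with * show ?thesis by simp
qed

lemma integral_ball_scale:
  fixes f :: "complex \<Rightarrow> 'b::{banach, second_countable_topology}"
  assumes [measurable]: "f \<in> borel_measurable borel" and "0 < r"
  shows "integral\<^sup>L lborel f = r\<^sup>2 *\<^sub>R (LINT w|lborel. f (r *\<^sub>R w))"
proof -
  have "integral\<^sup>L lborel f = integral\<^sup>L (density (distr lborel borel (\<lambda>x. 0 + r *\<^sub>R x)) (\<lambda>_. ennreal (r\<^sup>2))) f"
    using lborel_affine[of r "0::complex"] \<open>0 < r\<close> by simp
  also have "\<dots> = r\<^sup>2 *\<^sub>R integral\<^sup>L (distr lborel borel (\<lambda>x. 0 + r *\<^sub>R x)) f"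
    by (subst integral_density) auto
  also have "integral\<^sup>L (distr lborel borel (\<lambda>x. 0 + r *\<^sub>R x)) f = (LINT w|lborel. f (r *\<^sub>R w))"
    by (subst integral_distr) auto
  finally show ?thesis .
qed

lemma measure_ball_complex: "r \<ge> 0 \<Longrightarrow> measure lborel (ball (z::complex) r) = pi * r\<^sup>2"
  using content_ball[of r z] by (simp add: unit_ball_vol_2)

text \<open>The value at \<open>r = 1\<close> is determined by scaling: the annulus \<open>r \<le> \<bar>w\<bar> < 1\<close> carries
  the proportion \<open>1 - r^(2n+2)\<close> of the integral, and the integrand tends to \<open>1\<close> there as \<open>r \<rightarrow> 1\<close>.\<close>

lemma integral_ball_norm_power:
  assumes "0 < r"
  shows "(LINT w|lborel. indicator (ball (0::complex) r) w * (cmod w) ^ (2 * n)) = pi * r ^ (2 * n + 2) / (n + 1)"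
proof -
  define g where "g r = (LINT w|lborel. indicator (ball (0::complex) r) w * (cmod w) ^ (2 * n))" for r :: real
  have scale: "g r = r ^ (2 * n + 2) * g 1" if "0 < r" for r
  proof -
    have "g r = r\<^sup>2 *\<^sub>R (LINT w|lborel. indicator (ball (0::complex) r) (r *\<^sub>R w) * (cmod (r *\<^sub>R w)) ^ (2 * n))"
      unfolding g_def
      by (rule integral_ball_scale[OF _ that]) (intro borel_measurable_times borel_measurable_indicator, auto)
    also have "(LINT w|lborel. indicator (ball (0::complex) r) (r *\<^sub>R w) * (cmod (r *\<^sub>R w)) ^ (2 * n))
        = (LINT w|lborel. r ^ (2 * n) * (indicator (ball (0::complex) 1) w * (cmod w) ^ (2 * n)))"
      using that by (intro Bochner_Integration.integral_cong)
        (auto simp: indicator_def power_mult_distrib)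
    also have "\<dots> = r ^ (2 * n) * g 1" by (simp add: g_def)
    finally show ?thesis by (simp add: power2_eq_square mult_ac)
  qed
  have int: "integrable lborel (\<lambda>w. indicator (ball (0::complex) r) w * (cmod w) ^ m)" for r m
    using integrable_indicator_ball[of 0 r "\<lambda>w. (cmod w) ^ m"] by (simp add: continuous_intros)
  have int0: "integrable lborel (indicator (ball (0::complex) r) :: _ \<Rightarrow> real)" for r
    using int[of r 0] by simp
  have area: "(LINT w|lborel. indicator (ball (0::complex) r) w) = pi * r\<^sup>2" if "r > 0" for r :: real
    using that by (simp add: measure_ball_complex)
  \<comment> \<open>The annulus comparison divided by 1 - r^2: scaling gives g 1 - g r = (1 -
    r^(2n+2)) * g 1, and the first factor is 1 - r^2 times a geometric sum. As r tends to 1 that sum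
    tends to n + 1.\<close>
  have sq: "r ^ (2 * n) * pi \<le> g 1 * (\<Sum>i<Suc n. (r\<^sup>2) ^ i) \<and> g 1 * (\<Sum>i<Suc n. (r\<^sup>2) ^ i) \<le> pi"
    if r: "0 < r" "r < 1" for r
  proof -
    let ?a = "\<lambda>w::complex. indicator (ball 0 1) w - indicator (ball 0 r) w :: real"
    have inta: "integrable lborel ?a" using int0 by simp
    have a: "(LINT w|lborel. ?a w) = pi * (1 - r\<^sup>2)"
      using r area[of 1] area[of r] by (simp add: int0 measure_ball_complex right_diff_distrib)
    have g: "g 1 - g r = (LINT w|lborel. ?a w * (cmod w) ^ (2 * n))"
      unfolding g_def left_diff_distrib by (rule Bochner_Integration.integral_diff[OF int int, symmetric])
    have intb: "integrable lborel (\<lambda>w. ?a w * (cmod w) ^ (2 * n))"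
      using Bochner_Integration.integrable_diff[OF int[of 1] int[of r]] by (simp only: left_diff_distrib)
    have "(LINT w|lborel. r ^ (2 * n) * ?a w) \<le> g 1 - g r"
      unfolding g using r
      by (intro integral_mono integrable_mult_right inta intb)
         (auto simp: indicator_def intro!: power_mono)
    then have 1: "r ^ (2 * n) * pi * (1 - r\<^sup>2) \<le> g 1 - g r"
      using a by simp
    have "g 1 - g r \<le> (LINT w|lborel. ?a w)"
      unfolding g using r
      by (intro integral_mono inta intb) (auto simp: indicator_def intro: power_le_one)
    then have 2: "g 1 - g r \<le> pi * (1 - r\<^sup>2)" using a by simp
    have "1 - (r\<^sup>2) ^ Suc n = (1 - r\<^sup>2) * (\<Sum>i<Suc n. (r\<^sup>2) ^ i)"
      by (rule one_diff_power_eq)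
    moreover have "(r\<^sup>2) ^ Suc n = r ^ (2 * n + 2)"
      unfolding power_mult[symmetric] by simp
    ultimately have "1 - r ^ (2 * n + 2) = (1 - r\<^sup>2) * (\<Sum>i<Suc n. (r\<^sup>2) ^ i)"
      by metis
    moreover have "g 1 - g r = (1 - r ^ (2 * n + 2)) * g 1"
      using scale[OF r(1)] by (simp only: left_diff_distrib mult_1)
    ultimately have 3: "g 1 - g r = (1 - r\<^sup>2) * (g 1 * (\<Sum>i<Suc n. (r\<^sup>2) ^ i))"
      by (simp only: mult_ac)
    have pos: "1 - r\<^sup>2 > 0" using r by (simp add: power_less_one_iff abs_square_less_1)
    have "(1 - r\<^sup>2) * (r ^ (2 * n) * pi) \<le> (1 - r\<^sup>2) * (g 1 * (\<Sum>i<Suc n. (r\<^sup>2) ^ i))"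
      "(1 - r\<^sup>2) * (g 1 * (\<Sum>i<Suc n. (r\<^sup>2) ^ i)) \<le> (1 - r\<^sup>2) * pi"
      using 1 2 3 by (simp_all add: mult_ac del: sum.lessThan_Suc)
    with pos show ?thesis
      using mult_le_cancel_left_pos by blast
  qed
  have ev: "eventually (\<lambda>r. 0 < r \<and> r < (1::real)) (at_left 1)"
    using eventually_at_left_real[of 0 1] by simp
  note sum.lessThan_Suc [simp del]
  have l1: "((\<lambda>r. g 1 * (\<Sum>i<Suc n. (r\<^sup>2) ^ i)) \<longlongrightarrow> g 1 * (\<Sum>i<Suc n. ((1::real)\<^sup>2) ^ i)) (at_left 1)"
    by (intro tendsto_intros)
  have l2: "((\<lambda>r. r ^ (2 * n) * pi) \<longlongrightarrow> (1::real) ^ (2 * n) * pi) (at_left 1)"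
    by (intro tendsto_intros)
  have "(1::real) ^ (2 * n) * pi \<le> g 1 * (\<Sum>i<Suc n. ((1::real)\<^sup>2) ^ i)"
    by (rule tendsto_le[OF _ l1 l2]) (simp, rule eventually_mono[OF ev], use sq in blast)
  moreover have "g 1 * (\<Sum>i<Suc n. ((1::real)\<^sup>2) ^ i) \<le> pi"
    by (rule tendsto_upperbound[OF l1]) (rule eventually_mono[OF ev], use sq in blast, simp)
  ultimately have "g 1 * (real n + 1) = pi" by (simp add: add.commute)
  then have "g 1 = pi / (real n + 1)" by (simp add: field_simps)
  with scale[OF assms] show ?thesis unfolding g_def by (simp add: mult.commute)
qed

lemma integral_ball_monomial_eq:
  assumes "0 < r"
  shows "(LINT w|lborel. indicator (ball 0 r) w *\<^sub>R (w ^ n * cnj w ^ n)) = complex_of_real (pi * r ^ (2 * n + 2) / (n + 1))"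
proof -
  have "(LINT w|lborel. indicator (ball 0 r) w *\<^sub>R (w ^ n * cnj w ^ n))
      = (LINT w|lborel. complex_of_real (indicator (ball (0::complex) r) w * (cmod w) ^ (2 * n)))"
    by (rule Bochner_Integration.integral_cong)
       (auto simp: scaleR_conv_of_real power_mult_distrib[symmetric] complex_norm_square[symmetric] power_mult)
  also have "\<dots> = complex_of_real (LINT w|lborel. indicator (ball (0::complex) r) w * (cmod w) ^ (2 * n))"
    by (rule integral_complex_of_real)
  finally show ?thesis using integral_ball_norm_power[OF assms, of n] by simp
qed

section \<open>The Bergman space on the disc\<close>

text \<open>\<open>dA\<close> lives on the whole plane, where a function known only to be
  holomorphic on the disc need not be measurable. On the restricted space continuity on the disc
  suffices, whatever the values elsewhere.\<close>

definition nu :: "complex measure" where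
  "nu = restrict_space dA disc"

definition bergman :: "(complex \<Rightarrow> complex) set" where
  "bergman = {f. f holomorphic_on disc \<and> integrable nu (\<lambda>z. (cmod (f z))\<^sup>2)}"

lemma open_disc [simp]: "open disc"
  by (simp add: disc_def)

lemma sets_disc [measurable, simp]: "disc \<in> sets borel"
  by (rule borel_open) simp

lemma in_disc: "z \<in> disc \<longleftrightarrow> cmod z < 1"
  by (simp add: disc_def)

lemma space_dA [simp]: "space dA = UNIV" and sets_dA [simp, measurable_cong]: "sets dA = sets borel"
  by (simp_all add: dA_def)

lemma space_nu [simp]: "space nu = disc"
  by (simp add: nu_def space_restrict_space)

lemma sets_nu [measurable_cong]: "sets nu = sets (restrict_space borel disc)"
  by (simp add: nu_def sets_restrict_space)

lemma borel_measurable_nu_continuous: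
  "continuous_on disc f \<Longrightarrow> f \<in> borel_measurable nu"
  unfolding measurable_cong_sets[OF sets_nu refl] by (rule borel_measurable_continuous_on_restrict)

lemma borel_measurable_nu_iff:
  fixes f :: "complex \<Rightarrow> 'b::real_normed_vector"
  shows "f \<in> borel_measurable nu \<longleftrightarrow> (\<lambda>w. indicator disc w *\<^sub>R f w) \<in> borel_measurable borel"
  unfolding measurable_cong_sets[OF sets_nu refl] by (subst borel_measurable_restrict_space_iff) auto

lemma integrable_scaleR_iff:
  fixes f :: "'a \<Rightarrow> 'b::{banach, second_countable_topology}"
  assumes "c \<noteq> 0"
  shows "integrable M (\<lambda>x. c *\<^sub>R f x) \<longleftrightarrow> integrable M f"
  using integrable_scaleR_right[of c M f] integrable_scaleR_right[of "inverse c" M "\<lambda>x. c *\<^sub>R f x"] assms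
  by auto

lemma
  fixes f :: "complex \<Rightarrow> 'b::{banach, second_countable_topology}"
  assumes "f \<in> borel_measurable nu"
  shows integral_nu: "integral\<^sup>L nu f = (1 / pi) *\<^sub>R (LINT w|lborel. indicator disc w *\<^sub>R f w)"
    and integrable_nu_iff: "integrable nu f \<longleftrightarrow> integrable lborel (\<lambda>w. indicator disc w *\<^sub>R f w)"
proof -
  have [measurable]: "(\<lambda>w. indicator disc w *\<^sub>R f w) \<in> borel_measurable borel"
    using assms by (simp only: borel_measurable_nu_iff)
  have eq: "(indicator disc w / pi) *\<^sub>R indicator disc w *\<^sub>R f w = (1 / pi) *\<^sub>R indicator disc w *\<^sub>R f w" for w
    by (simp add: indicator_def)
  have "integral\<^sup>L nu f = (LINT w|dA. indicator disc w *\<^sub>R f w)"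
    unfolding nu_def by (rule integral_restrict_space) simp
  also have "\<dots> = (LINT w|lborel. (indicator disc w / pi) *\<^sub>R indicator disc w *\<^sub>R f w)"
    unfolding dA_def by (rule integral_density) auto
  finally show "integral\<^sup>L nu f = (1 / pi) *\<^sub>R (LINT w|lborel. indicator disc w *\<^sub>R f w)"
    by (simp only: eq integral_scaleR_right)
  have "integrable nu f \<longleftrightarrow> integrable dA (\<lambda>w. indicator disc w *\<^sub>R f w)"
    unfolding nu_def by (rule integrable_restrict_space) simp
  also have "\<dots> \<longleftrightarrow> integrable lborel (\<lambda>w. (indicator disc w / pi) *\<^sub>R indicator disc w *\<^sub>R f w)"
    unfolding dA_def by (rule integrable_density) auto
  also have "\<dots> \<longleftrightarrow> integrable lborel (\<lambda>w. indicator disc w *\<^sub>R f w)"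
    by (simp only: eq, rule integrable_scaleR_iff) simp
  finally show "integrable nu f \<longleftrightarrow> integrable lborel (\<lambda>w. indicator disc w *\<^sub>R f w)" .
qed

lemma borel_measurable_indicator_ball_nu [measurable]:
  "(indicator (ball z r) :: complex \<Rightarrow> real) \<in> borel_measurable nu"
  unfolding borel_measurable_nu_iff
  by (intro borel_measurable_scaleR borel_measurable_indicator) auto

lemma indicator_ball_disc:
  "ball z r \<subseteq> disc \<Longrightarrow> indicator disc w *\<^sub>R indicator (ball z r) w *\<^sub>R f w = indicator (ball z r) w *\<^sub>R (f w::'b::real_vector)"
  by (auto simp: indicator_def)

text \<open>Borel measurability on the whole plane is what makes the two sides comparable: a
  function that is not measurable off the disc has \<open>dA\<close> integral 0 by convention, even
  if it is well behaved on the disc.\<close>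

lemma integral_dA_eq_nu:
  fixes f :: "complex \<Rightarrow> 'b::{banach, second_countable_topology}"
  assumes [measurable]: "f \<in> borel_measurable borel"
  shows "integral\<^sup>L dA f = integral\<^sup>L nu f"
    and "integrable dA f \<longleftrightarrow> integrable nu f"
proof -
  have m: "f \<in> borel_measurable nu"
    unfolding borel_measurable_nu_iff by measurable
  have eq: "(indicator disc w / pi) *\<^sub>R f w = (1 / pi) *\<^sub>R indicator disc w *\<^sub>R f w" for w
    by simp
  have "integral\<^sup>L dA f = (LINT w|lborel. (indicator disc w / pi) *\<^sub>R f w)"
    unfolding dA_def by (rule integral_density) auto
  then show "integral\<^sup>L dA f = integral\<^sup>L nu f"
    by (simp only: eq integral_scaleR_right integral_nu[OF m])
  have "integrable dA f \<longleftrightarrow> integrable lborel (\<lambda>w. (indicator disc w / pi) *\<^sub>R f w)"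
    unfolding dA_def by (rule integrable_density) auto
  also have "\<dots> \<longleftrightarrow> integrable lborel (\<lambda>w. indicator disc w *\<^sub>R f w)"
    by (simp only: eq, rule integrable_scaleR_iff) simp
  finally show "integrable dA f \<longleftrightarrow> integrable nu f"
    by (simp only: integrable_nu_iff[OF m])
qed

lemma integrable_const_disc: "integrable lborel (indicator disc :: _ \<Rightarrow> real)"
  using integrable_indicator_ball[of 0 1 "\<lambda>_. 1::real"] by (simp add: disc_def)

lemma finite_measure_nu: "finite_measure nu"
proof -
  have m: "(\<lambda>_. 1::real) \<in> borel_measurable nu" by simp
  have "integrable nu (\<lambda>_. 1::real)"
    by (subst integrable_nu_iff[OF m]) (simp add: integrable_const_disc)
  then have "emeasure nu (space nu) < \<infinity>"
    by (simp add: integrable_iff_bounded)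
  then show ?thesis by (intro finite_measureI) simp
qed

interpretation nu: finite_measure nu
  by (rule finite_measure_nu)

lemma integral_nu_ball:
  fixes f :: "complex \<Rightarrow> 'b::{banach, second_countable_topology}"
  assumes "continuous_on disc f" "ball z r \<subseteq> disc"
  shows "(LINT w|nu. indicator (ball z r) w *\<^sub>R f w) = (1 / pi) *\<^sub>R (LINT w|lborel. indicator (ball z r) w *\<^sub>R f w)"
proof -
  have "f \<in> borel_measurable nu"
    by (rule borel_measurable_nu_continuous[OF assms(1)])
  then have "(\<lambda>w. indicator (ball z r) w *\<^sub>R f w) \<in> borel_measurable nu"
    by (intro borel_measurable_scaleR borel_measurable_indicator_ball_nu)
  then show ?thesis
    by (subst integral_nu) (simp_all add: indicator_ball_disc[OF assms(2)] del: scaleR_scaleR)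
qed

lemma integral_nu_indicator_ball:
  assumes "ball z r \<subseteq> disc" "r \<ge> 0"
  shows "(LINT w|nu. indicator (ball z r) w) = r\<^sup>2"
  using integral_nu_ball[OF _ assms(1), of "\<lambda>_. 1::real"] assms(2)
  by (simp add: measure_ball_complex)

section \<open>Cauchy-Schwarz and sums of square-integrable functions\<close>

lemma
  fixes f g :: "'a \<Rightarrow> complex"
  assumes [measurable]: "f \<in> borel_measurable M" "g \<in> borel_measurable M"
    and f: "integrable M (\<lambda>x. (cmod (f x))\<^sup>2)" and g: "integrable M (\<lambda>x. (cmod (g x))\<^sup>2)"
  shows integrable_mult_L2: "integrable M (\<lambda>x. f x * cnj (g x))"
    and Cauchy_Schwarz_L2: "(cmod (LINT x|M. f x * cnj (g x)))\<^sup>2 \<le> (LINT x|M. (cmod (f x))\<^sup>2) * (LINT x|M. (cmod (g x))\<^sup>2)"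
proof -
  have int: "integrable M (\<lambda>x. (cmod (f x))\<^sup>2 + (cmod (g x))\<^sup>2)"
    using f g by simp
  have bd: "cmod (f x) * cmod (g x) \<le> (cmod (f x))\<^sup>2 + (cmod (g x))\<^sup>2" for x
    using sum_squares_bound[of "cmod (f x)" "cmod (g x)"] mult_nonneg_nonneg[of "cmod (f x)" "cmod (g x)"]
    unfolding mult.assoc by (smt (verit) norm_ge_zero)
  show "integrable M (\<lambda>x. f x * cnj (g x))"
    by (rule Bochner_Integration.integrable_bound[OF int]) (use bd in \<open>auto simp: norm_mult\<close>)
  have 2: "integrable M (\<lambda>x. cmod (f x) * cmod (g x))"
    by (rule Bochner_Integration.integrable_bound[OF int]) (use bd in \<open>auto simp: norm_mult\<close>)
  have "(\<integral>\<^sup>+x. ennreal (cmod (f x)) * ennreal (cmod (g x)) \<partial>M)\<^sup>2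
      \<le> (\<integral>\<^sup>+x. ennreal (cmod (f x)) ^ 2 \<partial>M) * (\<integral>\<^sup>+x. ennreal (cmod (g x)) ^ 2 \<partial>M)"
    by (rule Cauchy_Schwarz_nn_integral) measurable
  also have "(\<integral>\<^sup>+x. ennreal (cmod (f x)) * ennreal (cmod (g x)) \<partial>M) = ennreal (LINT x|M. cmod (f x) * cmod (g x))"
    by (subst nn_integral_eq_integral[OF 2, symmetric]) (simp_all add: ennreal_mult)
  also have "(\<integral>\<^sup>+x. ennreal (cmod (f x)) ^ 2 \<partial>M) = ennreal (LINT x|M. (cmod (f x))\<^sup>2)"
    by (subst nn_integral_eq_integral[OF f, symmetric]) (simp_all add: ennreal_power)
  also have "(\<integral>\<^sup>+x. ennreal (cmod (g x)) ^ 2 \<partial>M) = ennreal (LINT x|M. (cmod (g x))\<^sup>2)"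
    by (subst nn_integral_eq_integral[OF g, symmetric]) (simp_all add: ennreal_power)
  finally have 3: "(LINT x|M. cmod (f x) * cmod (g x))\<^sup>2 \<le> (LINT x|M. (cmod (f x))\<^sup>2) * (LINT x|M. (cmod (g x))\<^sup>2)"
    by (simp add: ennreal_power ennreal_mult[symmetric] integral_nonneg ennreal_le_iff)
  have "cmod (LINT x|M. f x * cnj (g x)) \<le> (LINT x|M. cmod (f x) * cmod (g x))"
    using integral_norm_bound[of M "\<lambda>x. f x * cnj (g x)"] by (simp add: norm_mult)
  then have "(cmod (LINT x|M. f x * cnj (g x)))\<^sup>2 \<le> (LINT x|M. cmod (f x) * cmod (g x))\<^sup>2"
    by (rule power_mono) simp
  with 3 show "(cmod (LINT x|M. f x * cnj (g x)))\<^sup>2 \<le> (LINT x|M. (cmod (f x))\<^sup>2) * (LINT x|M. (cmod (g x))\<^sup>2)"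
    by linarith
qed

lemma
  fixes f g :: "'a \<Rightarrow> complex"
  assumes [measurable]: "f \<in> borel_measurable M" "g \<in> borel_measurable M"
    and f: "integrable M (\<lambda>x. (cmod (f x))\<^sup>2)" and g: "integrable M (\<lambda>x. (cmod (g x))\<^sup>2)"
  shows integrable_L2_add: "integrable M (\<lambda>x. (cmod (f x + g x))\<^sup>2)"
    and integrable_L2_diff: "integrable M (\<lambda>x. (cmod (f x - g x))\<^sup>2)"
    and integral_L2_add_le: "(LINT x|M. (cmod (f x + g x))\<^sup>2) \<le> 2 * (LINT x|M. (cmod (f x))\<^sup>2) + 2 * (LINT x|M. (cmod (g x))\<^sup>2)"
    and integral_L2_diff_le: "(LINT x|M. (cmod (f x - g x))\<^sup>2) \<le> 2 * (LINT x|M. (cmod (f x))\<^sup>2) + 2 * (LINT x|M. (cmod (g x))\<^sup>2)"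
proof -
  have int: "integrable M (\<lambda>x. 2 * (cmod (f x))\<^sup>2 + 2 * (cmod (g x))\<^sup>2)"
    using f g by simp
  have sq: "c\<^sup>2 \<le> 2 * a\<^sup>2 + 2 * b\<^sup>2" if "0 \<le> c" "c \<le> a + b" for a b c :: real
  proof -
    have "c\<^sup>2 \<le> (a + b)\<^sup>2" by (rule power_mono) (use that in auto)
    also have "\<dots> \<le> 2 * a\<^sup>2 + 2 * b\<^sup>2"
      using sum_squares_bound[of a b] by (simp add: power2_sum)
    finally show ?thesis .
  qed
  have bd: "(cmod (f x + g x))\<^sup>2 \<le> 2 * (cmod (f x))\<^sup>2 + 2 * (cmod (g x))\<^sup>2"
    "(cmod (f x - g x))\<^sup>2 \<le> 2 * (cmod (f x))\<^sup>2 + 2 * (cmod (g x))\<^sup>2" for x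
    by (intro sq norm_ge_zero norm_triangle_ineq norm_triangle_ineq4)+
  show 1: "integrable M (\<lambda>x. (cmod (f x + g x))\<^sup>2)"
    by (rule Bochner_Integration.integrable_bound[OF int]) (use bd in auto)
  show 2: "integrable M (\<lambda>x. (cmod (f x - g x))\<^sup>2)"
    by (rule Bochner_Integration.integrable_bound[OF int]) (use bd in auto)
  show "(LINT x|M. (cmod (f x + g x))\<^sup>2) \<le> 2 * (LINT x|M. (cmod (f x))\<^sup>2) + 2 * (LINT x|M. (cmod (g x))\<^sup>2)"
    using integral_mono[OF 1 int bd(1)] f g by simp
  show "(LINT x|M. (cmod (f x - g x))\<^sup>2) \<le> 2 * (LINT x|M. (cmod (f x))\<^sup>2) + 2 * (LINT x|M. (cmod (g x))\<^sup>2)"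
    using integral_mono[OF 2 int bd(2)] f g by simp
qed

section \<open>Membership in the Bergman space\<close>

lemma bergmanD:
  assumes "f \<in> bergman"
  shows "f holomorphic_on disc" "continuous_on disc f" "f \<in> borel_measurable nu"
    "integrable nu (\<lambda>z. (cmod (f z))\<^sup>2)" "integrable nu f" "integrable nu (\<lambda>z. cmod (f z))"
proof -
  show 1: "f holomorphic_on disc" and 2: "integrable nu (\<lambda>z. (cmod (f z))\<^sup>2)"
    using assms by (auto simp: bergman_def)
  show 3: "continuous_on disc f"
    using 1 by (rule holomorphic_on_imp_continuous_on)
  show 4: "f \<in> borel_measurable nu"
    using 3 by (rule borel_measurable_nu_continuous)
  show "integrable nu f"
    using integrable_mult_L2[of f nu "\<lambda>_. 1"] 2 4 by simp
  then show "integrable nu (\<lambda>z. cmod (f z))" by simp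
qed

lemma integrable_indicator_bergman:
  assumes f: "f \<in> bergman" and "A \<in> sets borel"
  shows "integrable nu (\<lambda>w. indicator A w * (cmod (f w))\<^sup>2)"
proof (rule Bochner_Integration.integrable_bound[OF bergmanD(4)[OF f]])
  have [measurable]: "f \<in> borel_measurable nu" by (rule bergmanD[OF f])
  have [measurable]: "(indicator A :: complex \<Rightarrow> real) \<in> borel_measurable nu"
    unfolding borel_measurable_nu_iff
    by (intro borel_measurable_scaleR borel_measurable_indicator assms) simp
  show "(\<lambda>w. indicator A w * (cmod (f w))\<^sup>2) \<in> borel_measurable nu" by measurable
  show "AE w in nu. norm (indicator A w * (cmod (f w))\<^sup>2) \<le> norm ((cmod (f w))\<^sup>2)"
    by (rule AE_I2) (auto simp: indicator_def)
qed

lemma bergman_bounded: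
  assumes "f holomorphic_on disc" "\<And>z. z \<in> disc \<Longrightarrow> cmod (f z) \<le> B"
  shows "f \<in> bergman"
proof -
  have "f \<in> borel_measurable nu"
    using assms(1) by (intro borel_measurable_nu_continuous holomorphic_on_imp_continuous_on)
  then have "integrable nu (\<lambda>z. (cmod (f z))\<^sup>2)"
    by (intro nu.integrable_const_bound[where B="B\<^sup>2"] AE_I2)
       (use assms(2) in \<open>auto intro!: power_mono\<close>)
  with assms(1) show ?thesis by (simp add: bergman_def)
qed

lemma bergman_add: "f \<in> bergman \<Longrightarrow> g \<in> bergman \<Longrightarrow> (\<lambda>z. f z + g z) \<in> bergman"
  and bergman_diff: "f \<in> bergman \<Longrightarrow> g \<in> bergman \<Longrightarrow> (\<lambda>z. f z - g z) \<in> bergman"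
  and bergman_cmult: "f \<in> bergman \<Longrightarrow> (\<lambda>z. c * f z) \<in> bergman"
proof -
  assume f: "f \<in> bergman"
  then show "(\<lambda>z. c * f z) \<in> bergman"
    by (simp add: bergman_def norm_mult power_mult_distrib holomorphic_intros)
  assume g: "g \<in> bergman"
  show "(\<lambda>z. f z + g z) \<in> bergman" "(\<lambda>z. f z - g z) \<in> bergman"
    using bergmanD(1,3,4)[OF f] bergmanD(1,3,4)[OF g]
    by (simp_all add: bergman_def integrable_L2_add integrable_L2_diff holomorphic_on_add holomorphic_on_diff)
qed

lemma bergman_poly: "poly p \<in> bergman"
proof -
  have "compact (poly p ` cball 0 1)"
    by (intro compact_continuous_image continuous_intros compact_cball)
  then obtain B where "\<And>z. z \<in> cball 0 1 \<Longrightarrow> cmod (poly p z) \<le> B"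
    using compact_imp_bounded[THEN bounded_iff[THEN iffD1]] by (metis imageI)
  then show ?thesis
    by (intro bergman_bounded[of _ B] holomorphic_intros) (auto simp: disc_def)
qed

section \<open>Taylor coefficients as area integrals\<close>

text \<open>Expand h in its Taylor series at 0 and integrate term by term; by orthogonality of the
  monomials only the term n = j survives.\<close>

lemma integral_ball_coeff:
  assumes h: "h holomorphic_on ball 0 R" and r: "0 < r" "r < R"
  shows "(LINT w|lborel. indicator (ball 0 r) w *\<^sub>R (h w * cnj w ^ j))
     = of_real (pi * r ^ (2 * j + 2) / (j + 1)) * ((deriv ^^ j) h 0 / fact j)"
proof -
  define a where "a n = (deriv ^^ n) h 0 / fact n" for n
  have sums: "(\<lambda>n. a n * w ^ n) sums h w" if "w \<in> ball 0 R" for w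
    using holomorphic_power_series[OF h that] by (simp add: a_def)
  \<comment> \<open>A point strictly between r and R: convergence there gives absolute convergence
    at r, the majorant for termwise integration.\<close>
  have "summable (\<lambda>n. a n * (of_real ((r + R) / 2)) ^ n)"
    using r by (intro sums_summable[OF sums]) (simp only: mem_ball_0 norm_of_real, simp)
  then have "summable (\<lambda>n. norm (a n * of_real r ^ n))"
    by (rule powser_insidea) (use r in \<open>simp only: norm_of_real, simp\<close>)
  then have summ: "summable (\<lambda>n. cmod (a n) * r ^ n)"
    using r by (simp add: norm_mult norm_power)
  let ?t = "\<lambda>n w. indicator (ball 0 r) w *\<^sub>R (a n * (w ^ n * cnj w ^ j))"
  have intt: "integrable lborel (?t n)" for n
    by (intro integrable_indicator_ball continuous_intros)
  have bound: "norm (?t n w) \<le> cmod (a n) * r ^ n * (r ^ j * indicator (ball 0 r) w)" for n w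
  proof (cases "w \<in> ball 0 r")
    case True
    then have "norm (?t n w) = cmod (a n) * (cmod w ^ n * cmod w ^ j)"
      by (simp add: norm_mult norm_power)
    also have "\<dots> \<le> cmod (a n) * (r ^ n * r ^ j)"
      using True r by (intro mult_left_mono mult_mono power_mono) auto
    finally show ?thesis using True by (simp add: mult_ac)
  qed simp
  have intb: "integrable lborel (\<lambda>w. c * (r ^ j * indicator (ball (0::complex) r) w))" for c
    using integrable_indicator_ball[of 0 r "\<lambda>_. 1::real"] by simp
  have "(\<lambda>n. LINT w|lborel. ?t n w) sums (LINT w|lborel. (\<Sum>n. ?t n w))"
  proof (rule sums_integral[OF intt])
    show "AE w in lborel. summable (\<lambda>n. norm (?t n w))"
    proof (rule AE_I2)
      fix w :: complex
      show "summable (\<lambda>n. norm (?t n w))"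
        by (rule summable_comparison_test'[OF summable_mult2[OF summ]]) (use bound in simp)
    qed
    show "summable (\<lambda>n. LINT w|lborel. norm (?t n w))"
    proof (rule summable_comparison_test'[OF summable_mult2[OF summ]])
      fix n
      have "(LINT w|lborel. norm (?t n w)) \<le> (LINT w|lborel. cmod (a n) * r ^ n * (r ^ j * indicator (ball (0::complex) r) w))"
        by (intro integral_mono integrable_norm intt intb bound)
      also have "\<dots> = cmod (a n) * r ^ n * (r ^ j * (pi * r\<^sup>2))"
        using r by (simp add: measure_ball_complex)
      finally show "norm (LINT w|lborel. norm (?t n w)) \<le> cmod (a n) * r ^ n * (r ^ j * (pi * r\<^sup>2))"
        by simp
    qed
  qed
  also have "(LINT w|lborel. (\<Sum>n. ?t n w)) = (LINT w|lborel. indicator (ball 0 r) w *\<^sub>R (h w * cnj w ^ j))"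
  proof (rule Bochner_Integration.integral_cong[OF refl])
    fix w :: complex
    show "(\<Sum>n. ?t n w) = indicator (ball 0 r) w *\<^sub>R (h w * cnj w ^ j)"
    proof (cases "w \<in> ball 0 r")
      case True
      have "(\<lambda>n. a n * w ^ n * cnj w ^ j) sums (h w * cnj w ^ j)"
        by (intro sums_mult2 sums) (use True r in auto)
      then show ?thesis using True by (simp add: sums_iff mult.assoc)
    qed simp
  qed
  finally have S: "(\<lambda>n. LINT w|lborel. ?t n w) sums (LINT w|lborel. indicator (ball 0 r) w *\<^sub>R (h w * cnj w ^ j))" .
  have "(LINT w|lborel. ?t n w) = (if n = j then a j * of_real (pi * r ^ (2 * j + 2) / (j + 1)) else 0)" for n
  proof -
    have "(LINT w|lborel. ?t n w) = (LINT w|lborel. a n * (indicator (ball 0 r) w *\<^sub>R (w ^ n * cnj w ^ j)))"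
      by (rule Bochner_Integration.integral_cong) auto
    also have "\<dots> = a n * (LINT w|lborel. indicator (ball 0 r) w *\<^sub>R (w ^ n * cnj w ^ j))"
      by (rule integral_mult_right_zero)
    finally show ?thesis
      using integral_ball_monomial_neq[of n j r] integral_ball_monomial_eq[OF r(1), of j] by auto
  qed
  with S have "(\<lambda>n. if n = j then a j * of_real (pi * r ^ (2 * j + 2) / (j + 1)) else 0)
      sums (LINT w|lborel. indicator (ball 0 r) w *\<^sub>R (h w * cnj w ^ j))"
    by simp
  from sums_unique2[OF this sums_single[of j "\<lambda>_. a j * of_real (pi * r ^ (2 * j + 2) / (j + 1))"]]
  show ?thesis by (simp add: a_def mult.commute)
qed

lemma ball_subset_disc: "cmod z + r \<le> 1 \<Longrightarrow> ball z r \<subseteq> disc"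
  unfolding disc_def by (intro ball_subset_ball_iff[THEN iffD2]) (auto simp: dist_norm)

lemma integral_translate:
  fixes f :: "complex \<Rightarrow> 'b::{banach, second_countable_topology}"
  assumes [measurable]: "f \<in> borel_measurable borel"
  shows "(LINT w|lborel. f (z + w)) = integral\<^sup>L lborel f"
proof -
  have "(LINT w|lborel. f (z + w)) = integral\<^sup>L (distr lborel borel ((+) z)) f"
    by (subst integral_distr) auto
  then show ?thesis by (simp add: lborel_distr_plus)
qed

text \<open>The coefficient formula at 0 applied to the translate of f by z, which is holomorphic on
  the ball of radius 1 - |z| > r. For j = 0 this is the mean value property.\<close>

lemma higher_deriv_local:
  assumes f: "f holomorphic_on disc" and r: "0 < r" "cmod z + r < 1"
  shows "(LINT w|nu. indicator (ball z r) w *\<^sub>R (f w * cnj (w - z) ^ j))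
     = of_real (r ^ (2 * j + 2) / (j + 1)) * ((deriv ^^ j) f z / fact j)"
proof -
  have c: "continuous_on disc (\<lambda>w. f w * cnj (w - z) ^ j)"
    using f by (intro continuous_intros holomorphic_on_imp_continuous_on)
  have sub: "ball z r \<subseteq> disc" using r by (intro ball_subset_disc) auto
  have m: "(\<lambda>w. indicator (ball z r) w *\<^sub>R (f w * cnj (w - z) ^ j)) \<in> borel_measurable borel"
    using continuous_on_subset[OF c sub]
    by (intro borel_measurable_continuous_on_indicator) auto
  have h: "(f \<circ> (+) z) holomorphic_on ball 0 (1 - cmod z)"
  proof (rule holomorphic_on_compose_gen[OF _ f])
    show "(+) z ` ball 0 (1 - cmod z) \<subseteq> disc"
    proof
      fix w assume "w \<in> (+) z ` ball 0 (1 - cmod z)"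
      then have "cmod (w - z) < 1 - cmod z" by (simp add: dist_norm norm_minus_commute)
      then show "w \<in> disc"
        using norm_triangle_ineq[of z "w - z"] by (simp add: in_disc)
    qed
  qed (auto intro!: holomorphic_intros)
  have "(LINT w|nu. indicator (ball z r) w *\<^sub>R (f w * cnj (w - z) ^ j))
      = (1 / pi) *\<^sub>R (LINT w|lborel. indicator (ball z r) w *\<^sub>R (f w * cnj (w - z) ^ j))"
    by (rule integral_nu_ball[OF c sub])
  also have "(LINT w|lborel. indicator (ball z r) w *\<^sub>R (f w * cnj (w - z) ^ j))
      = (LINT w|lborel. indicator (ball z r) (z + w) *\<^sub>R (f (z + w) * cnj (z + w - z) ^ j))"
    by (rule integral_translate[OF m, symmetric])
  also have "\<dots> = (LINT w|lborel. indicator (ball 0 r) w *\<^sub>R ((f \<circ> (+) z) w * cnj w ^ j))"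
    by (rule Bochner_Integration.integral_cong) (auto simp: indicator_def dist_norm)
  also have "\<dots> = of_real (pi * r ^ (2 * j + 2) / (j + 1)) * ((deriv ^^ j) (f \<circ> (+) z) 0 / fact j)"
    using r by (intro integral_ball_coeff[OF h]) auto
  also have "(deriv ^^ j) (f \<circ> (+) z) 0 = (deriv ^^ j) f z"
    by (subst higher_deriv_shift_0) (simp add: o_def)
  finally show ?thesis by (simp add: scaleR_conv_of_real)
qed

text \<open>The local formula at the origin with r tending to 1. As the powers of w are bounded by 1
  on the disc, |f| dominates, and it is integrable because the measure is finite.\<close>

lemma bergman_coeff:
  assumes f: "f \<in> bergman"
  shows "(LINT w|nu. f w * cnj w ^ j) = (deriv ^^ j) f 0 / fact j / (j + 1)"
proof -
  \<comment> \<open>The double successor keeps r n strictly positive already at n = 0.\<close>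
  define r where "r n = 1 - inverse (real (Suc (Suc n)))" for n
  have r: "0 < r n" "r n < 1" for n by (auto simp: r_def field_simps)
  have rlim: "r \<longlonglongrightarrow> 1"
    unfolding r_def using tendsto_diff[OF tendsto_const LIMSEQ_Suc[OF LIMSEQ_inverse_real_of_nat], of 1] by simp
  note fD = bergmanD[OF f]
  have [measurable]: "f \<in> borel_measurable nu" "cnj \<in> borel_measurable nu"
    "(\<lambda>w. cnj w ^ j) \<in> borel_measurable nu"
    by (auto intro!: fD borel_measurable_nu_continuous continuous_intros)
  have lim1: "(\<lambda>n. LINT w|nu. indicator (ball 0 (r n)) w *\<^sub>R (f w * cnj w ^ j)) \<longlonglongrightarrow> (LINT w|nu. f w * cnj w ^ j)"
  proof (rule integral_dominated_convergence[where w="\<lambda>w. cmod (f w)"])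
    show "(\<lambda>w. f w * cnj w ^ j) \<in> borel_measurable nu" by measurable
    show "(\<lambda>w. indicator (ball 0 (r n)) w *\<^sub>R (f w * cnj w ^ j)) \<in> borel_measurable nu" for n
      by measurable
    show "integrable nu (\<lambda>w. cmod (f w))" by (rule fD)
    show "AE w in nu. (\<lambda>n. indicator (ball 0 (r n)) w *\<^sub>R (f w * cnj w ^ j)) \<longlonglongrightarrow> f w * cnj w ^ j"
    proof (rule AE_I2, simp)
      fix w assume "w \<in> disc"
      then have "eventually (\<lambda>n. cmod w < r n) sequentially"
        using rlim by (intro order_tendstoD(1)) (auto simp: in_disc)
      then show "(\<lambda>n. indicator (ball 0 (r n)) w *\<^sub>R (f w * cnj w ^ j)) \<longlonglongrightarrow> f w * cnj w ^ j"
        by (intro tendsto_eventually) (auto elim: eventually_mono)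
    qed
    show "AE w in nu. norm (indicator (ball 0 (r n)) w *\<^sub>R (f w * cnj w ^ j)) \<le> cmod (f w)" for n
      by (rule AE_I2) (auto simp: indicator_def norm_mult norm_power in_disc intro!: mult_left_le power_le_one)
  qed
  have lim2: "(\<lambda>n. LINT w|nu. indicator (ball 0 (r n)) w *\<^sub>R (f w * cnj w ^ j)) \<longlonglongrightarrow>
      of_real (1 ^ (2 * j + 2) / (j + 1)) * ((deriv ^^ j) f 0 / fact j)"
  proof -
    have "(\<lambda>n. LINT w|nu. indicator (ball 0 (r n)) w *\<^sub>R (f w * cnj w ^ j))
        = (\<lambda>n. of_real (r n ^ (2 * j + 2) / (j + 1)) * ((deriv ^^ j) f 0 / fact j))"
      using higher_deriv_local[OF fD(1), of "r _" 0 j] r by simp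
    then show ?thesis by (simp only:) (intro tendsto_intros rlim; simp)
  qed
  show ?thesis
    using LIMSEQ_unique[OF lim1 lim2] by simp
qed

section \<open>Derivatives at a point and the kernels of the rank-one operators\<close>

text \<open>On the disc this is \<open>U z (e k)\<close> divided by 1 - |z|^2. For k = 0 it is minus
  the Bergman reproducing kernel, because \<open>phi z\<close> has derivative -(1 - |z|^2) / (1 -
  cnj z * w)^2.\<close>

definition kern :: "nat \<Rightarrow> complex \<Rightarrow> complex \<Rightarrow> complex" where
  "kern k z \<zeta> = - of_real (sqrt (real k + 1)) * (z - \<zeta>) ^ k / (1 - cnj z * \<zeta>) ^ (k + 2)"

text \<open>The map \<open>F\<close> of the overview: dividing by 1 - |z|^2 absorbs half of the
  weight (1 - |z|^2)^(-2) into each of the two factors of the form.\<close>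

definition ucoeff :: "nat \<Rightarrow> (complex \<Rightarrow> complex) \<Rightarrow> complex \<Rightarrow> complex" where
  "ucoeff k f z = (LINT \<zeta>|nu. f \<zeta> * cnj (kern k z \<zeta>))"

text \<open>Induction on p: multiply by the geometric series and collect the coefficients with the
  hockey-stick identity. Absolute summability is carried along because the Cauchy product demands
  it.\<close>

lemma sums_negative_binomial:
  fixes x :: complex
  assumes "norm x < 1"
  shows "summable (\<lambda>m. real ((p + m) choose p) * norm x ^ m)"
    and "(\<lambda>m. of_nat ((p + m) choose p) * x ^ m) sums (1 / (1 - x) ^ Suc p)"
proof -
  have *: "summable (\<lambda>m. real ((p + m) choose p) * norm x ^ m) \<and>
      (\<lambda>m. of_nat ((p + m) choose p) * x ^ m) sums (1 / (1 - x) ^ Suc p)" (is "?P p")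
  proof (induction p)
    case 0
    then show ?case using assms geometric_sums[of x] by (simp add: summable_geometric)
  next
    case (Suc p)
    have geo: "summable (\<lambda>m. norm (norm x ^ m))" "summable (\<lambda>m. norm (x ^ m))"
      using assms by (simp_all add: summable_geometric norm_power)
    have abs: "summable (\<lambda>m. norm (real ((p + m) choose p) * norm x ^ m))"
      "summable (\<lambda>m. norm (of_nat ((p + m) choose p) * x ^ m))"
      using Suc by (simp_all add: norm_mult norm_power)
    have rising: "(\<Sum>i\<le>m. (p + i) choose p) = (Suc p + m) choose Suc p" for m
      using choose_rising_sum(1)[of p m] by simp
    have "(\<Sum>i\<le>m. real ((p + i) choose p) * norm x ^ i * norm x ^ (m - i)) = real ((Suc p + m) choose Suc p) * norm x ^ m" for m
    proof -
      have "(\<Sum>i\<le>m. real ((p + i) choose p) * norm x ^ i * norm x ^ (m - i)) = (\<Sum>i\<le>m. real ((p + i) choose p) * norm x ^ m)"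
        by (intro sum.cong) (simp_all add: power_add[symmetric] mult.assoc)
      also have "\<dots> = real ((Suc p + m) choose Suc p) * norm x ^ m"
        by (simp only: sum_distrib_right[symmetric] of_nat_sum[symmetric] rising)
      finally show ?thesis .
    qed
    then have 1: "summable (\<lambda>m. real ((Suc p + m) choose Suc p) * norm x ^ m)"
      using summable_Cauchy_product[OF abs(1) geo(1)] by (simp only:)
    have "(\<Sum>i\<le>m. of_nat ((p + i) choose p) * x ^ i * x ^ (m - i)) = of_nat ((Suc p + m) choose Suc p) * x ^ m" for m
    proof -
      have "(\<Sum>i\<le>m. of_nat ((p + i) choose p) * x ^ i * x ^ (m - i)) = (\<Sum>i\<le>m. of_nat ((p + i) choose p) * x ^ m)"
        by (intro sum.cong) (simp_all add: power_add[symmetric] mult.assoc)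
      also have "\<dots> = of_nat ((Suc p + m) choose Suc p) * x ^ m"
        by (simp only: sum_distrib_right[symmetric] of_nat_sum[symmetric] rising)
      finally show ?thesis .
    qed
    moreover have "suminf (\<lambda>m. of_nat ((p + m) choose p) * x ^ m) = 1 / (1 - x) ^ Suc p"
      "suminf (\<lambda>m. x ^ m) = 1 / (1 - x)"
      using Suc geometric_sums[OF assms] by (auto simp: sums_iff)
    ultimately have "(\<lambda>m. of_nat ((Suc p + m) choose Suc p) * x ^ m) sums (1 / (1 - x) ^ Suc p * (1 / (1 - x)))"
      using Cauchy_product_sums[OF abs(2) geo(2)] by (simp only:)
    then show ?case using 1 by (simp add: mult.commute)
  qed
  then show "summable (\<lambda>m. real ((p + m) choose p) * norm x ^ m)"
    "(\<lambda>m. of_nat ((p + m) choose p) * x ^ m) sums (1 / (1 - x) ^ Suc p)" by auto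
qed

lemma norm_mult_disc_less_1:
  assumes "z \<in> disc" "w \<in> disc"
  shows "cmod (z * w) < 1"
  using assms mult_strict_mono'[of "cmod z" 1 "cmod w" 1] by (simp add: in_disc norm_mult)

lemma continuous_cnj_power: "continuous_on S (\<lambda>w. cnj w ^ n)"
  by (intro continuous_intros)

lemma integrable_bergman_cnj_power:
  assumes "f \<in> bergman"
  shows "integrable nu (\<lambda>w. f w * cnj w ^ n)"
proof (rule Bochner_Integration.integrable_bound[OF bergmanD(6)[OF assms]])
  show "(\<lambda>w. f w * cnj w ^ n) \<in> borel_measurable nu"
    by (intro borel_measurable_times bergmanD[OF assms] borel_measurable_nu_continuous continuous_cnj_power)
  show "AE w in nu. norm (f w * cnj w ^ n) \<le> norm (cmod (f w))"
    by (rule AE_I2) (auto simp: norm_mult norm_power in_disc intro!: mult_left_le power_le_one)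
qed

text \<open>Expanding the kernel in powers of \<open>cnj w\<close> reduces the reproducing property of the
  (derivatives of the) Bergman kernel to the Taylor coefficients at \<open>0\<close>.\<close>

lemma reproducing_derivative:
  assumes f: "f \<in> bergman" and z: "z \<in> disc"
  shows "(LINT w|nu. f w * (cnj w ^ j / (1 - z * cnj w) ^ (j + 2))) = (deriv ^^ j) f z / fact (j + 1)"
proof -
  \<comment> \<open>Coefficient of the m-th power of z * cnj w in the expansion of (1 - z * cnj
    w)^(-(j+2)).\<close>
  define B where "B m = ((Suc j + m) choose Suc j)" for m
  let ?t = "\<lambda>m w. (of_nat (B m) * z ^ m) * (f w * cnj w ^ (m + j))"
  have cz: "cmod z < 1" using z by (simp add: in_disc)
  have summ: "summable (\<lambda>m. real (B m) * cmod z ^ m)"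
    using sums_negative_binomial(1)[of z "Suc j"] cz by (simp add: B_def)
  have intt: "integrable nu (?t m)" for m
    by (intro integrable_mult_right integrable_bergman_cnj_power f)
  have bound: "norm (?t m w) \<le> real (B m) * cmod z ^ m * cmod (f w)" if "w \<in> disc" for m w
  proof -
    have "norm (?t m w) = real (B m) * cmod z ^ m * (cmod (f w) * cmod w ^ (m + j))"
      by (simp add: norm_mult norm_power)
    also have "\<dots> \<le> real (B m) * cmod z ^ m * (cmod (f w) * 1)"
      using that by (intro mult_left_mono power_le_one) (auto simp: in_disc)
    finally show ?thesis by simp
  qed
  have "(\<lambda>m. LINT w|nu. ?t m w) sums (LINT w|nu. (\<Sum>m. ?t m w))"
  proof (rule sums_integral[OF intt])
    show "AE w in nu. summable (\<lambda>m. norm (?t m w))"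
    proof (rule AE_I2)
      fix w assume "w \<in> space nu"
      then show "summable (\<lambda>m. norm (?t m w))"
        by (intro summable_comparison_test'[OF summable_mult2[OF summ]]) (use bound in simp)
    qed
    show "summable (\<lambda>m. LINT w|nu. norm (?t m w))"
    proof (rule summable_comparison_test'[OF summable_mult2[OF summ]])
      fix m
      have "(LINT w|nu. norm (?t m w)) \<le> (LINT w|nu. real (B m) * cmod z ^ m * cmod (f w))"
        by (intro integral_mono integrable_norm intt integrable_mult_right bergmanD[OF f]) (use bound in simp)
      also have "\<dots> = real (B m) * cmod z ^ m * (LINT w|nu. cmod (f w))"
        by simp
      finally show "norm (LINT w|nu. norm (?t m w)) \<le> real (B m) * cmod z ^ m * (LINT w|nu. cmod (f w))"
        by simp
    qed
  qed
  also have "(LINT w|nu. (\<Sum>m. ?t m w)) = (LINT w|nu. f w * (cnj w ^ j / (1 - z * cnj w) ^ (j + 2)))"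
  proof (rule Bochner_Integration.integral_cong[OF refl])
    fix w assume "w \<in> space nu"
    then have "cmod (z * cnj w) < 1"
      using norm_mult_disc_less_1[OF z, of "cnj w"] by (simp add: in_disc)
    from sums_negative_binomial(2)[OF this, of "Suc j"]
    have "(\<lambda>m. f w * cnj w ^ j * (of_nat (B m) * (z * cnj w) ^ m)) sums (f w * cnj w ^ j * (1 / (1 - z * cnj w) ^ Suc (Suc j)))"
      unfolding B_def by (rule sums_mult)
    moreover have "f w * cnj w ^ j * (of_nat (B m) * (z * cnj w) ^ m) = ?t m w" for m
      by (simp add: power_mult_distrib power_add mult_ac)
    ultimately have "(\<lambda>m. ?t m w) sums (f w * cnj w ^ j * (1 / (1 - z * cnj w) ^ Suc (Suc j)))"
      by (simp only:)
    then show "(\<Sum>m. ?t m w) = f w * (cnj w ^ j / (1 - z * cnj w) ^ (j + 2))"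
      by (simp add: sums_iff)
  qed
  finally have S: "(\<lambda>m. LINT w|nu. ?t m w) sums (LINT w|nu. f w * (cnj w ^ j / (1 - z * cnj w) ^ (j + 2)))" .
  \<comment> \<open>The coefficient of index m + j of f is read as a Taylor coefficient of index m
    of the j-th derivative of f; the binomial \<open>B m\<close> supplies exactly the factorials for
    this, leaving 1 / (j+1)!. The sum is then a Taylor series evaluated at z.\<close>
  have t: "(LINT w|nu. ?t m w) = (deriv ^^ m) ((deriv ^^ j) f) 0 / fact m * (z - 0) ^ m / fact (j + 1)" for m
  proof -
    have "(LINT w|nu. ?t m w) = (of_nat (B m) * z ^ m) * (LINT w|nu. f w * cnj w ^ (m + j))"
      by (rule integral_mult_right_zero)
    also have "\<dots> = (of_nat (B m) / (fact (m + j) * of_nat (m + j + 1))) * (z ^ m * (deriv ^^ (m + j)) f 0)"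
      unfolding bergman_coeff[OF f] by (simp add: divide_inverse mult_ac)
    also have "of_nat (B m) / (fact (m + j) * of_nat (m + j + 1)) = (1 / (fact (Suc j) * fact m) :: complex)"
    proof -
      have "of_nat (B m) = (fact (Suc j + m) / (fact (Suc j) * fact m) :: complex)"
        unfolding B_def by (subst binomial_fact) simp_all
      moreover have "(fact (Suc j + m) :: complex) = fact (m + j) * of_nat (m + j + 1)"
        by (simp add: add_ac)
      moreover have "(fact (m + j) * of_nat (m + j + 1) :: complex) \<noteq> 0"
        using fact_nonzero of_nat_neq_0[of "m + j"] by (simp del: of_nat_Suc)
      ultimately show ?thesis by (simp only: divide_divide_eq_left) (simp add: divide_simps)
    qed
    finally show ?thesis by (simp add: funpow_add divide_inverse mult_ac)
  qed
  have hol: "(deriv ^^ j) f holomorphic_on ball 0 1"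
    using bergmanD(1)[OF f] unfolding disc_def by (intro holomorphic_higher_deriv) auto
  have "(\<lambda>m. (deriv ^^ m) ((deriv ^^ j) f) 0 / fact m * (z - 0) ^ m) sums ((deriv ^^ j) f z)"
    by (rule holomorphic_power_series[OF hol]) (use z in \<open>simp add: disc_def\<close>)
  then have "(\<lambda>m. LINT w|nu. ?t m w) sums ((deriv ^^ j) f z / fact (j + 1))"
    unfolding t by (rule sums_divide)
  with S show ?thesis by (rule sums_unique2)
qed

text \<open>The last bound says that \<open>phi z\<close> maps the disc into the closed unit disc;
  it follows from |1 - cnj z * w|^2 - |z - w|^2 = (1 - |z|^2) * (1 - |w|^2).\<close>

lemma one_minus_cnj_mult_bounds:
  assumes "z \<in> disc" "w \<in> disc"
  shows "1 - cmod z \<le> cmod (1 - cnj z * w)" "1 - cnj z * w \<noteq> 0" "cmod (z - w) \<le> cmod (1 - cnj z * w)"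
proof -
  have "cmod (cnj z * w) \<le> cmod z"
    using assms by (simp add: norm_mult in_disc mult_left_le)
  then show 1: "1 - cmod z \<le> cmod (1 - cnj z * w)"
    using norm_triangle_ineq2[of 1 "cnj z * w"] by simp
  show "1 - cnj z * w \<noteq> 0" using 1 assms by (auto simp: in_disc)
  have "(cmod z)\<^sup>2 \<le> 1" "(cmod w)\<^sup>2 \<le> 1"
    using assms by (auto simp: in_disc abs_square_le_1)
  then have "0 \<le> (1 - (cmod z)\<^sup>2) * (1 - (cmod w)\<^sup>2)"
    by simp
  also have "\<dots> = (cmod (1 - cnj z * w))\<^sup>2 - (cmod (z - w))\<^sup>2"
    unfolding cmod_power2 by (simp add: power2_eq_square algebra_simps)
  finally show "cmod (z - w) \<le> cmod (1 - cnj z * w)"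
    by (simp add: power2_le_iff_abs_le)
qed

lemma cmod_kern_0: "cmod (kern 0 z w) = 1 / (cmod (1 - cnj z * w))\<^sup>2"
  by (simp add: kern_def norm_divide norm_mult power2_eq_square)

text \<open>Up to sign the kernel of order k is sqrt (k+1) times the kernel of order 0 times the
  k-th power of \<open>phi z\<close>, whose modulus is at most 1.\<close>

lemma cmod_kern_le:
  assumes "z \<in> disc" "w \<in> disc"
  shows "cmod (kern k z w) \<le> sqrt (real k + 1) * cmod (kern 0 z w)"
proof -
  note b = one_minus_cnj_mult_bounds[OF assms]
  have "cmod (kern k z w) = sqrt (real k + 1) * cmod (z - w) ^ k / cmod (1 - cnj z * w) ^ (k + 2)"
    by (simp add: kern_def norm_divide norm_mult norm_power del: power_Suc)
  also have "\<dots> \<le> sqrt (real k + 1) * cmod (1 - cnj z * w) ^ k / cmod (1 - cnj z * w) ^ (k + 2)"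
    by (intro divide_right_mono mult_left_mono power_mono b) auto
  also have "\<dots> = sqrt (real k + 1) * cmod (kern 0 z w)"
    using b(2) by (simp add: power_add cmod_kern_0 power2_eq_square)
  finally show ?thesis .
qed

lemma kern_bergman:
  assumes "z \<in> disc"
  shows "kern k z \<in> bergman"
proof (rule bergman_bounded)
  show "kern k z holomorphic_on disc"
    unfolding kern_def using one_minus_cnj_mult_bounds(2)[OF assms]
    by (intro holomorphic_intros) auto
  fix w assume w: "w \<in> disc"
  note b = one_minus_cnj_mult_bounds[OF assms w]
  have pos: "0 < 1 - cmod z" using assms by (simp add: in_disc)
  have "cmod (kern k z w) \<le> sqrt (real k + 1) * (1 / (cmod (1 - cnj z * w))\<^sup>2)"
    using cmod_kern_le[OF assms w] by (simp only: cmod_kern_0)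
  also have "\<dots> \<le> sqrt (real k + 1) * (1 / (1 - cmod z)\<^sup>2)"
    using pos b by (intro mult_left_mono divide_left_mono power_mono mult_pos_pos zero_less_power) auto
  finally show "cmod (kern k z w) \<le> sqrt (real k + 1) * (1 / (1 - cmod z)\<^sup>2)" .
qed

lemma integrable_mult_kern:
  assumes "f \<in> bergman" "z \<in> disc"
  shows "integrable nu (\<lambda>w. f w * cnj (kern k z w))"
  using assms by (intro integrable_mult_L2 bergmanD kern_bergman)

text \<open>With u = 1 - z * cnj w one has cnj z - cnj w = -(1 - |z|^2) * cnj w + cnj z * u. The
  binomial theorem splits the conjugate kernel into multiples of cnj w^j / u^(j+2), and each of
  these reproduces the j-th derivative at z.\<close>

lemma ucoeff_eq_sum_derivatives:
  assumes f: "f \<in> bergman" and z: "z \<in> disc"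
  shows "ucoeff k f z = - of_real (sqrt (real k + 1)) *
    (\<Sum>j\<le>k. of_nat (k choose j) * (- of_real (1 - (cmod z)\<^sup>2)) ^ j * cnj z ^ (k - j) * ((deriv ^^ j) f z / fact (j + 1)))"
proof -
  let ?c = "\<lambda>j. of_nat (k choose j) * (- of_real (1 - (cmod z)\<^sup>2)) ^ j * cnj z ^ (k - j)"
  let ?K = "\<lambda>j w. cnj w ^ j / (1 - z * cnj w) ^ (j + 2)"
  have cnjG: "cnj (kern k z w) = - of_real (sqrt (real k + 1)) * (\<Sum>j\<le>k. ?c j * ?K j w)" if w: "w \<in> disc" for w
  proof -
    define u where "u = 1 - z * cnj w"
    have u: "u \<noteq> 0"
      using one_minus_cnj_mult_bounds(2)[OF z w] unfolding u_def
      by (metis complex_cnj_cnj complex_cnj_diff complex_cnj_mult complex_cnj_one complex_cnj_zero)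
    have "cnj z - cnj w = (- of_real (1 - (cmod z)\<^sup>2)) * cnj w + cnj z * u"
      unfolding u_def complex_norm_square of_real_diff of_real_1 by (simp add: algebra_simps)
    then have "(cnj z - cnj w) ^ k = (\<Sum>j\<le>k. of_nat (k choose j) * ((- of_real (1 - (cmod z)\<^sup>2)) * cnj w) ^ j * (cnj z * u) ^ (k - j))"
      by (simp only: binomial_ring)
    then have "(cnj z - cnj w) ^ k / u ^ (k + 2)
        = (\<Sum>j\<le>k. of_nat (k choose j) * ((- of_real (1 - (cmod z)\<^sup>2)) * cnj w) ^ j * (cnj z * u) ^ (k - j) / u ^ (k + 2))"
      by (simp only: sum_divide_distrib)
    also have "\<dots> = (\<Sum>j\<le>k. ?c j * (cnj w ^ j / u ^ (j + 2)))"
    proof (rule sum.cong[OF refl])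
      fix j assume "j \<in> {..k}"
      then have "u ^ (k + 2) = u ^ (k - j) * u ^ (j + 2)"
        by (simp only: power_add[symmetric]) simp
      then show "of_nat (k choose j) * ((- of_real (1 - (cmod z)\<^sup>2)) * cnj w) ^ j * (cnj z * u) ^ (k - j) / u ^ (k + 2)
          = ?c j * (cnj w ^ j / u ^ (j + 2))"
        using u unfolding power_mult_distrib by (simp del: of_real_diff power_Suc add: mult_ac)
    qed
    finally have "(cnj z - cnj w) ^ k / u ^ (k + 2) = (\<Sum>j\<le>k. ?c j * (cnj w ^ j / u ^ (j + 2)))" .
    moreover have "cnj (kern k z w) = - of_real (sqrt (real k + 1)) * ((cnj z - cnj w) ^ k / u ^ (k + 2))"
      unfolding kern_def u_def by (simp del: power_Suc)
    ultimately show ?thesis by (simp only: u_def)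
  qed
  have intK: "integrable nu (\<lambda>w. f w * ?K j w)" for j
  proof -
    have "(\<lambda>w. w ^ j / (1 - cnj z * w) ^ (j + 2)) \<in> bergman"
    proof (rule bergman_bounded)
      show "(\<lambda>w. w ^ j / (1 - cnj z * w) ^ (j + 2)) holomorphic_on disc"
        using one_minus_cnj_mult_bounds(2)[OF z] by (intro holomorphic_intros) auto
      fix w assume w: "w \<in> disc"
      have "cmod (w ^ j / (1 - cnj z * w) ^ (j + 2)) \<le> 1 / (1 - cmod z) ^ (j + 2)"
        unfolding norm_divide norm_power using one_minus_cnj_mult_bounds[OF z w] w z
        by (intro frac_le power_le_one power_mono zero_less_power) (auto simp: in_disc)
      then show "cmod (w ^ j / (1 - cnj z * w) ^ (j + 2)) \<le> 1 / (1 - cmod z) ^ (j + 2)" .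
    qed
    note K = bergmanD(3,4)[OF this]
    have "cnj (w ^ j / (1 - cnj z * w) ^ (j + 2)) = ?K j w" for w
      by (simp del: power_Suc)
    then show ?thesis
      using integrable_mult_L2[OF bergmanD(3)[OF f] K(1) bergmanD(4)[OF f] K(2)] by (simp only:)
  qed
  have "ucoeff k f z = (LINT w|nu. - of_real (sqrt (real k + 1)) * (\<Sum>j\<le>k. ?c j * (f w * ?K j w)))"
    unfolding ucoeff_def
  proof (rule Bochner_Integration.integral_cong[OF refl])
    fix w assume "w \<in> space nu"
    then have "f w * cnj (kern k z w) = - of_real (sqrt (real k + 1)) * (f w * (\<Sum>j\<le>k. ?c j * ?K j w))"
      using cnjG[of w] by (simp only: space_nu mult_ac)
    also have "f w * (\<Sum>j\<le>k. ?c j * ?K j w) = (\<Sum>j\<le>k. ?c j * (f w * ?K j w))"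
      unfolding sum_distrib_left by (intro sum.cong refl) (simp only: mult_ac)
    finally show "f w * cnj (kern k z w) = - of_real (sqrt (real k + 1)) * (\<Sum>j\<le>k. ?c j * (f w * ?K j w))" .
  qed
  also have "\<dots> = - of_real (sqrt (real k + 1)) * (\<Sum>j\<le>k. ?c j * (LINT w|nu. f w * ?K j w))"
    by (subst integral_mult_right_zero, subst Bochner_Integration.integral_sum)
       (auto simp only: integral_mult_right_zero intro!: integrable_mult_right intK)
  finally show ?thesis
    unfolding reproducing_derivative[OF f z] .
qed

lemma ucoeff_0:
  assumes "f \<in> bergman" "z \<in> disc"
  shows "ucoeff 0 f z = - f z"
  unfolding ucoeff_eq_sum_derivatives[OF assms] by simp

text \<open>The reproducing property applied to the kernel itself: its squared norm is its value on
  the diagonal, up to the sign.\<close>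

lemma integral_kern_0:
  assumes "z \<in> disc"
  shows "(LINT w|nu. (cmod (kern 0 z w))\<^sup>2) = 1 / (1 - (cmod z)\<^sup>2)\<^sup>2"
proof -
  have "complex_of_real (LINT w|nu. (cmod (kern 0 z w))\<^sup>2) = ucoeff 0 (kern 0 z) z"
    unfolding ucoeff_def by (subst integral_complex_of_real[symmetric]) (simp only: complex_norm_square)
  also have "\<dots> = 1 / (1 - cnj z * z)\<^sup>2"
    using ucoeff_0[OF kern_bergman[OF assms] assms, of 0] by (simp add: kern_def power2_eq_square)
  also have "1 - cnj z * z = of_real (1 - (cmod z)\<^sup>2)"
    unfolding of_real_diff of_real_1 complex_norm_square by (simp add: mult.commute)
  also have "1 / (complex_of_real (1 - (cmod z)\<^sup>2))\<^sup>2 = complex_of_real (1 / (1 - (cmod z)\<^sup>2)\<^sup>2)"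
    by (simp only: of_real_divide of_real_power of_real_1)
  finally show ?thesis by (simp only: of_real_eq_iff)
qed

text \<open>As \<open>U z\<close> is unitary, the exact value carries 1 in place of k + 1. The loss
  comes from bounding \<open>phi z\<close> by 1 pointwise and only affects constants.\<close>

lemma integral_kern_le:
  assumes "z \<in> disc"
  shows "(LINT w|nu. (cmod (kern k z w))\<^sup>2) \<le> (real k + 1) / (1 - (cmod z)\<^sup>2)\<^sup>2"
proof -
  have "(LINT w|nu. (cmod (kern k z w))\<^sup>2) \<le> (LINT w|nu. (real k + 1) * (cmod (kern 0 z w))\<^sup>2)"
  proof (intro integral_mono integrable_mult_right bergmanD kern_bergman assms)
    fix w assume "w \<in> space nu"
    then have "(cmod (kern k z w))\<^sup>2 \<le> (sqrt (real k + 1) * cmod (kern 0 z w))\<^sup>2"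
      using assms by (intro power_mono cmod_kern_le) auto
    then show "(cmod (kern k z w))\<^sup>2 \<le> (real k + 1) * (cmod (kern 0 z w))\<^sup>2"
      by (simp add: power_mult_distrib)
  qed
  then show ?thesis by (simp add: integral_kern_0[OF assms])
qed

lemma ucoeff_continuous:
  assumes "f \<in> bergman"
  shows "continuous_on disc (ucoeff k f)"
proof -
  have d: "continuous_on disc ((deriv ^^ j) f)" for j
    by (intro holomorphic_on_imp_continuous_on holomorphic_higher_deriv bergmanD(1) assms open_disc)
  have "continuous_on disc (\<lambda>z. - of_real (sqrt (real k + 1)) *
    (\<Sum>j\<le>k. of_nat (k choose j) * (- of_real (1 - (cmod z)\<^sup>2)) ^ j * cnj z ^ (k - j) * ((deriv ^^ j) f z / fact (j + 1))))"
    by (intro continuous_intros d ballI fact_nonzero)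
  then show ?thesis
    by (rule continuous_on_eq) (simp only: ucoeff_eq_sum_derivatives[OF assms])
qed

lemma ucoeff_add:
  assumes "f \<in> bergman" "g \<in> bergman" "z \<in> disc"
  shows "ucoeff k (\<lambda>w. f w + g w) z = ucoeff k f z + ucoeff k g z"
  unfolding ucoeff_def distrib_right
  by (rule Bochner_Integration.integral_add) (intro integrable_mult_kern assms)+

lemma ucoeff_diff:
  assumes "f \<in> bergman" "g \<in> bergman" "z \<in> disc"
  shows "ucoeff k (\<lambda>w. f w - g w) z = ucoeff k f z - ucoeff k g z"
  unfolding ucoeff_def left_diff_distrib
  by (rule Bochner_Integration.integral_diff) (intro integrable_mult_kern assms)+

lemma ucoeff_cmult: "ucoeff k (\<lambda>w. c * f w) z = c * ucoeff k f z"
  unfolding ucoeff_def mult.assoc by (rule integral_mult_right_zero)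

section \<open>Local bounds by the mass of f near z\<close>

text \<open>The area formula for the derivative is an inner product of f with (w - z)^j on the ball;
  the squared norm of the latter is at most R^(2j+2), and Cauchy-Schwarz gives the power
  R^(-(j+1)).\<close>

lemma derivative_local_bound:
  assumes f: "f \<in> bergman" and R: "0 < R" "cmod z + R < 1"
  shows "cmod ((deriv ^^ j) f z / fact (j + 1)) \<le> sqrt (LINT w|nu. indicator (ball z R) w * (cmod (f w))\<^sup>2) / R ^ (j + 1)"
proof -
  let ?D = "LINT w|nu. indicator (ball z R) w * (cmod (f w))\<^sup>2"
  let ?f = "\<lambda>w. indicator (ball z R) w *\<^sub>R f w" and ?g = "\<lambda>w. indicator (ball z R) w *\<^sub>R (w - z) ^ j"
  have [measurable]: "f \<in> borel_measurable nu" "(\<lambda>w. (w - z) ^ j) \<in> borel_measurable nu"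
    by (intro bergmanD f borel_measurable_nu_continuous continuous_intros)+
  have sqf: "(\<lambda>w. (cmod (?f w))\<^sup>2) = (\<lambda>w. indicator (ball z R) w * (cmod (f w))\<^sup>2)"
    by (auto simp: indicator_def)
  have intf: "integrable nu (\<lambda>w. (cmod (?f w))\<^sup>2)"
  proof (rule Bochner_Integration.integrable_bound[OF bergmanD(4)[OF f]])
    show "(\<lambda>w. (cmod (?f w))\<^sup>2) \<in> borel_measurable nu" by measurable
    show "AE w in nu. norm ((cmod (?f w))\<^sup>2) \<le> norm ((cmod (f w))\<^sup>2)"
      by (rule AE_I2) (auto simp: indicator_def)
  qed
  have gle: "(cmod (?g w))\<^sup>2 \<le> R ^ (2 * j) * indicator (ball z R) w" for w
  proof (cases "w \<in> ball z R")
    case True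
    then have "cmod (w - z) ^ (2 * j) \<le> R ^ (2 * j)"
      by (intro power_mono) (auto simp: dist_norm norm_minus_commute)
    then show ?thesis using True by (simp add: norm_power power_mult[symmetric] mult.commute)
  qed simp
  have intb: "integrable nu (\<lambda>w. R ^ (2 * j) * indicator (ball z R) w :: real)"
    by (intro integrable_mult_right nu.integrable_const_bound[where B=1] borel_measurable_indicator_ball_nu)
       (auto simp: indicator_def)
  have intg: "integrable nu (\<lambda>w. (cmod (?g w))\<^sup>2)"
  proof (rule Bochner_Integration.integrable_bound[OF intb])
    show "(\<lambda>w. (cmod (?g w))\<^sup>2) \<in> borel_measurable nu" by measurable
    show "AE w in nu. norm ((cmod (?g w))\<^sup>2) \<le> norm (R ^ (2 * j) * indicator (ball z R) w :: real)"
    proof (rule AE_I2)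
      fix w
      show "norm ((cmod (?g w))\<^sup>2) \<le> norm (R ^ (2 * j) * indicator (ball z R) w :: real)"
        unfolding real_norm_def
        by (subst (1 2) abs_of_nonneg) (use R gle[of w] in \<open>simp_all del: norm_scaleR\<close>)
    qed
  qed
  have sub: "ball z R \<subseteq> disc" using R by (intro ball_subset_disc) auto
  have "(LINT w|nu. (cmod (?g w))\<^sup>2) \<le> (LINT w|nu. R ^ (2 * j) * indicator (ball z R) w)"
    by (intro integral_mono intg intb gle)
  also have "\<dots> = R ^ (2 * j + 2)"
    using integral_nu_indicator_ball[OF sub] R by (simp add: power_add power2_eq_square)
  finally have g: "(LINT w|nu. (cmod (?g w))\<^sup>2) \<le> R ^ (2 * j + 2)" .
  have "of_real (R ^ (2 * j + 2)) * ((deriv ^^ j) f z / fact (j + 1)) = (LINT w|nu. ?f w * cnj (?g w))"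
  proof -
    have "(LINT w|nu. ?f w * cnj (?g w)) = (LINT w|nu. indicator (ball z R) w *\<^sub>R (f w * cnj (w - z) ^ j))"
      by (rule Bochner_Integration.integral_cong) (auto simp: indicator_def)
    then show ?thesis
      unfolding higher_deriv_local[OF bergmanD(1)[OF f] R] by (simp add: mult_ac add_ac)
  qed
  moreover have "R ^ (2 * j + 2) * cmod ((deriv ^^ j) f z / fact (j + 1))
      = cmod (of_real (R ^ (2 * j + 2)) * ((deriv ^^ j) f z / fact (j + 1)))"
    unfolding norm_mult norm_of_real using R by simp
  ultimately have "(R ^ (2 * j + 2) * cmod ((deriv ^^ j) f z / fact (j + 1)))\<^sup>2 = (cmod (LINT w|nu. ?f w * cnj (?g w)))\<^sup>2"
    by (simp only:)
  also have "\<dots> \<le> (LINT w|nu. (cmod (?f w))\<^sup>2) * (LINT w|nu. (cmod (?g w))\<^sup>2)"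
    by (intro Cauchy_Schwarz_L2 intf intg) measurable
  also have "\<dots> \<le> ?D * R ^ (2 * j + 2)"
    unfolding sqf by (intro mult_left_mono g Bochner_Integration.integral_nonneg) auto
  also have "\<dots> = (sqrt ?D * R ^ (j + 1))\<^sup>2"
  proof -
    have "?D \<ge> 0" by (intro Bochner_Integration.integral_nonneg) auto
    moreover have "(j + 1) * 2 = 2 * j + 2" by simp
    ultimately show ?thesis
      by (simp only: power_mult_distrib real_sqrt_pow2 power_mult[symmetric])
  qed
  finally have "R ^ (2 * j + 2) * cmod ((deriv ^^ j) f z / fact (j + 1)) \<le> sqrt ?D * R ^ (j + 1)"
  proof (rule power2_le_imp_le)
    show "0 \<le> sqrt ?D * R ^ (j + 1)"
      using R by (intro mult_nonneg_nonneg real_sqrt_ge_zero Bochner_Integration.integral_nonneg) auto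
  qed
  moreover have "R ^ (2 * j + 2) = R ^ (j + 1) * R ^ (j + 1)"
    by (simp only: power_add[symmetric], rule arg_cong[of _ _ "power R"]) simp
  ultimately have "R ^ (j + 1) * (cmod ((deriv ^^ j) f z / fact (j + 1)) * R ^ (j + 1)) \<le> R ^ (j + 1) * sqrt ?D"
    by (simp only: mult_ac)
  then have "cmod ((deriv ^^ j) f z / fact (j + 1)) * R ^ (j + 1) \<le> sqrt ?D"
    using R by (simp only: mult_le_cancel_left_pos zero_less_power)
  then show ?thesis
    using R by (simp only: pos_le_divide_eq zero_less_power)
qed

text \<open>With R = s * (1 - |z|) one has 1 - |z|^2 \<le> (2 / s) * R, so the weights of the
  derivative formula cancel all powers of R but one. The binomial sum of the powers of 2 / s is (1 +
  2 / s)^k.\<close>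

lemma ucoeff_local_bound:
  assumes f: "f \<in> bergman" and z: "z \<in> disc" and s: "0 < s" "s < 1"
  shows "(cmod (ucoeff k f z))\<^sup>2 \<le> ((real k + 1) * (1 + 2 / s) ^ (2 * k) / s\<^sup>2) / (1 - cmod z)\<^sup>2 *
     (LINT w|nu. indicator (ball z (s * (1 - cmod z))) w * (cmod (f w))\<^sup>2)"
proof -
  define R where "R = s * (1 - cmod z)"
  let ?D = "LINT w|nu. indicator (ball z R) w * (cmod (f w))\<^sup>2"
  have D: "?D \<ge> 0" by (intro Bochner_Integration.integral_nonneg) auto
  have cz: "0 < 1 - cmod z" using z by (simp add: in_disc)
  have R: "0 < R" "cmod z + R < 1"
  proof -
    show "0 < R" unfolding R_def by (rule mult_pos_pos[OF s(1) cz])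
    have "R < 1 - cmod z" using mult_strict_right_mono[OF s(2) cz] by (simp only: R_def mult_1)
    then show "cmod z + R < 1" by linarith
  qed
  have t: "\<bar>1 - (cmod z)\<^sup>2\<bar> \<le> 2 / s * R"
  proof -
    have "1 - (cmod z)\<^sup>2 = (1 - cmod z) * (1 + cmod z)"
      by (simp add: power2_eq_square algebra_simps)
    moreover have "0 \<le> (1 - cmod z) * (1 + cmod z)"
      using cz by simp
    ultimately have "\<bar>1 - (cmod z)\<^sup>2\<bar> = (1 - cmod z) * (1 + cmod z)"
      by simp
    also have "\<dots> \<le> (1 - cmod z) * 2" using cz by (intro mult_left_mono) auto
    finally show ?thesis using s by (simp add: R_def)
  qed
  have "cmod (ucoeff k f z) \<le> sqrt (real k + 1) * (\<Sum>j\<le>k. real (k choose j) * (2 / s) ^ j * (sqrt ?D / R))"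
  proof -
    have "cmod (\<Sum>j\<le>k. of_nat (k choose j) * (- of_real (1 - (cmod z)\<^sup>2)) ^ j * cnj z ^ (k - j) * ((deriv ^^ j) f z / fact (j + 1)))
        \<le> (\<Sum>j\<le>k. real (k choose j) * (2 / s) ^ j * (sqrt ?D / R))"
    proof (rule sum_norm_le)
      fix j assume "j \<in> {..k}"
      have "norm (of_nat (k choose j) * (- of_real (1 - (cmod z)\<^sup>2)) ^ j * cnj z ^ (k - j) * ((deriv ^^ j) f z / fact (j + 1)))
          = real (k choose j) * \<bar>1 - (cmod z)\<^sup>2\<bar> ^ j * cmod z ^ (k - j) * cmod ((deriv ^^ j) f z / fact (j + 1))"
        by (simp only: norm_mult norm_power norm_of_nat norm_minus_cancel norm_of_real complex_mod_cnj)
      also have "\<dots> \<le> real (k choose j) * (2 / s * R) ^ j * 1 * (sqrt ?D / R ^ (j + 1))"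
        using t R s cz
        by (intro mult_mono mult_nonneg_nonneg power_mono power_le_one derivative_local_bound f) auto
      also have "\<dots> = real (k choose j) * (2 / s) ^ j * (sqrt ?D / R)"
        using R by (simp add: power_mult_distrib power_divide)
      finally show "norm (of_nat (k choose j) * (- of_real (1 - (cmod z)\<^sup>2)) ^ j * cnj z ^ (k - j) * ((deriv ^^ j) f z / fact (j + 1)))
          \<le> real (k choose j) * (2 / s) ^ j * (sqrt ?D / R)" .
    qed
    then show ?thesis
      unfolding ucoeff_eq_sum_derivatives[OF f z] norm_mult norm_minus_cancel norm_of_real
      by (simp add: mult_left_mono)
  qed
  also have "(\<Sum>j\<le>k. real (k choose j) * (2 / s) ^ j * (sqrt ?D / R)) = (1 + 2 / s) ^ k * (sqrt ?D / R)"
    unfolding sum_distrib_right[symmetric] using binomial_ring[of "2 / s" 1 k] by (simp add: add.commute)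
  finally have "(cmod (ucoeff k f z))\<^sup>2 \<le> (sqrt (real k + 1) * ((1 + 2 / s) ^ k * (sqrt ?D / R)))\<^sup>2"
    by (rule power_mono) simp
  also have "\<dots> = ((real k + 1) * (1 + 2 / s) ^ (2 * k) / s\<^sup>2) / (1 - cmod z)\<^sup>2 * ?D"
    using D by (simp add: power_mult_distrib power_divide power_mult[symmetric] R_def mult.commute[of k 2])
  finally show ?thesis by (simp only: R_def)
qed

section \<open>From \<open>U z (e k)\<close> to its normalized kernel\<close>

text \<open>\<open>inner_A2\<close> integrates over the plane, so \<open>U z (e k)\<close> has to be
  Borel off the disc as well; there the derivative of \<open>phi z\<close> is a rational function
  except possibly at one point.\<close>

lemma measurable_U_e: "U z (e k) \<in> borel_measurable borel"
  and U_e_eq: "w \<in> disc \<Longrightarrow> z \<in> disc \<Longrightarrow> U z (e k) w = of_real (1 - (cmod z)\<^sup>2) * kern k z w"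
proof -
  have deriv: "deriv (phi z) w = - of_real (1 - (cmod z)\<^sup>2) / (1 - cnj z * w)\<^sup>2" if "1 - cnj z * w \<noteq> 0" for w
  proof -
    have "((\<lambda>w. (z - w) / (1 - cnj z * w)) has_field_derivative
        ((0 - 1) * (1 - cnj z * w) - (z - w) * (0 - cnj z)) / ((1 - cnj z * w) * (1 - cnj z * w))) (at w)"
      using that by (auto intro!: derivative_eq_intros)
    also have "((0 - 1) * (1 - cnj z * w) - (z - w) * (0 - cnj z)) / ((1 - cnj z * w) * (1 - cnj z * w))
        = - of_real (1 - (cmod z)\<^sup>2) / (1 - cnj z * w)\<^sup>2"
      unfolding of_real_diff of_real_1 complex_norm_square by (simp add: power2_eq_square algebra_simps)
    finally show ?thesis
      unfolding phi_def[abs_def] by (rule DERIV_imp_deriv)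
  qed
  \<comment> \<open>The zero of the denominator, where \<open>deriv\<close> has some unspecified
    value; one exceptional point does not disturb measurability.\<close>
  define c where "c = deriv (phi z) (1 / cnj z)"
  have eq: "deriv (phi z) = (\<lambda>w. if w = 1 / cnj z \<and> z \<noteq> 0 then c
      else - of_real (1 - (cmod z)\<^sup>2) / (1 - cnj z * w)\<^sup>2)"
  proof
    fix w
    show "deriv (phi z) w = (if w = 1 / cnj z \<and> z \<noteq> 0 then c
      else - of_real (1 - (cmod z)\<^sup>2) / (1 - cnj z * w)\<^sup>2)"
    proof (cases "1 - cnj z * w = 0")
      case True
      then have "z \<noteq> 0" "cnj z * w = 1" by auto
      then have "w = 1 / cnj z" by (simp add: field_simps)
      with \<open>z \<noteq> 0\<close> show ?thesis by (simp add: c_def)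
    next
      case False
      have "\<not> (w = 1 / cnj z \<and> z \<noteq> 0)"
      proof
        assume "w = 1 / cnj z \<and> z \<noteq> 0"
        then have "cnj z * w = 1" by simp
        with False show False by simp
      qed
      with deriv[OF False] show ?thesis by (simp only: if_False)
    qed
  qed
  then have [measurable]: "deriv (phi z) \<in> borel_measurable borel"
    unfolding eq by measurable
  have [measurable]: "phi z \<in> borel_measurable borel"
    unfolding phi_def[abs_def] by measurable
  show "U z (e k) \<in> borel_measurable borel"
    unfolding U_def e_def by measurable
  assume "w \<in> disc" "z \<in> disc"
  then have "1 - cnj z * w \<noteq> 0" by (intro one_minus_cnj_mult_bounds)
  then show "U z (e k) w = of_real (1 - (cmod z)\<^sup>2) * kern k z w"
    unfolding U_def e_def kern_def deriv[OF \<open>1 - cnj z * w \<noteq> 0\<close>] phi_def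
    by (simp add: power_divide power2_eq_square mult_ac del: of_real_diff)
qed

lemma inner_A2_U_e:
  assumes [measurable]: "f \<in> borel_measurable borel" and z: "z \<in> disc"
  shows "inner_A2 f (U z (e k)) = of_real (1 - (cmod z)\<^sup>2) * ucoeff k f z"
proof -
  note [measurable] = measurable_U_e
  have "inner_A2 f (U z (e k)) = (LINT w|nu. f w * cnj (U z (e k) w))"
    unfolding inner_A2_def by (rule integral_dA_eq_nu) measurable
  also have "\<dots> = (LINT w|nu. of_real (1 - (cmod z)\<^sup>2) * (f w * cnj (kern k z w)))"
    by (rule Bochner_Integration.integral_cong) (auto simp: U_e_eq z simp del: of_real_diff)
  finally show ?thesis unfolding ucoeff_def by (simp del: of_real_diff)
qed

lemma Tk_integrand_eq:
  assumes [measurable]: "f \<in> borel_measurable borel" "g \<in> borel_measurable borel" and z: "z \<in> disc"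
  shows "Tk_integrand k f g z = ucoeff k f z * cnj (ucoeff k g z)"
proof -
  have "(cmod z)\<^sup>2 < 1" using z by (simp add: in_disc abs_square_less_1)
  then have "complex_of_real (1 - (cmod z)\<^sup>2) \<noteq> 0" by (simp only: of_real_eq_0_iff)
  then show ?thesis
    unfolding Tk_integrand_def inner_A2_U_e[OF assms(1) z] inner_A2_U_e[OF assms(2) z] of_real_power
    by (simp add: power2_eq_square del: of_real_diff)
qed

section \<open>Carleson-type estimates for measures of vanishing density\<close>

locale finite_disc_measure = finite_measure \<mu> for \<mu> :: "complex measure" +
  assumes sets_mu [measurable_cong]: "sets \<mu> = sets (restrict_space borel disc)"
begin

lemma space_mu [simp]: "space \<mu> = disc"
  using sets_eq_imp_space_eq[OF sets_mu] by (simp add: space_restrict_space)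

lemma borel_measurable_mu_continuous: "continuous_on disc f \<Longrightarrow> f \<in> borel_measurable \<mu>"
  unfolding measurable_cong_sets[OF sets_mu refl] by (rule borel_measurable_continuous_on_restrict)

lemma ucoeff_measurable_mu: "f \<in> bergman \<Longrightarrow> ucoeff k f \<in> borel_measurable \<mu>"
  by (intro borel_measurable_mu_continuous ucoeff_continuous)

definition dens :: "real \<Rightarrow> complex \<Rightarrow> real" where
  "dens t w = measure \<mu> (ball w (t * (1 - cmod w))) / (1 - cmod w)\<^sup>2"

definition vanishing_density :: "real \<Rightarrow> bool" where
  "vanishing_density t \<longleftrightarrow> (\<forall>\<epsilon>>0. \<exists>R<1. \<forall>w\<in>disc. R < cmod w \<longrightarrow> dens t w \<le> \<epsilon>)"

lemma ball_disc: "w \<in> disc \<Longrightarrow> t \<le> 1 \<Longrightarrow> ball w (t * (1 - cmod w)) \<subseteq> disc"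
proof (rule ball_subset_disc)
  assume "w \<in> disc" "t \<le> 1"
  then have "t * (1 - cmod w) \<le> 1 * (1 - cmod w)"
    by (intro mult_right_mono) (auto simp: in_disc)
  then show "cmod w + t * (1 - cmod w) \<le> 1" unfolding mult_1 by linarith
qed

lemma ball_in_sets_mu: "ball z r \<subseteq> disc \<Longrightarrow> ball z r \<in> sets \<mu>"
  unfolding sets_mu by (auto simp: sets_restrict_space image_iff intro!: bexI[of _ "ball z r"])

text \<open>The constant of the local bound at s = t / (1 + t). The factor 4 pays for replacing 1 /
  (1 - |z|)^2 by 1 / (1 - |w|)^2 when w is close to z.\<close>

definition carleson_const :: "nat \<Rightarrow> real \<Rightarrow> real" where
  "carleson_const k t = 4 * ((real k + 1) * (1 + 2 / (t / (1 + t))) ^ (2 * k) / (t / (1 + t))\<^sup>2)"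

lemma carleson_const_pos: "0 < t \<Longrightarrow> 0 < carleson_const k t"
  unfolding carleson_const_def by (intro mult_pos_pos divide_pos_pos zero_less_power add_pos_pos[of 1]) (auto intro: add_nonneg_pos)

lemma nn_integral_ucoeff_le:
  assumes f: "f \<in> bergman" and t: "0 < t" "t < 1"
  shows "(\<integral>\<^sup>+z. ennreal ((cmod (ucoeff k f z))\<^sup>2) \<partial>\<mu>) \<le> (\<integral>\<^sup>+w. ennreal (carleson_const k t * (dens t w * (cmod (f w))\<^sup>2)) \<partial>nu)"
proof -
  interpret P: pair_sigma_finite \<mu> nu ..
  \<comment> \<open>The solution of t * (1 - s) = s. With it, |w - z| < s * (1 - |z|) implies |w -
    z| < t * (1 - |w|), which turns a ball around z into a ball around w.\<close>
  define s where "s = t / (1 + t)"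
  have s: "0 < s" "s < 1" "s \<le> t" using t by (auto simp: s_def field_simps)
  have ts: "t * (1 - s) = s" using t by (simp add: s_def field_simps)
  define K where "K = (real k + 1) * (1 + 2 / s) ^ (2 * k) / s\<^sup>2"
  have K: "0 < K" unfolding K_def using s by (intro mult_pos_pos divide_pos_pos zero_less_power add_pos_pos[of 1]) (auto intro: add_nonneg_pos)
  have CK: "carleson_const k t = 4 * K" by (simp add: carleson_const_def K_def s_def)
  have [measurable]: "f \<in> borel_measurable nu" "(\<lambda>z. z) \<in> borel_measurable nu" "(\<lambda>z. z) \<in> borel_measurable \<mu>"
    by (intro bergmanD f borel_measurable_nu_continuous borel_measurable_mu_continuous continuous_intros)+
  \<comment> \<open>A jointly measurable majorant in which everything but the ball condition depends
    on w alone, so that after exchanging the integrals the inner one is the measure of a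
    ball.\<close>
  define H where "H z w = (if dist w z < t * (1 - cmod w) then ennreal (4 * K * ((cmod (f w))\<^sup>2 / (1 - cmod w)\<^sup>2)) else 0)" for z w
  have H_meas: "(\<lambda>(z, w). H z w) \<in> borel_measurable (\<mu> \<Otimes>\<^sub>M nu)"
    unfolding H_def by measurable
  have "(\<integral>\<^sup>+z. ennreal ((cmod (ucoeff k f z))\<^sup>2) \<partial>\<mu>) \<le> (\<integral>\<^sup>+z. \<integral>\<^sup>+w. H z w \<partial>nu \<partial>\<mu>)"
  proof (rule nn_integral_mono)
    fix z assume "z \<in> space \<mu>"
    then have z: "z \<in> disc" by simp
    let ?B = "ball z (s * (1 - cmod z))"
    have int: "integrable nu (\<lambda>w. K / (1 - cmod z)\<^sup>2 * (indicator ?B w * (cmod (f w))\<^sup>2))"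
      by (intro integrable_mult_right integrable_indicator_bergman f) simp
    have "ennreal ((cmod (ucoeff k f z))\<^sup>2) \<le> ennreal (LINT w|nu. K / (1 - cmod z)\<^sup>2 * (indicator ?B w * (cmod (f w))\<^sup>2))"
      using ucoeff_local_bound[OF f z s(1,2), of k] by (intro ennreal_leI) (simp add: K_def)
    also have "\<dots> = (\<integral>\<^sup>+w. ennreal (K / (1 - cmod z)\<^sup>2 * (indicator ?B w * (cmod (f w))\<^sup>2)) \<partial>nu)"
      using K by (intro nn_integral_eq_integral[symmetric] int AE_I2) auto
    also have "\<dots> \<le> (\<integral>\<^sup>+w. H z w \<partial>nu)"
    proof (rule nn_integral_mono)
      fix w assume "w \<in> space nu"
      then have w: "cmod w < 1" by (simp add: in_disc)
      show "ennreal (K / (1 - cmod z)\<^sup>2 * (indicator ?B w * (cmod (f w))\<^sup>2)) \<le> H z w"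
      proof (cases "w \<in> ?B")
        case True
        then have d: "cmod (w - z) < s * (1 - cmod z)" by (simp add: dist_norm norm_minus_commute)
        have cz: "0 < 1 - cmod z" using z by (simp add: in_disc)
        have tri: "cmod w \<le> cmod z + cmod (w - z)" "cmod z \<le> cmod w + cmod (w - z)"
          using norm_triangle_ineq2[of w z] norm_triangle_ineq2[of z w] by (simp_all add: norm_minus_commute)
        have "s * (1 - cmod z) \<le> 1 * (1 - cmod z)" using s cz by (intro mult_right_mono) auto
        with d have "cmod (w - z) < 1 - cmod z" unfolding mult_1 by (rule less_le_trans)
        with tri(2) have w2: "1 - cmod w \<le> 2 * (1 - cmod z)" by (smt (verit))
        have "(1 - cmod z) * (1 - s) \<le> 1 - cmod w"
        proof -
          have "(1 - cmod z) * (1 - s) = (1 - cmod z) - s * (1 - cmod z)"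
            by (simp add: algebra_simps)
          then show ?thesis using d tri(1) by (smt (verit))
        qed
        then have "t * ((1 - cmod z) * (1 - s)) \<le> t * (1 - cmod w)"
          using t by (intro mult_left_mono) auto
        moreover have "t * ((1 - cmod z) * (1 - s)) = s * (1 - cmod z)"
        proof -
          have "t * ((1 - cmod z) * (1 - s)) = t * (1 - s) * (1 - cmod z)" by (simp only: mult_ac)
          then show ?thesis unfolding ts .
        qed
        ultimately have "dist w z < t * (1 - cmod w)"
          using d by (simp add: dist_norm)
        then have "H z w = ennreal (4 * K * ((cmod (f w))\<^sup>2 / (1 - cmod w)\<^sup>2))"
          by (simp add: H_def)
        moreover have "K / (1 - cmod z)\<^sup>2 \<le> 4 * K / (1 - cmod w)\<^sup>2"
        proof -
          have "(1 - cmod w)\<^sup>2 \<le> (2 * (1 - cmod z))\<^sup>2" using w2 w by (intro power_mono) auto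
          then have "4 * K / (2 * (1 - cmod z))\<^sup>2 \<le> 4 * K / (1 - cmod w)\<^sup>2"
            using K cz w by (intro divide_left_mono mult_pos_pos zero_less_power) auto
          then show ?thesis unfolding power_mult_distrib by simp
        qed
        then have "K / (1 - cmod z)\<^sup>2 * (cmod (f w))\<^sup>2 \<le> 4 * K / (1 - cmod w)\<^sup>2 * (cmod (f w))\<^sup>2"
          by (intro mult_right_mono) auto
        ultimately show ?thesis using True by (simp add: ennreal_leI)
      qed simp
    qed
    finally show "ennreal ((cmod (ucoeff k f z))\<^sup>2) \<le> (\<integral>\<^sup>+w. H z w \<partial>nu)" .
  qed
  also have "\<dots> = (\<integral>\<^sup>+w. \<integral>\<^sup>+z. H z w \<partial>\<mu> \<partial>nu)"
    using P.Fubini[OF H_meas] by simp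
  also have "\<dots> = (\<integral>\<^sup>+w. ennreal (carleson_const k t * (dens t w * (cmod (f w))\<^sup>2)) \<partial>nu)"
  proof (rule nn_integral_cong)
    fix w assume "w \<in> space nu"
    then have w: "w \<in> disc" by simp
    let ?B = "ball w (t * (1 - cmod w))" and ?c = "4 * K * ((cmod (f w))\<^sup>2 / (1 - cmod w)\<^sup>2)"
    have B: "?B \<in> sets \<mu>" by (intro ball_in_sets_mu ball_disc w) (use t in simp)
    have "(\<integral>\<^sup>+z. H z w \<partial>\<mu>) = (\<integral>\<^sup>+z. ennreal ?c * indicator ?B z \<partial>\<mu>)"
      by (intro nn_integral_cong) (auto simp: H_def indicator_def)
    also have "\<dots> = ennreal ?c * ennreal (measure \<mu> ?B)"
      using B by (simp add: nn_integral_cmult_indicator emeasure_eq_measure)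
    also have "\<dots> = ennreal (carleson_const k t * (dens t w * (cmod (f w))\<^sup>2))"
      using K by (subst ennreal_mult[symmetric]) (auto simp: CK dens_def mult_ac)
    finally show "(\<integral>\<^sup>+z. H z w \<partial>\<mu>) = ennreal (carleson_const k t * (dens t w * (cmod (f w))\<^sup>2))" .
  qed
  finally show ?thesis .
qed

text \<open>The density is split into a part small everywhere and a part carried by a compact ball.
  The first is paid for by the norm of f, the second by the size of f on that ball, which locally
  uniform convergence makes small.\<close>

lemma
  assumes f: "f \<in> bergman" and t: "0 < t" "t < 1" and \<epsilon>: "0 \<le> \<epsilon>" and M: "0 \<le> M"
    and dens: "\<And>w. w \<in> disc \<Longrightarrow> dens t w \<le> \<epsilon> + M * indicator (cball 0 R) w"
  shows integrable_ucoeff: "integrable \<mu> (\<lambda>z. (cmod (ucoeff k f z))\<^sup>2)"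
    and integral_ucoeff_le: "(LINT z|\<mu>. (cmod (ucoeff k f z))\<^sup>2) \<le>
      carleson_const k t * (\<epsilon> * (LINT w|nu. (cmod (f w))\<^sup>2) + M * (LINT w|nu. indicator (cball 0 R) w * (cmod (f w))\<^sup>2))"
proof -
  have [measurable]: "f \<in> borel_measurable nu" "ucoeff k f \<in> borel_measurable \<mu>"
    by (intro bergmanD ucoeff_measurable_mu f)+
  have int: "integrable nu (\<lambda>w. indicator (cball 0 R) w * (cmod (f w))\<^sup>2)"
    by (intro integrable_indicator_bergman f) simp
  let ?h = "\<lambda>w. carleson_const k t * (\<epsilon> * (cmod (f w))\<^sup>2 + M * (indicator (cball 0 R) w * (cmod (f w))\<^sup>2))"
  have inth: "integrable nu ?h"
    by (intro integrable_mult_right Bochner_Integration.integrable_add int bergmanD f)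
  note C = carleson_const_pos[OF t(1), of k]
  have h0: "0 \<le> ?h w" for w
    using C \<epsilon> M by (intro mult_nonneg_nonneg add_nonneg_nonneg) auto
  have "(\<integral>\<^sup>+z. ennreal ((cmod (ucoeff k f z))\<^sup>2) \<partial>\<mu>) \<le> (\<integral>\<^sup>+w. ennreal (carleson_const k t * (dens t w * (cmod (f w))\<^sup>2)) \<partial>nu)"
    by (rule nn_integral_ucoeff_le[OF f t])
  also have "\<dots> \<le> (\<integral>\<^sup>+w. ennreal (?h w) \<partial>nu)"
  proof (rule nn_integral_mono, rule ennreal_leI, rule mult_left_mono)
    fix w assume "w \<in> space nu"
    then have "dens t w * (cmod (f w))\<^sup>2 \<le> (\<epsilon> + M * indicator (cball 0 R) w) * (cmod (f w))\<^sup>2"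
      by (intro mult_right_mono dens) auto
    then show "dens t w * (cmod (f w))\<^sup>2 \<le> \<epsilon> * (cmod (f w))\<^sup>2 + M * (indicator (cball 0 R) w * (cmod (f w))\<^sup>2)"
      by (simp only: distrib_right mult.assoc)
  qed (use C in simp)
  also have "\<dots> = ennreal (LINT w|nu. ?h w)"
    by (intro nn_integral_eq_integral inth AE_I2 h0)
  finally have le: "(\<integral>\<^sup>+z. ennreal ((cmod (ucoeff k f z))\<^sup>2) \<partial>\<mu>) \<le> ennreal (LINT w|nu. ?h w)" .
  show intF: "integrable \<mu> (\<lambda>z. (cmod (ucoeff k f z))\<^sup>2)"
    by (rule integrableI_bounded) (use le in \<open>auto simp: le_less_trans\<close>)
  have "ennreal (LINT z|\<mu>. (cmod (ucoeff k f z))\<^sup>2) \<le> ennreal (LINT w|nu. ?h w)"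
    using le nn_integral_eq_integral[OF intF] by simp
  then have "(LINT z|\<mu>. (cmod (ucoeff k f z))\<^sup>2) \<le> (LINT w|nu. ?h w)"
    by (subst (asm) ennreal_le_iff) (intro Bochner_Integration.integral_nonneg h0)
  also have "\<dots> = carleson_const k t * (\<epsilon> * (LINT w|nu. (cmod (f w))\<^sup>2) + M * (LINT w|nu. indicator (cball 0 R) w * (cmod (f w))\<^sup>2))"
    by (simp only: integral_mult_right_zero Bochner_Integration.integral_add[OF integrable_mult_right integrable_mult_right] int bergmanD f)
  finally show "(LINT z|\<mu>. (cmod (ucoeff k f z))\<^sup>2) \<le>
      carleson_const k t * (\<epsilon> * (LINT w|nu. (cmod (f w))\<^sup>2) + M * (LINT w|nu. indicator (cball 0 R) w * (cmod (f w))\<^sup>2))" .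
qed

text \<open>On |w| \<le> R the total mass divided by (1 - R)^2 bounds the density; this is where
  finiteness of the measure enters.\<close>

lemma vanishing_density_split:
  assumes "vanishing_density t" "0 < \<epsilon>" "t \<le> 1"
  obtains R M where "R < 1" "0 \<le> M" "\<And>w. w \<in> disc \<Longrightarrow> dens t w \<le> \<epsilon> + M * indicator (cball 0 R) w"
proof -
  obtain R where R: "R < 1" "\<And>w. w \<in> disc \<Longrightarrow> R < cmod w \<Longrightarrow> dens t w \<le> \<epsilon>"
    using assms unfolding vanishing_density_def by blast
  define M where "M = measure \<mu> disc / (1 - R)\<^sup>2"
  show ?thesis
  proof (rule that[OF R(1), of M])
    show "0 \<le> M" by (simp add: M_def)
    fix w assume w: "w \<in> disc"
    show "dens t w \<le> \<epsilon> + M * indicator (cball 0 R) w"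
    proof (cases "R < cmod w")
      case True
      then show ?thesis using R(2)[OF w True] by simp
    next
      case False
      have "measure \<mu> (ball w (t * (1 - cmod w))) \<le> measure \<mu> disc"
        using ball_disc[OF w assms(3)] sets.top[of \<mu>] by (intro finite_measure_mono) auto
      then have "dens t w \<le> M"
        unfolding dens_def M_def using False R(1) w
        by (intro frac_le power_mono zero_less_power) (auto simp: in_disc)
      then show ?thesis using False assms(2) by simp
    qed
  qed
qed

text \<open>A vanishing density is bounded on the whole disc, here by 1 + M, so the compact part can
  be left empty.\<close>

lemma ucoeff_bounded:
  assumes "vanishing_density t" "0 < t" "t < 1"
  obtains C where "0 \<le> C" "\<And>f. f \<in> bergman \<Longrightarrow> integrable \<mu> (\<lambda>z. (cmod (ucoeff k f z))\<^sup>2)"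
    "\<And>f. f \<in> bergman \<Longrightarrow> (LINT z|\<mu>. (cmod (ucoeff k f z))\<^sup>2) \<le> C * (LINT w|nu. (cmod (f w))\<^sup>2)"
proof -
  obtain R M where RM: "R < 1" "0 \<le> M" "\<And>w. w \<in> disc \<Longrightarrow> dens t w \<le> 1 + M * indicator (cball 0 R) w"
    using vanishing_density_split[OF assms(1), of 1] assms(3) by auto
  have M': "dens t w \<le> (1 + M) + 0 * indicator (cball 0 R) w" if "w \<in> disc" for w
    using RM(3)[OF that] RM(2) by (cases "w \<in> cball 0 R") auto
  have M1: "0 \<le> 1 + M" using RM(2) by simp
  show ?thesis
  proof (rule that[of "carleson_const k t * (1 + M)"])
    show "0 \<le> carleson_const k t * (1 + M)" using carleson_const_pos[OF assms(2), of k] M1 by simp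
    fix f assume f: "f \<in> bergman"
    show "integrable \<mu> (\<lambda>z. (cmod (ucoeff k f z))\<^sup>2)"
      by (rule integrable_ucoeff[OF f assms(2,3) M1 order_refl M'])
    show "(LINT z|\<mu>. (cmod (ucoeff k f z))\<^sup>2) \<le> carleson_const k t * (1 + M) * (LINT w|nu. (cmod (f w))\<^sup>2)"
      using integral_ucoeff_le[OF f assms(2,3) M1 order_refl M', of k] by simp
  qed
qed

text \<open>Montel's theorem gives a subsequence converging uniformly on compact subsets of the
  disc. For the differences of its members, the boundary region is controlled by the small density
  and the norm bound, the inner region by uniform convergence.\<close>

lemma ucoeff_compact:
  assumes vd: "vanishing_density t" and t: "0 < t" "t < 1"
    and fs: "\<And>n. fs n \<in> bergman" "\<And>n. (LINT w|nu. (cmod (fs n w))\<^sup>2) \<le> 1"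
  obtains r :: "nat \<Rightarrow> nat" where "strict_mono r"
    "\<And>\<epsilon>. 0 < \<epsilon> \<Longrightarrow> \<exists>N. \<forall>m\<ge>N. \<forall>n\<ge>N. (LINT z|\<mu>. (cmod (ucoeff k (\<lambda>w. fs (r m) w - fs (r n) w) z))\<^sup>2) < \<epsilon>"
proof -
  define \<H> where "\<H> = {h \<in> bergman. (LINT w|nu. (cmod (h w))\<^sup>2) \<le> 1}"
  have bounded: "\<exists>B. \<forall>h\<in>\<H>. \<forall>z\<in>K. cmod (h z) \<le> B" if K: "compact K" "K \<subseteq> disc" for K
  proof -
    obtain \<rho> where \<rho>: "\<rho> < 1" "\<And>z. z \<in> K \<Longrightarrow> cmod z \<le> \<rho>"
    proof (cases "K = {}")
      case False
      from continuous_attains_sup[OF K(1) False, of cmod] obtain x where "x \<in> K" "\<forall>z\<in>K. cmod z \<le> cmod x"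
        by (auto intro: continuous_intros)
      then show ?thesis using that[of "cmod x"] K(2) by (auto simp: in_disc)
    qed (use that[of 0] in auto)
    \<comment> \<open>The local bound with k = 0 and s = 1/2 has constant 4; the number 16 is
      slack.\<close>
    have "cmod (h z) \<le> sqrt (16 / (1 - \<rho>)\<^sup>2)" if h: "h \<in> \<H>" and z: "z \<in> K" for h z
    proof -
      have hb: "h \<in> bergman" and h1: "(LINT w|nu. (cmod (h w))\<^sup>2) \<le> 1" using h by (auto simp: \<H>_def)
      have zd: "z \<in> disc" using z K by auto
      let ?B = "ball z (1/2 * (1 - cmod z))"
      have "(LINT w|nu. indicator ?B w * (cmod (h w))\<^sup>2) \<le> (LINT w|nu. (cmod (h w))\<^sup>2)"
        by (rule integral_mono[OF integrable_indicator_bergman[OF hb] bergmanD(4)[OF hb]]) (auto simp: indicator_def)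
      then have 1: "(LINT w|nu. indicator ?B w * (cmod (h w))\<^sup>2) \<le> 1" using h1 by linarith
      have "(cmod (h z))\<^sup>2 = (cmod (ucoeff 0 h z))\<^sup>2" using ucoeff_0[OF hb zd] by simp
      also have "\<dots> \<le> 4 / (1 - cmod z)\<^sup>2 * (LINT w|nu. indicator ?B w * (cmod (h w))\<^sup>2)"
        using ucoeff_local_bound[OF hb zd, of "1/2" 0] by (simp add: power2_eq_square)
      also have "\<dots> \<le> 4 / (1 - cmod z)\<^sup>2 * 1"
        by (intro mult_left_mono 1) auto
      also have "\<dots> \<le> 16 / (1 - \<rho>)\<^sup>2"
        using \<rho>(1) \<rho>(2)[OF z] by (simp, intro frac_le power_mono zero_less_power) auto
      finally show ?thesis by (rule real_le_rsqrt)
    qed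
    then show ?thesis by blast
  qed
  obtain g r where gr: "strict_mono (r :: nat \<Rightarrow> nat)"
    "\<And>K. compact K \<Longrightarrow> K \<subseteq> disc \<Longrightarrow> uniform_limit K (fs \<circ> r) g sequentially"
    by (rule Montel[of disc \<H> fs]) (use bounded fs bergmanD(1) in \<open>auto simp: \<H>_def\<close>)
  show ?thesis
  proof (rule that[OF gr(1)])
    fix \<epsilon> :: real assume \<epsilon>: "0 < \<epsilon>"
    define C where "C = carleson_const k t"
    have C: "0 < C" using carleson_const_pos[OF t(1)] by (simp add: C_def)
    \<comment> \<open>A difference of two elements of the unit ball has squared norm at most 4, so
      the boundary part contributes at most \<open>\<epsilon>\<close> / 4.\<close>
    define \<epsilon>' where "\<epsilon>' = \<epsilon> / (16 * C)"
    have \<epsilon>': "0 < \<epsilon>'" using \<epsilon> C by (simp add: \<epsilon>'_def)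
    obtain R M where RM: "R < 1" "0 \<le> M" "\<And>w. w \<in> disc \<Longrightarrow> dens t w \<le> \<epsilon>' + M * indicator (cball 0 R) w"
      using vanishing_density_split[OF vd \<epsilon>'] t by auto
    define a where "a = measure nu disc"
    have a: "0 \<le> a" by (simp add: a_def)
    \<comment> \<open>Each difference is at most 2 * \<open>\<delta>\<close> on the compact ball, so
      the inner part is at most C * M * 4 * \<open>\<delta>\<close>^2 * a, again at most
      \<open>\<epsilon>\<close> / 4. The summand 1 avoids division by zero when M * a = 0.\<close>
    define \<delta> where "\<delta> = sqrt (\<epsilon> / (16 * C * (M * a + 1)))"
    have Ma: "0 < M * a + 1" using RM(2) a by (simp add: add_nonneg_pos)
    have \<delta>: "0 < \<delta>" unfolding \<delta>_def using \<epsilon> C Ma by simp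
    have \<delta>2: "\<delta>\<^sup>2 = \<epsilon> / (16 * C * (M * a + 1))"
      unfolding \<delta>_def using \<epsilon> C Ma by simp
    have sub: "cball 0 R \<subseteq> disc" using RM(1) by (auto simp: disc_def)
    from uniform_limitD[OF gr(2)[OF compact_cball sub] \<delta>]
    obtain N where "\<forall>n\<ge>N. \<forall>w\<in>cball 0 R. dist ((fs \<circ> r) n w) (g w) < \<delta>"
      unfolding eventually_sequentially by blast
    then have N: "\<And>n w. N \<le> n \<Longrightarrow> w \<in> cball 0 R \<Longrightarrow> dist (fs (r n) w) (g w) < \<delta>"
      by (simp add: o_def del: mem_cball_0 mem_cball)
    show "\<exists>N. \<forall>m\<ge>N. \<forall>n\<ge>N. (LINT z|\<mu>. (cmod (ucoeff k (\<lambda>w. fs (r m) w - fs (r n) w) z))\<^sup>2) < \<epsilon>"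
    proof (intro exI allI impI)
      fix m n assume mn: "N \<le> m" "N \<le> n"
      let ?h = "\<lambda>w. fs (r m) w - fs (r n) w"
      have h: "?h \<in> bergman" by (intro bergman_diff fs)
      have [measurable]: "?h \<in> borel_measurable nu" by (rule bergmanD[OF h])
      have h4: "(LINT w|nu. (cmod (?h w))\<^sup>2) \<le> 4"
        using integral_L2_diff_le[OF bergmanD(3)[OF fs(1)] bergmanD(3)[OF fs(1)] bergmanD(4)[OF fs(1)] bergmanD(4)[OF fs(1)], of "r m" "r n"]
          fs(2)[of "r m"] fs(2)[of "r n"] by linarith
      have small: "(LINT w|nu. indicator (cball 0 R) w * (cmod (?h w))\<^sup>2) \<le> 4 * \<delta>\<^sup>2 * a"
      proof -
        have le: "indicator (cball 0 R) w * (cmod (?h w))\<^sup>2 \<le> 4 * \<delta>\<^sup>2" for w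
        proof (cases "w \<in> cball 0 R")
          case True
          have "cmod (?h w) \<le> 2 * \<delta>"
            using dist_triangle2[of "fs (r m) w" "fs (r n) w" "g w"] N[OF mn(1) True] N[OF mn(2) True]
            by (simp add: dist_norm)
          then have "(cmod (?h w))\<^sup>2 \<le> (2 * \<delta>)\<^sup>2" by (rule power_mono) simp
          then show ?thesis using True by (simp add: power_mult_distrib)
        qed simp
        have "(LINT w|nu. indicator (cball 0 R) w * (cmod (?h w))\<^sup>2) \<le> (LINT w|nu. 4 * \<delta>\<^sup>2)"
          by (rule integral_mono') (use le in auto)
        then show ?thesis by (simp add: a_def mult_ac)
      qed
      have "(LINT z|\<mu>. (cmod (ucoeff k ?h z))\<^sup>2) \<le> C * (\<epsilon>' * (LINT w|nu. (cmod (?h w))\<^sup>2) + M * (LINT w|nu. indicator (cball 0 R) w * (cmod (?h w))\<^sup>2))"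
        unfolding C_def by (rule integral_ucoeff_le[OF h t less_imp_le[OF \<epsilon>'] RM(2,3)])
      also have "\<dots> \<le> C * (\<epsilon>' * 4 + M * (4 * \<delta>\<^sup>2 * a))"
        using C \<epsilon>' RM(2) by (intro mult_left_mono add_mono h4 small) auto
      also have "C * (\<epsilon>' * 4) = \<epsilon> / 4" using C by (simp add: \<epsilon>'_def)
      then have "C * (\<epsilon>' * 4 + M * (4 * \<delta>\<^sup>2 * a)) = \<epsilon> / 4 + C * (M * (4 * \<delta>\<^sup>2 * a))"
        by (simp only: distrib_left)
      also have "C * (M * (4 * \<delta>\<^sup>2 * a)) = (M * a) / (M * a + 1) * (\<epsilon> / 4)"
      proof -
        have *: "C * (M * (4 * (\<epsilon> / (16 * C * X)) * a)) = M * a / X * (\<epsilon> / 4)" if "X \<noteq> 0" for X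
          using that C by (simp add: field_simps)
        show ?thesis unfolding \<delta>2 by (rule *) (use Ma in simp)
      qed
      also have "(M * a) / (M * a + 1) * (\<epsilon> / 4) \<le> 1 * (\<epsilon> / 4)"
        using Ma \<epsilon> by (intro mult_right_mono) auto
      also have "\<epsilon> / 4 + 1 * (\<epsilon> / 4) < \<epsilon>" using \<epsilon> by simp
      finally show "(LINT z|\<mu>. (cmod (ucoeff k ?h z))\<^sup>2) < \<epsilon>" by simp
    qed
  qed
qed

end

section \<open>Square-summable coefficient sequences\<close>

lemma A2_bergman:
  assumes "f \<in> A2"
  shows "f \<in> bergman" "(norm_A2 f)\<^sup>2 = (LINT w|nu. (cmod (f w))\<^sup>2)"
proof -
  have int: "integrable dA (\<lambda>z. (cmod (f z))\<^sup>2)" using assms by (simp add: A2_def)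
  then have m: "(\<lambda>z. (cmod (f z))\<^sup>2) \<in> borel_measurable borel"
    using borel_measurable_integrable[OF int] by (simp cong: measurable_cong_sets)
  show "f \<in> bergman" "(norm_A2 f)\<^sup>2 = (LINT w|nu. (cmod (f w))\<^sup>2)"
    using assms int integral_dA_eq_nu[OF m] by (auto simp: A2_def bergman_def norm_A2_def)
qed

lemma bergman_A2:
  assumes "f \<in> bergman" "f \<in> borel_measurable borel"
  shows "f \<in> A2"
  using assms integral_dA_eq_nu[of "\<lambda>z. (cmod (f z))\<^sup>2"] by (auto simp: A2_def bergman_def)

lemma e_poly: "e n = poly (monom (of_real (sqrt (real n + 1))) n)"
  by (auto simp: e_def poly_monom)

lemma e_bergman: "e n \<in> bergman"
  unfolding e_poly by (rule bergman_poly)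

lemma e_orthonormal: "(LINT w|nu. e n w * cnj (e m w)) = (if n = m then 1 else 0)"
proof -
  let ?c = "complex_of_real (sqrt (real n + 1)) * of_real (sqrt (real m + 1))"
  have "continuous_on disc (\<lambda>w. e n w * cnj (e m w))"
    unfolding e_def by (intro continuous_intros)
  then have "(LINT w|nu. e n w * cnj (e m w)) = (1 / pi) *\<^sub>R (LINT w|lborel. indicator disc w *\<^sub>R (e n w * cnj (e m w)))"
    by (intro integral_nu borel_measurable_nu_continuous)
  also have "(LINT w|lborel. indicator disc w *\<^sub>R (e n w * cnj (e m w))) =
      (LINT w|lborel. ?c * (indicator (ball 0 1) w *\<^sub>R (w ^ n * cnj w ^ m)))"
    by (rule Bochner_Integration.integral_cong) (auto simp: e_def disc_def indicator_def)
  also have "\<dots> = ?c * (LINT w|lborel. indicator (ball 0 1) w *\<^sub>R (w ^ n * cnj w ^ m))"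
    by (rule integral_mult_right_zero)
  finally have *: "(LINT w|nu. e n w * cnj (e m w)) = (1 / pi) *\<^sub>R (?c * (LINT w|lborel. indicator (ball 0 1) w *\<^sub>R (w ^ n * cnj w ^ m)))" .
  show ?thesis
  proof (cases "n = m")
    case True
    have "?c = of_real (real n + 1)"
      using True by (simp only: of_real_mult[symmetric]) simp
    moreover have "complex_of_real (real n + 1) \<noteq> 0"
      by (simp only: of_real_eq_0_iff)
    ultimately show ?thesis
      unfolding * using True integral_ball_monomial_eq[of 1 n]
      by (simp add: scaleR_conv_of_real field_simps)
  next
    case False
    then show ?thesis
      unfolding * integral_ball_monomial_neq[OF False] by simp
  qed
qed

lemma integrable_bergman_mult:
  assumes "f \<in> bergman" "g \<in> bergman"
  shows "integrable nu (\<lambda>w. f w * cnj (g w))"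
  using assms by (intro integrable_mult_L2 bergmanD)

lemma bergman_sum: "(\<lambda>w. \<Sum>n\<in>A. c n * e n w) \<in> bergman"
proof (induction A rule: infinite_finite_induct)
  case (insert x A)
  then show ?case using bergman_add[OF bergman_cmult[OF e_bergman, of "c x" x] insert.IH] by simp
qed (simp_all add: bergman_bounded[of "\<lambda>_. 0" 0])

lemma bergman_sum_inner:
  assumes "f \<in> bergman"
  shows "(LINT w|nu. f w * cnj (\<Sum>n\<in>A. c n * e n w)) = (\<Sum>n\<in>A. cnj (c n) * (LINT w|nu. f w * cnj (e n w)))"
proof -
  have "(LINT w|nu. f w * cnj (\<Sum>n\<in>A. c n * e n w)) = (LINT w|nu. (\<Sum>n\<in>A. cnj (c n) * (f w * cnj (e n w))))"
    by (simp add: sum_distrib_left mult_ac)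
  also have "\<dots> = (\<Sum>n\<in>A. cnj (c n) * (LINT w|nu. f w * cnj (e n w)))"
    by (subst Bochner_Integration.integral_sum)
       (auto intro!: integrable_mult_right integrable_bergman_mult assms e_bergman simp only: integral_mult_right_zero)
  finally show ?thesis .
qed

lemma sum_e_inner:
  assumes "finite A" "m \<in> A"
  shows "(LINT w|nu. (\<Sum>n\<in>A. c n * e n w) * cnj (e m w)) = c m"
proof -
  have "(LINT w|nu. (\<Sum>n\<in>A. c n * e n w) * cnj (e m w)) = (LINT w|nu. (\<Sum>n\<in>A. c n * (e n w * cnj (e m w))))"
    by (simp only: sum_distrib_right mult.assoc)
  also have "\<dots> = (\<Sum>n\<in>A. c n * (LINT w|nu. e n w * cnj (e m w)))"
    by (subst Bochner_Integration.integral_sum)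
       (auto intro!: integrable_mult_right integrable_bergman_mult e_bergman simp only: integral_mult_right_zero)
  also have "\<dots> = c m"
    unfolding e_orthonormal using assms by (simp add: if_distrib[of "(*) _"] cong: if_cong)
  finally show ?thesis .
qed

lemma bergman_sum_norm:
  assumes "finite A"
  shows "(LINT w|nu. (cmod (\<Sum>n\<in>A. c n * e n w))\<^sup>2) = (\<Sum>n\<in>A. (cmod (c n))\<^sup>2)"
proof -
  let ?f = "\<lambda>w. \<Sum>n\<in>A. c n * e n w"
  have "complex_of_real (LINT w|nu. (cmod (?f w))\<^sup>2) = (LINT w|nu. ?f w * cnj (?f w))"
    by (simp only: integral_complex_of_real[symmetric] complex_norm_square)
  also have "\<dots> = (\<Sum>n\<in>A. cnj (c n) * c n)"
    unfolding bergman_sum_inner[OF bergman_sum] by (intro sum.cong refl) (simp add: sum_e_inner assms)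
  also have "\<dots> = complex_of_real (\<Sum>n\<in>A. (cmod (c n))\<^sup>2)"
    by (simp only: of_real_sum complex_norm_square mult.commute)
  finally show ?thesis by (simp only: of_real_eq_iff)
qed

text \<open>The value 0 off the disc makes the sum Borel measurable on the whole plane, as
  membership in \<open>A2\<close> and integration over \<open>dA\<close> call for.\<close>

definition l2sum :: "(nat \<Rightarrow> complex) \<Rightarrow> complex \<Rightarrow> complex" where
  "l2sum b z = (if z \<in> disc then \<Sum>n. b n * e n z else 0)"

lemma l2sum_sums:
  assumes b: "\<And>n. cmod (b n) \<le> B" and z: "z \<in> disc"
  shows "(\<lambda>n. b n * e n z) sums l2sum b z"
proof -
  have "summable (\<lambda>m. real ((1 + m) choose 1) * cmod z ^ m)"
    using z by (intro sums_negative_binomial(1)) (simp add: in_disc)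
  then have s: "summable (\<lambda>n. B * (real (1 + n) * cmod z ^ n))"
    by (intro summable_mult) simp
  have "norm (b n * e n z) \<le> B * (real (1 + n) * cmod z ^ n)" for n
  proof -
    have "sqrt (real n + 1) \<le> real n + 1"
      by (rule real_le_lsqrt) (auto simp: power2_eq_square)
    then have "norm (e n z) \<le> real (1 + n) * cmod z ^ n"
      by (simp add: e_def norm_mult norm_power mult_right_mono add.commute)
    then show ?thesis
      unfolding norm_mult using b[of n] order_trans[OF norm_ge_zero b[of n]] by (intro mult_mono) auto
  qed
  then have "summable (\<lambda>n. b n * e n z)"
    by (intro summable_comparison_test'[OF s]) auto
  then show ?thesis using z by (simp add: l2sum_def summable_sums)
qed

text \<open>The partial sums have squared norms computed by orthonormality; Fatou's lemma passes the
  bound B to the pointwise limit.\<close>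

lemma
  assumes b: "\<And>N. (\<Sum>n<N. (cmod (b n))\<^sup>2) \<le> B"
  shows l2sum_bergman: "l2sum b \<in> bergman"
    and l2sum_norm_le: "(LINT w|nu. (cmod (l2sum b w))\<^sup>2) \<le> B"
    and l2sum_coeff_le: "cmod (b n) \<le> sqrt B"
proof -
  have B: "0 \<le> B" using b[of 0] by simp
  have bn: "cmod (b n) \<le> sqrt B" for n
  proof (rule real_le_rsqrt)
    have "(cmod (b n))\<^sup>2 \<le> (\<Sum>n<Suc n. (cmod (b n))\<^sup>2)"
      by (simp add: sum_nonneg)
    then show "(cmod (b n))\<^sup>2 \<le> B" using b[of "Suc n"] by linarith
  qed
  then show "cmod (b n) \<le> sqrt B" .
  have hol: "l2sum b holomorphic_on disc"
    unfolding disc_def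
  proof (rule power_series_holomorphic)
    fix w :: complex assume "w \<in> ball 0 1"
    then have "(\<lambda>n. b n * e n w) sums l2sum b w"
      by (intro l2sum_sums[OF bn]) (simp add: disc_def)
    then show "(\<lambda>n. b n * of_real (sqrt (real n + 1)) * (w - 0) ^ n) sums l2sum b w"
      by (simp add: e_def mult.assoc)
  qed
  then have m [measurable]: "l2sum b \<in> borel_measurable nu"
    by (intro borel_measurable_nu_continuous holomorphic_on_imp_continuous_on)
  let ?S = "\<lambda>N w. \<Sum>n<N. b n * e n w"
  have Sm [measurable]: "?S N \<in> borel_measurable nu" for N
    by (intro bergmanD bergman_sum)
  have SB: "(\<integral>\<^sup>+w. ennreal ((cmod (?S N w))\<^sup>2) \<partial>nu) \<le> ennreal B" for N
  proof -
    have "(\<integral>\<^sup>+w. ennreal ((cmod (?S N w))\<^sup>2) \<partial>nu) = ennreal (LINT w|nu. (cmod (?S N w))\<^sup>2)"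
      by (intro nn_integral_eq_integral bergmanD bergman_sum) auto
    also have "\<dots> \<le> ennreal B"
      using b[of N] by (intro ennreal_leI) (simp add: bergman_sum_norm)
    finally show ?thesis .
  qed
  have "(\<integral>\<^sup>+w. ennreal ((cmod (l2sum b w))\<^sup>2) \<partial>nu) = (\<integral>\<^sup>+w. liminf (\<lambda>N. ennreal ((cmod (?S N w))\<^sup>2)) \<partial>nu)"
  proof (rule nn_integral_cong)
    fix w assume "w \<in> space nu"
    then have "(\<lambda>N. ?S N w) \<longlonglongrightarrow> l2sum b w"
      using l2sum_sums[OF bn] by (simp add: sums_def)
    then have "(\<lambda>N. ennreal ((cmod (?S N w))\<^sup>2)) \<longlonglongrightarrow> ennreal ((cmod (l2sum b w))\<^sup>2)"
      by (intro tendsto_intros)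
    then show "ennreal ((cmod (l2sum b w))\<^sup>2) = liminf (\<lambda>N. ennreal ((cmod (?S N w))\<^sup>2))"
      by (rule lim_imp_Liminf[OF sequentially_bot, symmetric])
  qed
  also have "\<dots> \<le> liminf (\<lambda>N. \<integral>\<^sup>+w. ennreal ((cmod (?S N w))\<^sup>2) \<partial>nu)"
    by (rule nn_integral_liminf) measurable
  also have "\<dots> \<le> liminf (\<lambda>N. ennreal B)"
    by (intro Liminf_mono always_eventually allI SB)
  finally have le: "(\<integral>\<^sup>+w. ennreal ((cmod (l2sum b w))\<^sup>2) \<partial>nu) \<le> ennreal B"
    by (simp add: Liminf_const)
  have int: "integrable nu (\<lambda>w. (cmod (l2sum b w))\<^sup>2)"
    by (rule integrableI_bounded) (use le in \<open>auto simp: le_less_trans\<close>)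
  show "l2sum b \<in> bergman" using hol int by (simp add: bergman_def)
  show "(LINT w|nu. (cmod (l2sum b w))\<^sup>2) \<le> B"
    using le B by (subst (asm) nn_integral_eq_integral[OF int]) (auto simp: ennreal_le_iff)
qed

lemma l2sum_add:
  assumes "\<And>n. cmod (b n) \<le> B" "\<And>n. cmod (c n) \<le> C" "z \<in> disc"
  shows "l2sum (\<lambda>n. b n + c n) z = l2sum b z + l2sum c z"
  using sums_add[OF l2sum_sums[of b B z] l2sum_sums[of c C z]] assms
  by (simp add: l2sum_def sums_iff distrib_right)

lemma l2sum_cmult:
  assumes "\<And>n. cmod (b n) \<le> B" "z \<in> disc"
  shows "l2sum (\<lambda>n. c * b n) z = c * l2sum b z"
  using sums_mult[OF l2sum_sums[of b B z], of c] assms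
  by (simp add: l2sum_def sums_iff mult.assoc)

lemma borel_measurable_l2sum:
  assumes "l2sum b \<in> bergman"
  shows "l2sum b \<in> borel_measurable borel"
proof -
  have "(\<lambda>w. indicator disc w *\<^sub>R l2sum b w) = l2sum b"
    by (auto simp: l2sum_def indicator_def)
  then show ?thesis using bergmanD(3)[OF assms] unfolding borel_measurable_nu_iff by simp
qed

text \<open>Cut the series beyond the index m, at a point where the remaining squares sum to at most
  a given \<open>\<epsilon>\<close>. The finite part gives the coefficient exactly, and
  Cauchy-Schwarz bounds the tail.\<close>

lemma l2sum_inner_e:
  assumes b: "\<And>N. (\<Sum>n<N. (cmod (b n))\<^sup>2) \<le> B"
  shows "(LINT w|nu. l2sum b w * cnj (e m w)) = b m"
proof -
  have summ: "summable (\<lambda>n. (cmod (b n))\<^sup>2)"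
    by (rule bounded_imp_summable[of _ B]) (use b[of "Suc _"] in \<open>auto simp: lessThan_Suc_atMost\<close>)
  have "(cmod ((LINT w|nu. l2sum b w * cnj (e m w)) - b m))\<^sup>2 \<le> \<epsilon>" if \<epsilon>: "0 < \<epsilon>" for \<epsilon>
  proof -
    obtain M0 where M0: "\<And>p q. p \<ge> M0 \<Longrightarrow> norm (\<Sum>n\<in>{p..<q}. (cmod (b n))\<^sup>2) < \<epsilon>"
      using summ \<epsilon> unfolding summable_Cauchy by blast
    define M where "M = max M0 (Suc m)"
    define c where "c n = (if n < M then 0 else b n)" for n
    have c: "(\<Sum>n<N. (cmod (c n))\<^sup>2) \<le> \<epsilon>" for N
    proof -
      have "(\<Sum>n<N. (cmod (c n))\<^sup>2) = (\<Sum>n\<in>{M..<N}. (cmod (b n))\<^sup>2)"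
        by (rule sum.mono_neutral_cong_right) (auto simp: c_def)
      also have "\<dots> \<le> norm (\<Sum>n\<in>{M..<N}. (cmod (b n))\<^sup>2)" by simp
      also have "\<dots> \<le> \<epsilon>" using M0[of M N] by (simp add: M_def less_imp_le)
      finally show ?thesis .
    qed
    let ?S = "\<lambda>w. \<Sum>n<M. b n * e n w"
    have eq: "l2sum b w = ?S w + l2sum c w" if w: "w \<in> disc" for w
    proof -
      have 1: "(\<lambda>n. if n < M then b n * e n w else 0) sums ?S w"
        using sums_If_finite_set[of "{..<M}" "\<lambda>n. b n * e n w"] by simp
      have "(\<lambda>n. (if n < M then b n * e n w else 0) + c n * e n w) sums (?S w + l2sum c w)"
        by (rule sums_add[OF 1 l2sum_sums[OF l2sum_coeff_le[OF c] w]])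
      also have "(\<lambda>n. (if n < M then b n * e n w else 0) + c n * e n w) = (\<lambda>n. b n * e n w)"
        by (auto simp: c_def)
      finally have 2: "(\<lambda>n. b n * e n w) sums (?S w + l2sum c w)" .
      show ?thesis by (rule sums_unique2[OF l2sum_sums[OF l2sum_coeff_le[OF b] w] 2])
    qed
    have "(LINT w|nu. l2sum b w * cnj (e m w)) = (LINT w|nu. ?S w * cnj (e m w) + l2sum c w * cnj (e m w))"
      by (rule Bochner_Integration.integral_cong) (auto simp: eq distrib_right)
    also have "\<dots> = (LINT w|nu. ?S w * cnj (e m w)) + (LINT w|nu. l2sum c w * cnj (e m w))"
      by (intro Bochner_Integration.integral_add integrable_bergman_mult e_bergman bergman_sum l2sum_bergman[OF c])
    also have "(LINT w|nu. ?S w * cnj (e m w)) = b m"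
      by (rule sum_e_inner) (auto simp: M_def)
    finally have "(cmod ((LINT w|nu. l2sum b w * cnj (e m w)) - b m))\<^sup>2 = (cmod (LINT w|nu. l2sum c w * cnj (e m w)))\<^sup>2"
      by simp
    also have "\<dots> \<le> (LINT w|nu. (cmod (l2sum c w))\<^sup>2) * (LINT w|nu. (cmod (e m w))\<^sup>2)"
      by (intro Cauchy_Schwarz_L2 bergmanD e_bergman l2sum_bergman[OF c])
    also have "(LINT w|nu. (cmod (e m w))\<^sup>2) = 1"
      using bergman_sum_norm[of "{m}" "\<lambda>_. 1"] by simp
    also have "(LINT w|nu. (cmod (l2sum c w))\<^sup>2) * 1 \<le> \<epsilon>"
      using l2sum_norm_le[OF c] by simp
    finally show ?thesis .
  qed
  then have "(cmod ((LINT w|nu. l2sum b w * cnj (e m w)) - b m))\<^sup>2 \<le> 0"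
    by (rule field_le_epsilon[where y=0, simplified])
  then show ?thesis by simp
qed

section \<open>Sufficiency of vanishing density\<close>

lemma norm_A2_le_1: "f \<in> A2 \<Longrightarrow> norm_A2 f \<le> 1 \<Longrightarrow> (LINT w|nu. (cmod (f w))\<^sup>2) \<le> 1"
  by (subst A2_bergman(2)[symmetric]) (auto simp: norm_A2_def abs_square_le_1)

lemma ucoeff_sum: "ucoeff k (\<lambda>w. \<Sum>n\<in>A. c n * e n w) z = (\<Sum>n\<in>A. c n * ucoeff k (e n) z)" if "z \<in> disc"
proof (induction A rule: infinite_finite_induct)
  case (insert x A)
  then show ?case
    by (simp add: ucoeff_add bergman_cmult e_bergman bergman_sum that ucoeff_cmult)
qed (simp_all add: ucoeff_def)

lemma poly_eq_sum_e: "poly p w = (\<Sum>n\<le>degree p. (coeff p n / of_real (sqrt (real n + 1))) * e n w)"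
proof -
  have "coeff p n * w ^ n = (coeff p n / of_real (sqrt (real n + 1))) * e n w" for n
  proof -
    have "complex_of_real (sqrt (real n + 1)) \<noteq> 0"
      by (simp only: of_real_eq_0_iff real_sqrt_eq_zero_cancel_iff)
    then show ?thesis by (simp add: e_def)
  qed
  then show ?thesis by (simp add: poly_altdef)
qed

context finite_disc_measure
begin

lemma vanishing_density_imp_vanishing_carleson:
  assumes vd: "vanishing_density t" and t: "0 < t" "t < 1"
  shows "vanishing_carleson \<mu>"
proof -
  obtain C where C: "0 \<le> C" "\<And>f. f \<in> bergman \<Longrightarrow> integrable \<mu> (\<lambda>z. (cmod (ucoeff 0 f z))\<^sup>2)"
    "\<And>f. f \<in> bergman \<Longrightarrow> (LINT z|\<mu>. (cmod (ucoeff 0 f z))\<^sup>2) \<le> C * (LINT w|nu. (cmod (f w))\<^sup>2)"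
    using ucoeff_bounded[OF vd t, of 0] by blast
  have eq: "(cmod (ucoeff 0 f z))\<^sup>2 = (cmod (f z))\<^sup>2" if "f \<in> bergman" "z \<in> space \<mu>" for f z
    using ucoeff_0[of f z] that by simp
  show ?thesis
    unfolding vanishing_carleson_def carleson_def
  proof (intro conjI ballI allI impI)
    fix f assume "f \<in> A2"
    then have f: "f \<in> bergman" by (rule A2_bergman)
    show "f \<in> borel_measurable \<mu>"
      by (intro borel_measurable_mu_continuous bergmanD f)
    show "integrable \<mu> (\<lambda>z. (cmod (f z))\<^sup>2)"
    proof -
      have "integrable \<mu> (\<lambda>z. (cmod (f z))\<^sup>2) \<longleftrightarrow> integrable \<mu> (\<lambda>z. (cmod (ucoeff 0 f z))\<^sup>2)"
        by (rule Bochner_Integration.integrable_cong[OF refl]) (rule eq[OF f, symmetric])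
      then show ?thesis using C(2)[OF f] by simp
    qed
  next
    fix fs :: "nat \<Rightarrow> complex \<Rightarrow> complex"
    assume fs: "\<forall>n. fs n \<in> A2 \<and> norm_A2 (fs n) \<le> 1"
    have fb: "fs n \<in> bergman" and f1: "(LINT w|nu. (cmod (fs n w))\<^sup>2) \<le> 1" for n
      using fs A2_bergman(1) norm_A2_le_1 by blast+
    obtain r :: "nat \<Rightarrow> nat" where r: "strict_mono r"
      "\<And>\<epsilon>. 0 < \<epsilon> \<Longrightarrow> \<exists>N. \<forall>m\<ge>N. \<forall>n\<ge>N. (LINT z|\<mu>. (cmod (ucoeff 0 (\<lambda>w. fs (r m) w - fs (r n) w) z))\<^sup>2) < \<epsilon>"
      by (rule ucoeff_compact[where fs = fs and k = 0, OF vd t fb f1]) (rule that)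
    show "\<exists>r::nat \<Rightarrow> nat. strict_mono r \<and> (\<forall>\<epsilon>>0. \<exists>N. \<forall>m\<ge>N. \<forall>n\<ge>N. norm_L2 \<mu> (\<lambda>z. fs (r m) z - fs (r n) z) < \<epsilon>)"
    proof (intro exI[of _ r] conjI r(1) allI impI)
      fix \<epsilon> :: real assume \<epsilon>: "0 < \<epsilon>"
      obtain N where N: "\<And>m n. m \<ge> N \<Longrightarrow> n \<ge> N \<Longrightarrow> (LINT z|\<mu>. (cmod (ucoeff 0 (\<lambda>w. fs (r m) w - fs (r n) w) z))\<^sup>2) < \<epsilon>\<^sup>2"
        using r(2)[of "\<epsilon>\<^sup>2"] \<epsilon> by auto
      have "norm_L2 \<mu> (\<lambda>z. fs (r m) z - fs (r n) z) < \<epsilon>" if "m \<ge> N" "n \<ge> N" for m n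
      proof -
        have "(LINT z|\<mu>. (cmod (fs (r m) z - fs (r n) z))\<^sup>2) = (LINT z|\<mu>. (cmod (ucoeff 0 (\<lambda>w. fs (r m) w - fs (r n) w) z))\<^sup>2)"
          by (rule Bochner_Integration.integral_cong[OF refl eq[OF bergman_diff[OF fb fb], symmetric]])
        also have "\<dots> < \<epsilon>\<^sup>2" by (rule N[OF that])
        finally show ?thesis
          unfolding norm_L2_def using \<epsilon> by (intro real_less_lsqrt) auto
      qed
      then show "\<exists>N. \<forall>m\<ge>N. \<forall>n\<ge>N. norm_L2 \<mu> (\<lambda>z. fs (r m) z - fs (r n) z) < \<epsilon>" by blast
    qed
  qed
qed

definition coef :: "nat \<Rightarrow> (complex \<Rightarrow> complex) \<Rightarrow> nat \<Rightarrow> complex" where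
  "coef k f n = (LINT z|\<mu>. ucoeff k f z * cnj (ucoeff k (e n) z))"

text \<open>The operator is \<open>ucoeff k\<close> followed by its adjoint, which is given by its coefficients
  with respect to the orthonormal basis.\<close>

definition Tk :: "nat \<Rightarrow> (complex \<Rightarrow> complex) \<Rightarrow> complex \<Rightarrow> complex" where
  "Tk k f = l2sum (coef k f)"

lemma vanishing_density_imp_Tk_bounded_compact:
  assumes vd: "vanishing_density t" and t: "0 < t" "t < 1"
  shows "Tk_bounded_compact \<mu> k"
proof -
  obtain C where C: "0 \<le> C" and intF: "\<And>f. f \<in> bergman \<Longrightarrow> integrable \<mu> (\<lambda>z. (cmod (ucoeff k f z))\<^sup>2)"
    and FC: "\<And>f. f \<in> bergman \<Longrightarrow> (LINT z|\<mu>. (cmod (ucoeff k f z))\<^sup>2) \<le> C * (LINT w|nu. (cmod (f w))\<^sup>2)"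
    using ucoeff_bounded[OF vd t, of k] by blast
  have intFF: "integrable \<mu> (\<lambda>z. ucoeff k f z * cnj (ucoeff k g z))" if "f \<in> bergman" "g \<in> bergman" for f g
    using that by (intro integrable_mult_L2 ucoeff_measurable_mu intF)
  have ucoeff_sum_mu: "(LINT z|\<mu>. ucoeff k f z * cnj (ucoeff k (\<lambda>w. \<Sum>n\<in>A. c n * e n w) z)) = (\<Sum>n\<in>A. cnj (c n) * coef k f n)"
    if f: "f \<in> bergman" for f c A
  proof -
    have "(LINT z|\<mu>. ucoeff k f z * cnj (ucoeff k (\<lambda>w. \<Sum>n\<in>A. c n * e n w) z)) = (LINT z|\<mu>. (\<Sum>n\<in>A. cnj (c n) * (ucoeff k f z * cnj (ucoeff k (e n) z))))"
      by (rule Bochner_Integration.integral_cong[OF refl]) (simp add: ucoeff_sum sum_distrib_left mult_ac)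
    also have "\<dots> = (\<Sum>n\<in>A. cnj (c n) * coef k f n)"
      unfolding coef_def by (subst Bochner_Integration.integral_sum)
         (auto intro!: integrable_mult_right intFF f e_bergman simp only: integral_mult_right_zero)
    finally show ?thesis .
  qed
  \<comment> \<open>Duality: testing against the finite sum q whose coefficients are those of f
    turns S into the form at (f, q), so S^2 \<le> I * C * S by Cauchy-Schwarz and boundedness of
    \<open>ucoeff k\<close>. Division by S gives the claim.\<close>
  have coef_le: "(\<Sum>n<N. (cmod (coef k f n))\<^sup>2) \<le> C * (LINT z|\<mu>. (cmod (ucoeff k f z))\<^sup>2)" if f: "f \<in> bergman" for f N
  proof -
    let ?S = "\<Sum>n<N. (cmod (coef k f n))\<^sup>2" and ?q = "\<lambda>w. \<Sum>n<N. coef k f n * e n w"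
    let ?I = "LINT z|\<mu>. (cmod (ucoeff k f z))\<^sup>2"
    have S: "0 \<le> ?S" by (simp add: sum_nonneg)
    have I: "0 \<le> ?I" by (rule Bochner_Integration.integral_nonneg) simp
    have eq: "complex_of_real ?S = (LINT z|\<mu>. ucoeff k f z * cnj (ucoeff k ?q z))"
      unfolding ucoeff_sum_mu[OF f] by (simp only: of_real_sum complex_norm_square mult.commute)
    have "?S\<^sup>2 = (cmod (LINT z|\<mu>. ucoeff k f z * cnj (ucoeff k ?q z)))\<^sup>2"
      unfolding eq[symmetric] norm_of_real power2_abs ..
    also have "\<dots> \<le> ?I * (LINT z|\<mu>. (cmod (ucoeff k ?q z))\<^sup>2)"
      by (intro Cauchy_Schwarz_L2 ucoeff_measurable_mu intF f bergman_sum)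
    also have "\<dots> \<le> ?I * (C * ?S)"
      using FC[OF bergman_sum, of "coef k f" "{..<N}"] I by (intro mult_left_mono) (simp_all add: bergman_sum_norm)
    finally have *: "?S * ?S \<le> (C * ?I) * ?S" by (simp add: power2_eq_square mult_ac)
    show ?thesis
    proof (cases "?S = 0")
      case True
      then show ?thesis using C I by simp
    next
      case False
      then show ?thesis using * S mult_right_le_imp_le[of ?S ?S "C * ?I"] by simp
    qed
  qed
  have coef_bound: "cmod (coef k f n) \<le> sqrt (C * (LINT z|\<mu>. (cmod (ucoeff k f z))\<^sup>2))" if "f \<in> bergman" for f n
    by (rule l2sum_coeff_le[OF coef_le[OF that]])
  have T_bergman: "Tk k f \<in> bergman" if "f \<in> bergman" for f
    unfolding Tk_def by (rule l2sum_bergman[OF coef_le[OF that]])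
  have T_meas: "Tk k f \<in> borel_measurable borel" if "f \<in> bergman" for f
    using T_bergman[OF that] unfolding Tk_def by (rule borel_measurable_l2sum)
  have T_A2: "Tk k f \<in> A2" if "f \<in> bergman" for f
    by (intro bergman_A2 T_bergman T_meas that)
  \<comment> \<open>The right side keeps \<open>ucoeff k f\<close> in place of the norm of f, so
    that a subsequence made Cauchy by \<open>ucoeff k\<close> stays Cauchy under the
    operator.\<close>
  have T_le: "(LINT w|nu. (cmod (Tk k f w))\<^sup>2) \<le> C * (LINT z|\<mu>. (cmod (ucoeff k f z))\<^sup>2)" if "f \<in> bergman" for f
    unfolding Tk_def by (rule l2sum_norm_le[OF coef_le[OF that]])
  have T_add: "Tk k (\<lambda>w. f w + g w) z = Tk k f z + Tk k g z" if fg: "f \<in> bergman" "g \<in> bergman" and z: "z \<in> disc" for f g z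
  proof -
    have "coef k (\<lambda>w. f w + g w) n = coef k f n + coef k g n" for n
    proof -
      have "coef k (\<lambda>w. f w + g w) n = (LINT z|\<mu>. ucoeff k f z * cnj (ucoeff k (e n) z) + ucoeff k g z * cnj (ucoeff k (e n) z))"
        unfolding coef_def by (rule Bochner_Integration.integral_cong[OF refl]) (simp add: ucoeff_add fg distrib_right)
      also have "\<dots> = coef k f n + coef k g n"
        unfolding coef_def by (intro Bochner_Integration.integral_add intFF fg e_bergman)
      finally show ?thesis .
    qed
    then have "coef k (\<lambda>w. f w + g w) = (\<lambda>n. coef k f n + coef k g n)" by blast
    then show ?thesis
      unfolding Tk_def using l2sum_add[OF coef_bound[OF fg(1)] coef_bound[OF fg(2)] z] by simp
  qed
  have T_cmult: "Tk k (\<lambda>w. c * f w) z = c * Tk k f z" if f: "f \<in> bergman" and z: "z \<in> disc" for f c z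
  proof -
    have "coef k (\<lambda>w. c * f w) n = c * coef k f n" for n
      unfolding coef_def ucoeff_cmult mult.assoc by (rule integral_mult_right_zero)
    then have "coef k (\<lambda>w. c * f w) = (\<lambda>n. c * coef k f n)" by blast
    then show ?thesis
      unfolding Tk_def using l2sum_cmult[OF coef_bound[OF f] z] by simp
  qed
  have T_diff: "Tk k f z - Tk k g z = Tk k (\<lambda>w. f w - g w) z" if fg: "f \<in> bergman" "g \<in> bergman" and z: "z \<in> disc" for f g z
    using T_add[OF bergman_diff[OF fg] fg(2) z] by simp
  show ?thesis
    unfolding Tk_bounded_compact_def
  proof (intro exI[of _ "Tk k"] conjI ballI allI impI)
    fix f assume "f \<in> A2"
    then show "Tk k f \<in> A2" by (intro T_A2 A2_bergman)
  next
    fix f g z assume "f \<in> A2" "g \<in> A2" "z \<in> disc"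
    then show "Tk k (\<lambda>w. f w + g w) z = Tk k f z + Tk k g z" by (intro T_add A2_bergman)
  next
    fix f c z assume "f \<in> A2" "z \<in> disc"
    then show "Tk k (\<lambda>w. c * f w) z = c * Tk k f z" by (intro T_cmult A2_bergman)
  next
    have "norm_A2 (Tk k f) \<le> C * norm_A2 f" if f: "f \<in> A2" for f
    proof (rule power2_le_imp_le)
      note fb = A2_bergman(1)[OF f]
      have "(norm_A2 (Tk k f))\<^sup>2 = (LINT w|nu. (cmod (Tk k f w))\<^sup>2)"
        by (rule A2_bergman(2)[OF T_A2[OF fb]])
      also have "\<dots> \<le> C * (LINT z|\<mu>. (cmod (ucoeff k f z))\<^sup>2)" by (rule T_le[OF fb])
      also have "\<dots> \<le> C * (C * (LINT w|nu. (cmod (f w))\<^sup>2))"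
        by (intro mult_left_mono FC fb C)
      also have "\<dots> = (C * norm_A2 f)\<^sup>2"
        unfolding power_mult_distrib A2_bergman(2)[OF f] by (simp add: power2_eq_square)
      finally show "(norm_A2 (Tk k f))\<^sup>2 \<le> (C * norm_A2 f)\<^sup>2" .
      show "0 \<le> C * norm_A2 f" using C by (simp add: norm_A2_def)
    qed
    then show "\<exists>C. \<forall>f\<in>A2. norm_A2 (Tk k f) \<le> C * norm_A2 f" by blast
  next
    fix fs :: "nat \<Rightarrow> complex \<Rightarrow> complex"
    assume fs: "\<forall>n. fs n \<in> A2 \<and> norm_A2 (fs n) \<le> 1"
    have fb: "fs n \<in> bergman" and f1: "(LINT w|nu. (cmod (fs n w))\<^sup>2) \<le> 1" for n
      using fs A2_bergman(1) norm_A2_le_1 by blast+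
    obtain r :: "nat \<Rightarrow> nat" where r: "strict_mono r"
      "\<And>\<epsilon>. 0 < \<epsilon> \<Longrightarrow> \<exists>N. \<forall>m\<ge>N. \<forall>n\<ge>N. (LINT z|\<mu>. (cmod (ucoeff k (\<lambda>w. fs (r m) w - fs (r n) w) z))\<^sup>2) < \<epsilon>"
      by (rule ucoeff_compact[where fs = fs and k = k, OF vd t fb f1]) (rule that)
    show "\<exists>r::nat \<Rightarrow> nat. strict_mono r \<and> (\<forall>\<epsilon>>0. \<exists>N. \<forall>m\<ge>N. \<forall>n\<ge>N. norm_A2 (\<lambda>z. Tk k (fs (r m)) z - Tk k (fs (r n)) z) < \<epsilon>)"
    proof (intro exI[of _ r] conjI r(1) allI impI)
      fix \<epsilon> :: real assume \<epsilon>: "0 < \<epsilon>"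
      \<comment> \<open>C may be 0, hence C + 1 in the denominator.\<close>
      have "0 < \<epsilon>\<^sup>2 / (C + 1)" using \<epsilon> C by simp
      from r(2)[OF this] obtain N where N: "\<And>m n. m \<ge> N \<Longrightarrow> n \<ge> N \<Longrightarrow> (LINT z|\<mu>. (cmod (ucoeff k (\<lambda>w. fs (r m) w - fs (r n) w) z))\<^sup>2) < \<epsilon>\<^sup>2 / (C + 1)"
        by auto
      have "norm_A2 (\<lambda>z. Tk k (fs (r m)) z - Tk k (fs (r n)) z) < \<epsilon>" if "m \<ge> N" "n \<ge> N" for m n
      proof -
        let ?h = "\<lambda>w. fs (r m) w - fs (r n) w"
        note h = bergman_diff[OF fb fb, of "r m" "r n"]
        note [measurable] = T_meas[OF fb]
        have "(LINT z|dA. (cmod (Tk k (fs (r m)) z - Tk k (fs (r n)) z))\<^sup>2) = (LINT z|nu. (cmod (Tk k (fs (r m)) z - Tk k (fs (r n)) z))\<^sup>2)"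
          by (rule integral_dA_eq_nu) measurable
        also have "\<dots> = (LINT z|nu. (cmod (Tk k ?h z))\<^sup>2)"
          by (rule Bochner_Integration.integral_cong[OF refl]) (simp add: T_diff fb)
        also have "\<dots> \<le> C * (LINT z|\<mu>. (cmod (ucoeff k ?h z))\<^sup>2)" by (rule T_le[OF h])
        also have "\<dots> \<le> C * (\<epsilon>\<^sup>2 / (C + 1))"
          using N[OF that] C by (intro mult_left_mono) auto
        also have "\<dots> < \<epsilon>\<^sup>2" using C \<epsilon> by (simp add: field_simps)
        finally show ?thesis
          unfolding norm_A2_def using \<epsilon> by (intro real_less_lsqrt) auto
      qed
      then show "\<exists>N. \<forall>m\<ge>N. \<forall>n\<ge>N. norm_A2 (\<lambda>z. Tk k (fs (r m)) z - Tk k (fs (r n)) z) < \<epsilon>" by blast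
    qed
  next
    fix p q :: "complex poly"
    have pm: "poly p \<in> borel_measurable borel" for p :: "complex poly"
      by (intro borel_measurable_continuous_onI continuous_intros)
    have eq: "Tk_integrand k (poly p) (poly q) z = ucoeff k (poly p) z * cnj (ucoeff k (poly q) z)" if "z \<in> space \<mu>" for z
      using that by (intro Tk_integrand_eq pm) simp
    show "integrable \<mu> (Tk_integrand k (poly p) (poly q))"
      using intFF[OF bergman_poly bergman_poly, of p q]
      by (subst Bochner_Integration.integrable_cong[OF refl eq])
    let ?c = "\<lambda>n. coeff q n / of_real (sqrt (real n + 1))"
    have q: "poly q = (\<lambda>w. \<Sum>n\<le>degree q. ?c n * e n w)"
      by (rule ext) (rule poly_eq_sum_e)
    note [measurable] = pm T_meas[OF bergman_poly]
    have "inner_A2 (Tk k (poly p)) (poly q) = (LINT w|nu. Tk k (poly p) w * cnj (poly q w))"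
      unfolding inner_A2_def by (rule integral_dA_eq_nu) measurable
    also have "\<dots> = (\<Sum>n\<le>degree q. cnj (?c n) * coef k (poly p) n)"
      unfolding q bergman_sum_inner[OF T_bergman[OF bergman_poly]]
      unfolding Tk_def l2sum_inner_e[OF coef_le[OF bergman_poly]] ..
    also have "\<dots> = (LINT z|\<mu>. ucoeff k (poly p) z * cnj (ucoeff k (\<lambda>w. \<Sum>n\<le>degree q. ?c n * e n w) z))"
      by (rule ucoeff_sum_mu[OF bergman_poly, symmetric])
    also have "\<dots> = (LINT z|\<mu>. ucoeff k (poly p) z * cnj (ucoeff k (poly q) z))"
      by (simp only: q[symmetric])
    also have "\<dots> = integral\<^sup>L \<mu> (Tk_integrand k (poly p) (poly q))"
      by (rule Bochner_Integration.integral_cong[OF refl eq[symmetric]])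
    finally show "inner_A2 (Tk k (poly p)) (poly q) = integral\<^sup>L \<mu> (Tk_integrand k (poly p) (poly q))" .
  qed
qed

end

section \<open>Test functions\<close>

text \<open>Write 1 - cnj w * z = (1 - |w|^2) - cnj w * (z - w); the two terms are at most 2 and 1
  times 1 - |w|.\<close>

lemma cmod_one_minus_cnj_le:
  assumes "w \<in> disc" "cmod (z - w) \<le> 1 - cmod w"
  shows "cmod (1 - cnj w * z) \<le> 3 * (1 - cmod w)"
proof -
  have w: "cmod w < 1" using assms by (simp add: in_disc)
  have eq: "1 - cnj w * z = of_real (1 - (cmod w)\<^sup>2) - cnj w * (z - w)"
    unfolding of_real_diff of_real_1 complex_norm_square by (simp add: algebra_simps)
  have "cmod (1 - cnj w * z) \<le> \<bar>1 - (cmod w)\<^sup>2\<bar> + cmod w * cmod (z - w)"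
    unfolding eq by (rule order_trans[OF norm_triangle_ineq4]) (simp only: norm_of_real norm_mult complex_mod_cnj order_refl)
  also have "\<bar>1 - (cmod w)\<^sup>2\<bar> = (1 - cmod w) * (1 + cmod w)"
  proof -
    have "1 - (cmod w)\<^sup>2 = (1 - cmod w) * (1 + cmod w)" by (simp add: power2_eq_square algebra_simps)
    moreover have "0 \<le> (1 - cmod w) * (1 + cmod w)" using w by simp
    ultimately show ?thesis by simp
  qed
  also have "(1 - cmod w) * (1 + cmod w) + cmod w * cmod (z - w) \<le> (1 - cmod w) * 2 + 1 * (1 - cmod w)"
    using w assms(2) by (intro add_mono mult_mono) auto
  finally show ?thesis by simp
qed

lemma one_minus_norm_square_bounds:
  assumes "w \<in> disc"
  shows "1 - cmod w \<le> 1 - (cmod w)\<^sup>2" "1 - (cmod w)\<^sup>2 \<le> 2 * (1 - cmod w)" "0 < 1 - cmod w" "0 < 1 - (cmod w)\<^sup>2"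
proof -
  show w: "0 < 1 - cmod w" using assms by (simp add: in_disc)
  have eq: "1 - (cmod w)\<^sup>2 = (1 - cmod w) * (1 + cmod w)" by (simp add: power2_eq_square algebra_simps)
  have "(1 - cmod w) * 1 \<le> (1 - cmod w) * (1 + cmod w)" "(1 - cmod w) * (1 + cmod w) \<le> (1 - cmod w) * 2"
    using w by (intro mult_left_mono; simp)+
  then show "1 - cmod w \<le> 1 - (cmod w)\<^sup>2" "1 - (cmod w)\<^sup>2 \<le> 2 * (1 - cmod w)"
    unfolding eq by simp_all
  with w show "0 < 1 - (cmod w)\<^sup>2" by linarith
qed

lemma borel_measurable_kern [measurable]: "kern k z \<in> borel_measurable borel"
  unfolding kern_def[abs_def] by measurable

text \<open>The Taylor series at 0 has radius of convergence greater than 1, so its partial sums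
  converge uniformly on the closed unit disc.\<close>

lemma poly_approx:
  assumes f: "f holomorphic_on ball 0 \<rho>" and "1 < \<rho>" "0 < \<eta>"
  obtains p where "\<And>z. z \<in> disc \<Longrightarrow> cmod (poly p z - f z) < \<eta>"
proof -
  define a where "a n = (deriv ^^ n) f 0 / fact n" for n
  have sums: "(\<lambda>n. a n * (z - 0) ^ n) sums f z" if "z \<in> ball 0 \<rho>" for z
    using holomorphic_power_series[OF f that] by (simp add: a_def)
  have \<rho>: "cmod (of_real ((1 + \<rho>) / 2)) = (1 + \<rho>) / 2"
    using assms(2) by (simp only: norm_of_real) simp
  have "summable (\<lambda>n. a n * of_real ((1 + \<rho>) / 2) ^ n)"
    using sums[of "of_real ((1 + \<rho>) / 2)"] assms(2) unfolding mem_ball_0 \<rho> by (simp add: sums_iff)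
  from conv_radius_geI[OF this] have "ereal ((1 + \<rho>) / 2) \<le> conv_radius a"
    unfolding \<rho> .
  moreover have "ereal 1 < ereal ((1 + \<rho>) / 2)" using assms(2) by simp
  ultimately have "ereal 1 < conv_radius a" by (rule less_le_trans[rotated])
  from uniform_limitD[OF powser_uniform_limit[OF this, of 0] \<open>0 < \<eta>\<close>]
  obtain N where N: "\<forall>z\<in>cball 0 1. dist (\<Sum>i<N. a i * (z - 0) ^ i) (\<Sum>i. a i * (z - 0) ^ i) < \<eta>"
    unfolding eventually_sequentially by blast
  show ?thesis
  proof (rule that[of "\<Sum>i<N. monom (a i) i"])
    fix z assume "z \<in> disc"
    then have z: "z \<in> cball 0 1" "z \<in> ball 0 \<rho>" using assms(2) by (auto simp: in_disc)
    have "(\<Sum>i. a i * (z - 0) ^ i) = f z" using sums[OF z(2)] by (simp add: sums_iff)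
    moreover have "poly (\<Sum>i<N. monom (a i) i) z = (\<Sum>i<N. a i * (z - 0) ^ i)"
      by (simp add: poly_sum poly_monom)
    ultimately show "cmod (poly (\<Sum>i<N. monom (a i) i) z - f z) < \<eta>"
      using N z(1) by (metis dist_norm)
  qed
qed

lemma poly_approx_kern:
  assumes w: "w \<in> disc" and "0 < \<eta>"
  obtains p where "\<And>z. z \<in> disc \<Longrightarrow> cmod (poly p z - c * kern k w z) < \<eta>"
proof (rule poly_approx[OF _ _ \<open>0 < \<eta>\<close>])
  \<comment> \<open>A radius between 1 and the modulus 1 / |w| of the pole: |w| *
    \<open>\<rho>\<close> < 1 < \<open>\<rho>\<close>. The formula makes sense for w = 0
    too.\<close>
  define \<rho> where "\<rho> = 2 / (1 + cmod w)"
  have w1: "cmod w < 1" using w by (simp add: in_disc)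
  have pos: "0 < 1 + cmod w" by (simp add: add_pos_nonneg)
  show "1 < \<rho>" using w1 pos by (simp add: \<rho>_def)
  have ne: "1 - cnj w * z \<noteq> 0" if "z \<in> ball 0 \<rho>" for z
  proof -
    have "cmod (cnj w * z) \<le> cmod w * \<rho>"
      using that by (simp add: norm_mult mult_left_mono)
    also have "\<dots> < 1" using w1 pos by (simp add: \<rho>_def)
    finally show ?thesis by auto
  qed
  show "(\<lambda>z. c * kern k w z) holomorphic_on ball 0 \<rho>"
    unfolding kern_def using ne by (intro holomorphic_intros) auto
qed (rule that)

text \<open>The normalized area \<open>3/16\<close> of the annulus \<open>1/4 \<le> \<bar>z - w\<bar> < 1/2\<close> (in units of \<open>1 - \<bar>w\<bar>\<close>)
  times a lower bound on it for the square of the modulus of the kernel, divided by \<open>k + 1\<close>.\<close>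

definition gap :: "nat \<Rightarrow> real" where
  "gap k = 3 / 16 / (144 ^ k * 81)"

lemma gap_pos: "0 < gap k" and gap_le_1: "gap k \<le> 1"
proof -
  show "0 < gap k" by (simp add: gap_def)
  have "(1::real) * 1 \<le> 144 ^ k * 81" by (intro mult_mono) auto
  then have "gap k \<le> (3 / 16) / 1" unfolding gap_def by (intro frac_le) auto
  then show "gap k \<le> 1" by simp
qed

text \<open>The kernel vanishes to order k at z = w, so it has no useful pointwise lower bound at
  the centre; it is bounded below on an annulus around w, whose area is of order (1 -
  |w|)^2.\<close>

lemma integral_kern_ge:
  assumes w: "w \<in> disc"
  shows "(real k + 1) * gap k / (1 - cmod w)\<^sup>2 \<le> (LINT z|nu. (cmod (kern k w z))\<^sup>2)"
proof -
  define \<delta> where "\<delta> = 1 - cmod w"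
  have \<delta>: "0 < \<delta>" using w by (simp add: \<delta>_def in_disc)
  have sub: "ball w (\<delta> / 2) \<subseteq> disc" "ball w (\<delta> / 4) \<subseteq> disc"
  proof -
    have "cmod w + \<delta> / 2 \<le> 1" "cmod w + \<delta> / 4 \<le> 1" using \<delta> by (simp_all add: \<delta>_def field_simps)
    then show "ball w (\<delta> / 2) \<subseteq> disc" "ball w (\<delta> / 4) \<subseteq> disc" by (simp_all only: ball_subset_disc)
  qed
  \<comment> \<open>Without its factor sqrt (k+1), the modulus of the kernel is |w - z|^k / |1 - cnj
    w * z|^(k+2). On the annulus the numerator is at least (\<open>\<delta>\<close> / 4)^k and the
    base of the denominator at most 3 * \<open>\<delta>\<close>; the square yields 144^k *
    81.\<close>
  define A where "A = (\<delta> / 4) ^ k / (3 * \<delta>) ^ (k + 2)"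
  have A: "0 \<le> A" using \<delta> by (simp add: A_def)
  let ?i = "\<lambda>z. indicator (ball w (\<delta> / 2)) z - indicator (ball w (\<delta> / 4)) z :: real"
  have int: "integrable nu (indicator (ball w r) :: _ \<Rightarrow> real)" for r
    by (rule nu.integrable_const_bound[where B=1]) (auto simp: indicator_def intro: borel_measurable_indicator_ball_nu)
  have le: "((real k + 1) * A\<^sup>2) * ?i z \<le> (cmod (kern k w z))\<^sup>2" if z: "z \<in> disc" for z
  proof (cases "\<delta> / 4 \<le> dist w z \<and> dist w z < \<delta> / 2")
    case True
    then have d: "\<delta> / 4 \<le> cmod (w - z)" "cmod (z - w) \<le> 1 - cmod w"
      using \<delta> by (auto simp: dist_norm norm_minus_commute \<delta>_def)
    have "sqrt (real k + 1) * A \<le> sqrt (real k + 1) * (cmod (w - z) ^ k / cmod (1 - cnj w * z) ^ (k + 2))"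
      unfolding A_def using \<delta> d one_minus_cnj_mult_bounds(2)[OF w z] cmod_one_minus_cnj_le[OF w d(2)]
      by (intro mult_left_mono frac_le power_mono) (auto simp: \<delta>_def)
    also have "\<dots> = cmod (kern k w z)"
      by (simp add: kern_def norm_divide norm_mult norm_power del: power_Suc)
    finally have "(sqrt (real k + 1) * A)\<^sup>2 \<le> (cmod (kern k w z))\<^sup>2"
      using A by (intro power_mono) auto
    then show ?thesis using True by (simp add: power_mult_distrib)
  next
    case False
    then have "?i z = 0" using \<delta> by (auto simp: indicator_def)
    then show ?thesis by simp
  qed
  have "(LINT z|nu. ((real k + 1) * A\<^sup>2) * ?i z) \<le> (LINT z|nu. (cmod (kern k w z))\<^sup>2)"
    using le by (intro integral_mono integrable_mult_right Bochner_Integration.integrable_diff int bergmanD kern_bergman w) auto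
  also have "(LINT z|nu. ((real k + 1) * A\<^sup>2) * ?i z) = ((real k + 1) * A\<^sup>2) * (LINT z|nu. ?i z)"
    by (rule integral_mult_right_zero)
  also have "(LINT z|nu. ?i z) = 3 / 16 * \<delta>\<^sup>2"
    using \<delta> integral_nu_indicator_ball[OF sub(1)] integral_nu_indicator_ball[OF sub(2)]
    by (subst Bochner_Integration.integral_diff[OF int int]) (simp add: power_divide)
  also have "((real k + 1) * A\<^sup>2) * (3 / 16 * \<delta>\<^sup>2) = (real k + 1) * (A\<^sup>2 * (3 / 16 * \<delta>\<^sup>2))"
    by (rule mult.assoc)
  also have "A\<^sup>2 * (3 / 16 * \<delta>\<^sup>2) = gap k / \<delta>\<^sup>2"
  proof -
    have "(4::real) ^ k * 3 ^ k = 12 ^ k" by (simp flip: power_mult_distrib)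
    then have "A = 1 / (12 ^ k * (9 * \<delta>\<^sup>2))"
      unfolding A_def using \<delta> by (simp add: power_divide power_mult_distrib power_add power2_eq_square)
    then have "A\<^sup>2 = 1 / (144 ^ k * (81 * (\<delta>\<^sup>2 * \<delta>\<^sup>2)))"
      by (simp add: power2_eq_square power_mult_distrib[symmetric])
    then show ?thesis using \<delta> by (simp add: gap_def field_simps power2_eq_square)
  qed
  finally show ?thesis by (simp add: \<delta>_def)
qed

text \<open>The kernel at w is - sqrt (k+1) * \<open>\<alpha>\<close>^k / b^2 with
  \<open>\<alpha>\<close> of modulus at most 1. Moving w to z perturbs a and b by at most t * |b|
  each. This costs 4 * t in \<open>\<alpha>\<close>, hence 4 * k * t in its power, and 6 * t in the
  ratio of the squared denominators.\<close>

lemma kern_lipschitz: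
  assumes w: "w \<in> disc" and z: "z \<in> disc" and \<zeta>: "\<zeta> \<in> disc"
    and t: "cmod (z - w) \<le> t * (1 - cmod w)" "0 \<le> t" "t \<le> 1 / 2"
  shows "cmod (kern k z \<zeta> - kern k w \<zeta>) \<le> sqrt (real k + 1) * (4 * k + 6) * t * cmod (kern 0 w \<zeta>)"
proof -
  define a a' b b' where "a = w - \<zeta>" and "a' = z - \<zeta>" and "b = 1 - cnj w * \<zeta>" and "b' = 1 - cnj z * \<zeta>"
  note bw = one_minus_cnj_mult_bounds[OF w \<zeta>, folded a_def b_def]
  note bz = one_minus_cnj_mult_bounds[OF z \<zeta>, folded a'_def b'_def]
  have nz: "b \<noteq> 0" "b' \<noteq> 0" using bw bz by auto
  have "t * (1 - cmod w) \<le> t * cmod b" using bw t by (intro mult_left_mono) auto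
  with t have zw: "cmod (z - w) \<le> t * cmod b" by linarith
  have da: "cmod (a' - a) \<le> t * cmod b" using zw by (simp add: a_def a'_def)
  have db: "cmod (b - b') \<le> t * cmod b"
  proof -
    have "b - b' = cnj (z - w) * \<zeta>" by (simp add: b_def b'_def algebra_simps)
    then have "cmod (b - b') = cmod (z - w) * cmod \<zeta>" by (simp only: norm_mult complex_mod_cnj)
    also have "\<dots> \<le> cmod (z - w)" using \<zeta> by (intro mult_left_le) (auto simp: in_disc)
    finally show ?thesis using zw by linarith
  qed
  \<comment> \<open>Here t \<le> 1/2 is used: the denominator loses at most half its modulus, so the
    ratio \<open>\<beta>\<close> introduced next has modulus at most 2.\<close>
  have b': "cmod b / 2 \<le> cmod b'"
  proof -
    have "t * cmod b \<le> 1 / 2 * cmod b" using t by (intro mult_right_mono) auto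
    then show ?thesis using db norm_triangle_ineq2[of b b'] by linarith
  qed
  define \<alpha> \<alpha>' \<beta> where "\<alpha> = a / b" and "\<alpha>' = a' / b'" and "\<beta> = b / b'"
  have \<alpha>: "cmod \<alpha> \<le> 1" "cmod \<alpha>' \<le> 1"
    using bw(3) bz(3) nz by (auto simp: \<alpha>_def \<alpha>'_def norm_divide)
  have \<beta>: "cmod \<beta> \<le> 2"
    using b' nz by (simp add: \<beta>_def norm_divide field_simps)
  have b'': "t * cmod b / cmod b' \<le> 2 * t"
  proof -
    have "t * cmod \<beta> \<le> t * 2" using \<beta> t by (intro mult_left_mono) auto
    then show ?thesis by (simp add: \<beta>_def norm_divide mult.commute)
  qed
  have "\<alpha>' - \<alpha> = (a' - a) / b' + \<alpha> * ((b - b') / b')"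
    using nz by (simp add: \<alpha>_def \<alpha>'_def field_simps)
  then have "cmod (\<alpha>' - \<alpha>) \<le> cmod (a' - a) / cmod b' + cmod \<alpha> * (cmod (b - b') / cmod b')"
    by (metis norm_divide norm_mult norm_triangle_ineq)
  also have "\<dots> \<le> 2 * t + 1 * (2 * t)"
  proof (intro add_mono mult_mono \<alpha>)
    show "cmod (a' - a) / cmod b' \<le> 2 * t" "cmod (b - b') / cmod b' \<le> 2 * t"
      using divide_right_mono[OF da, of "cmod b'"] divide_right_mono[OF db, of "cmod b'"] b'' by auto
  qed auto
  finally have d\<alpha>: "cmod (\<alpha>' - \<alpha>) \<le> 4 * t" by simp
  have d\<alpha>k: "cmod (\<alpha>' ^ k - \<alpha> ^ k) \<le> k * (4 * t)"
    using norm_power_diff[OF \<alpha>(2,1), of k] mult_left_mono[OF d\<alpha>, of "real k"] by linarith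
  have d\<beta>: "cmod (\<beta>\<^sup>2 - 1) \<le> 6 * t"
  proof -
    have "\<beta> - 1 = (b - b') / b'" using nz by (simp add: \<beta>_def field_simps)
    then have "cmod (\<beta> - 1) \<le> 2 * t"
      using divide_right_mono[OF db, of "cmod b'"] b'' by (simp add: norm_divide)
    moreover have "cmod (\<beta> + 1) \<le> 3" using \<beta> norm_triangle_ineq[of \<beta> 1] by simp
    moreover have "\<beta>\<^sup>2 - 1 = (\<beta> - 1) * (\<beta> + 1)" by (simp add: power2_eq_square algebra_simps)
    ultimately show ?thesis
      using mult_mono[of "cmod (\<beta> - 1)" "2 * t" "cmod (\<beta> + 1)" 3] t by (simp add: norm_mult)
  qed
  have "cmod (\<alpha>' ^ k * \<beta>\<^sup>2 - \<alpha> ^ k) \<le> cmod (\<alpha>' ^ k * (\<beta>\<^sup>2 - 1)) + cmod (\<alpha>' ^ k - \<alpha> ^ k)"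
    using norm_triangle_ineq[of "\<alpha>' ^ k * (\<beta>\<^sup>2 - 1)" "\<alpha>' ^ k - \<alpha> ^ k"] by (simp add: algebra_simps)
  also have "\<dots> \<le> 1 * (6 * t) + k * (4 * t)"
    unfolding norm_mult norm_power using \<alpha>(2)
    by (intro add_mono mult_mono d\<beta> d\<alpha>k[unfolded norm_power] power_le_one) auto
  finally have le: "cmod (\<alpha>' ^ k * \<beta>\<^sup>2 - \<alpha> ^ k) \<le> (4 * k + 6) * t" by (simp add: algebra_simps)
  have "kern k z \<zeta> - kern k w \<zeta> = - of_real (sqrt (real k + 1)) * (\<alpha>' ^ k * \<beta>\<^sup>2 - \<alpha> ^ k) / b\<^sup>2"
  proof -
    have "a' ^ k / b' ^ (k + 2) = \<alpha>' ^ k * \<beta>\<^sup>2 / b\<^sup>2" "a ^ k / b ^ (k + 2) = \<alpha> ^ k / b\<^sup>2"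
      using nz by (simp_all add: \<alpha>'_def \<alpha>_def \<beta>_def power_divide power_add power2_eq_square)
    moreover have "kern k z \<zeta> = - of_real (sqrt (real k + 1)) * (a' ^ k / b' ^ (k + 2))"
      "kern k w \<zeta> = - of_real (sqrt (real k + 1)) * (a ^ k / b ^ (k + 2))"
      by (simp_all add: kern_def a_def a'_def b_def b'_def del: power_Suc)
    ultimately show ?thesis by (simp add: diff_divide_distrib right_diff_distrib)
  qed
  then have "cmod (kern k z \<zeta> - kern k w \<zeta>) = sqrt (real k + 1) * cmod (\<alpha>' ^ k * \<beta>\<^sup>2 - \<alpha> ^ k) / (cmod b)\<^sup>2"
    by (simp only: norm_divide norm_mult norm_minus_cancel norm_of_real norm_power) simp
  also have "\<dots> \<le> sqrt (real k + 1) * ((4 * k + 6) * t) / (cmod b)\<^sup>2"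
    by (intro divide_right_mono mult_left_mono le) auto
  finally show ?thesis by (simp add: cmod_kern_0 b_def mult_ac)
qed

lemma ucoeff_cauchy_schwarz:
  assumes "h \<in> bergman" "z \<in> disc"
  shows "(cmod (ucoeff k h z))\<^sup>2 \<le> (LINT w|nu. (cmod (h w))\<^sup>2) * ((real k + 1) / (1 - (cmod z)\<^sup>2)\<^sup>2)"
proof -
  have "(cmod (ucoeff k h z))\<^sup>2 \<le> (LINT w|nu. (cmod (h w))\<^sup>2) * (LINT w|nu. (cmod (kern k z w))\<^sup>2)"
    unfolding ucoeff_def by (intro Cauchy_Schwarz_L2 bergmanD kern_bergman assms)
  also have "\<dots> \<le> (LINT w|nu. (cmod (h w))\<^sup>2) * ((real k + 1) / (1 - (cmod z)\<^sup>2)\<^sup>2)"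
    by (intro mult_left_mono integral_kern_le assms Bochner_Integration.integral_nonneg) auto
  finally show ?thesis .
qed

lemma measure_nu_disc: "measure nu disc = 1"
proof -
  have "(LINT w|nu. indicator (ball 0 1) w) = (1::real)"
    using integral_nu_indicator_ball[of 0 1] by (simp add: disc_def)
  moreover have "(LINT w|nu. indicator (ball 0 1) w) = (LINT w|nu. 1::real)"
    by (rule Bochner_Integration.integral_cong) (auto simp: disc_def)
  ultimately show ?thesis by simp
qed

lemma L2_le_sup:
  assumes "h \<in> bergman" "\<And>z. z \<in> disc \<Longrightarrow> cmod (h z) \<le> \<eta>"
  shows "(LINT w|nu. (cmod (h w))\<^sup>2) \<le> \<eta>\<^sup>2"
proof -
  have "(LINT w|nu. (cmod (h w))\<^sup>2) \<le> (LINT w|nu. \<eta>\<^sup>2)"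
    using assms by (intro integral_mono bergmanD) (auto intro: power_mono)
  then show ?thesis by (simp add: measure_nu_disc)
qed

text \<open>This is \<open>U\<^sub>w e\<^sub>k\<close> divided by \<open>2 sqrt (k + 1)\<close>, so that uniformly close polynomials stay in the
  unit ball.\<close>

definition test_fun :: "nat \<Rightarrow> complex \<Rightarrow> complex \<Rightarrow> complex" where
  "test_fun k w \<zeta> = of_real ((1 - (cmod w)\<^sup>2) / (2 * sqrt (real k + 1))) * kern k w \<zeta>"

lemma test_fun_bergman: "w \<in> disc \<Longrightarrow> test_fun k w \<in> bergman"
  unfolding test_fun_def[abs_def] by (intro bergman_cmult kern_bergman)

lemma test_fun_norm:
  assumes "w \<in> disc"
  shows "(LINT \<zeta>|nu. (cmod (test_fun k w \<zeta>))\<^sup>2) \<le> 1 / 4"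
proof -
  define c where "c = (1 - (cmod w)\<^sup>2) / (2 * sqrt (real k + 1))"
  have "(LINT \<zeta>|nu. (cmod (test_fun k w \<zeta>))\<^sup>2) = c\<^sup>2 * (LINT \<zeta>|nu. (cmod (kern k w \<zeta>))\<^sup>2)"
    unfolding test_fun_def c_def[symmetric] norm_mult norm_of_real power_mult_distrib power2_abs
    by (rule integral_mult_right_zero)
  also have "\<dots> \<le> c\<^sup>2 * ((real k + 1) / (1 - (cmod w)\<^sup>2)\<^sup>2)"
    by (intro mult_left_mono integral_kern_le assms) auto
  also have "\<dots> = 1 / 4"
    using one_minus_norm_square_bounds(4)[OF assms] by (simp add: c_def power_divide power_mult_distrib)
  finally show ?thesis .
qed

text \<open>At z = w the coefficient is a multiple of the squared norm of the kernel, hence at least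
  sqrt (k+1) * \<open>gap k\<close> / (2 * (1 - |w|)). The smallness of t keeps the change from w to
  z below half of that, by Cauchy-Schwarz and the Lipschitz bound.\<close>

lemma ucoeff_test_fun_ge:
  assumes w: "w \<in> disc" and z: "z \<in> disc"
    and t: "cmod (z - w) \<le> t * (1 - cmod w)" "0 \<le> t" "(4 * k + 6) * t \<le> gap k / 2"
  shows "sqrt (real k + 1) * gap k / (4 * (1 - cmod w)) \<le> cmod (ucoeff k (test_fun k w) z)"
proof -
  define \<delta> where "\<delta> = 1 - cmod w"
  define s where "s = sqrt (real k + 1)"
  have s: "0 < s" "s\<^sup>2 = real k + 1" by (simp_all add: s_def add_nonneg_pos)
  note d = one_minus_norm_square_bounds[OF w, folded \<delta>_def]
  define c where "c = (1 - (cmod w)\<^sup>2) / (2 * s)"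
  have c: "\<delta> / (2 * s) \<le> c" unfolding c_def using d s by (intro divide_right_mono) auto
  have c0: "0 < c" using d s by (simp add: c_def)
  have "t \<le> 1 / 2"
  proof -
    have "2 * t \<le> (4 * real k + 6) * t" using t by (intro mult_right_mono) auto
    then show ?thesis using t gap_le_1[of k] by linarith
  qed
  note v = test_fun_bergman[OF w, of k]
  have tf: "test_fun k w \<zeta> = of_real c * kern k w \<zeta>" for \<zeta> by (simp only: test_fun_def c_def s_def)
  have "ucoeff k (test_fun k w) w = of_real c * (LINT \<zeta>|nu. of_real ((cmod (kern k w \<zeta>))\<^sup>2))"
    unfolding ucoeff_def tf mult.assoc complex_norm_square by (rule integral_mult_right_zero)
  then have "ucoeff k (test_fun k w) w = of_real (c * (LINT \<zeta>|nu. (cmod (kern k w \<zeta>))\<^sup>2))"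
    by (simp only: integral_complex_of_real of_real_mult)
  then have "cmod (ucoeff k (test_fun k w) w) = c * (LINT \<zeta>|nu. (cmod (kern k w \<zeta>))\<^sup>2)"
    using c0 by (simp only: norm_of_real) (simp add: Bochner_Integration.integral_nonneg)
  moreover have "\<delta> / (2 * s) * ((real k + 1) * gap k / \<delta>\<^sup>2) \<le> c * (LINT \<zeta>|nu. (cmod (kern k w \<zeta>))\<^sup>2)"
    using c c0 gap_pos[of k] integral_kern_ge[OF w, of k] by (intro mult_mono) (auto simp: \<delta>_def)
  moreover have "\<delta> / (2 * s) * ((real k + 1) * gap k / \<delta>\<^sup>2) = s * gap k / (2 * \<delta>)"
    using d s unfolding s(2)[symmetric] by (simp add: power2_eq_square field_simps)
  ultimately have 1: "s * gap k / (2 * \<delta>) \<le> cmod (ucoeff k (test_fun k w) w)" by simp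
  have Gd: "(\<lambda>\<zeta>. kern k z \<zeta> - kern k w \<zeta>) \<in> bergman" by (intro bergman_diff kern_bergman w z)
  have "ucoeff k (test_fun k w) z - ucoeff k (test_fun k w) w = (LINT \<zeta>|nu. test_fun k w \<zeta> * cnj (kern k z \<zeta>) - test_fun k w \<zeta> * cnj (kern k w \<zeta>))"
    unfolding ucoeff_def by (intro Bochner_Integration.integral_diff[symmetric] integrable_mult_kern v w z)
  also have "\<dots> = (LINT \<zeta>|nu. test_fun k w \<zeta> * cnj (kern k z \<zeta> - kern k w \<zeta>))"
    by (simp only: right_diff_distrib complex_cnj_diff)
  finally have "(cmod (ucoeff k (test_fun k w) z - ucoeff k (test_fun k w) w))\<^sup>2
      \<le> (LINT \<zeta>|nu. (cmod (test_fun k w \<zeta>))\<^sup>2) * (LINT \<zeta>|nu. (cmod (kern k z \<zeta> - kern k w \<zeta>))\<^sup>2)"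
    by (simp only:) (intro Cauchy_Schwarz_L2 bergmanD v Gd)
  also have "\<dots> \<le> 1 / 4 * ((s * ((4 * k + 6) * t))\<^sup>2 * (1 / (1 - (cmod w)\<^sup>2)\<^sup>2))"
  proof (intro mult_mono test_fun_norm w)
    have "(LINT \<zeta>|nu. (cmod (kern k z \<zeta> - kern k w \<zeta>))\<^sup>2) \<le> (LINT \<zeta>|nu. (s * ((4 * k + 6) * t))\<^sup>2 * (cmod (kern 0 w \<zeta>))\<^sup>2)"
    proof (intro integral_mono integrable_mult_right bergmanD[OF Gd] bergmanD[OF kern_bergman[OF w]])
      fix \<zeta> assume "\<zeta> \<in> space nu"
      then have "cmod (kern k z \<zeta> - kern k w \<zeta>) \<le> (s * ((4 * k + 6) * t)) * cmod (kern 0 w \<zeta>)"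
        using kern_lipschitz[OF w z _ t(1,2) \<open>t \<le> 1 / 2\<close>, of \<zeta> k] by (simp add: s_def mult.assoc)
      then have "(cmod (kern k z \<zeta> - kern k w \<zeta>))\<^sup>2 \<le> ((s * ((4 * k + 6) * t)) * cmod (kern 0 w \<zeta>))\<^sup>2"
        by (rule power_mono) simp
      then show "(cmod (kern k z \<zeta> - kern k w \<zeta>))\<^sup>2 \<le> (s * ((4 * k + 6) * t))\<^sup>2 * (cmod (kern 0 w \<zeta>))\<^sup>2"
        by (simp only: power_mult_distrib)
    qed
    then show "(LINT \<zeta>|nu. (cmod (kern k z \<zeta> - kern k w \<zeta>))\<^sup>2) \<le> (s * ((4 * k + 6) * t))\<^sup>2 * (1 / (1 - (cmod w)\<^sup>2)\<^sup>2)"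
      by (simp only: integral_mult_right_zero integral_kern_0[OF w])
  qed (auto intro: Bochner_Integration.integral_nonneg)
  also have "\<dots> = (s * ((4 * k + 6) * t) / (2 * (1 - (cmod w)\<^sup>2)))\<^sup>2"
    unfolding power_divide power_mult_distrib by simp
  finally have "cmod (ucoeff k (test_fun k w) z - ucoeff k (test_fun k w) w) \<le> s * ((4 * k + 6) * t) / (2 * (1 - (cmod w)\<^sup>2))"
    using s d t by (elim power2_le_imp_le) auto
  also have "\<dots> \<le> s * (gap k / 2) / (2 * \<delta>)"
    using s d t gap_pos[of k] by (intro frac_le mult_left_mono) auto
  finally have 2: "cmod (ucoeff k (test_fun k w) z - ucoeff k (test_fun k w) w) \<le> s * gap k / (4 * \<delta>)"
    by simp
  have "s * gap k / (2 * \<delta>) = 2 * (s * gap k / (4 * \<delta>))" using d by (simp add: field_simps)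
  moreover have "cmod (ucoeff k (test_fun k w) w) \<le> cmod (ucoeff k (test_fun k w) z) + cmod (ucoeff k (test_fun k w) z - ucoeff k (test_fun k w) w)"
    by (metis norm_minus_commute norm_triangle_sub)
  ultimately show ?thesis using 1 2 unfolding s_def \<delta>_def by (smt (verit))
qed

text \<open>The inner product with g is a real multiple of \<open>ucoeff k g (w n)\<close>. The
  local bound controls it by the integral of |g|^2 over a ball around w n, and the factors 1 - |w n|
  cancel. Each fixed point lies outside these balls eventually, so dominated convergence
  applies.\<close>

lemma test_fun_weak_limit:
  assumes g: "g \<in> bergman" and w: "\<And>n. w n \<in> disc" "(\<lambda>n. cmod (w n)) \<longlonglongrightarrow> 1"
  shows "(\<lambda>n. LINT \<zeta>|nu. g \<zeta> * cnj (test_fun k (w n) \<zeta>)) \<longlonglongrightarrow> 0"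
proof -
  let ?B = "\<lambda>n. ball (w n) (1 / 2 * (1 - cmod (w n)))"
  let ?I = "\<lambda>n. LINT \<zeta>|nu. indicator (?B n) \<zeta> * (cmod (g \<zeta>))\<^sup>2"
  define K where "K = (real k + 1) * (1 + 2 / (1/2)) ^ (2 * k) / (1/2)\<^sup>2"
  have K: "0 \<le> K" by (simp add: K_def)
  have [measurable]: "g \<in> borel_measurable nu" by (rule bergmanD[OF g])
  have I: "?I \<longlonglongrightarrow> (LINT \<zeta>|nu. 0)"
  proof (rule integral_dominated_convergence[OF _ _ bergmanD(4)[OF g]])
    show "(\<lambda>\<zeta>. indicator (?B n) \<zeta> * (cmod (g \<zeta>))\<^sup>2) \<in> borel_measurable nu" for n by measurable
    show "AE \<zeta> in nu. norm (indicator (?B n) \<zeta> * (cmod (g \<zeta>))\<^sup>2) \<le> (cmod (g \<zeta>))\<^sup>2" for n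
      by (rule AE_I2) (auto simp: indicator_def)
    show "AE \<zeta> in nu. (\<lambda>n. indicator (?B n) \<zeta> * (cmod (g \<zeta>))\<^sup>2) \<longlonglongrightarrow> 0"
    proof (rule AE_I2)
      fix \<zeta> assume "\<zeta> \<in> space nu"
      then have "cmod \<zeta> < 1" by (simp add: in_disc)
      then have "eventually (\<lambda>n. (1 + cmod \<zeta>) / 2 < cmod (w n)) sequentially"
        using w(2) by (intro order_tendstoD(1)) auto
      then have "eventually (\<lambda>n. indicator (?B n) \<zeta> * (cmod (g \<zeta>))\<^sup>2 = 0) sequentially"
      proof (rule eventually_mono)
        fix n assume n: "(1 + cmod \<zeta>) / 2 < cmod (w n)"
        with \<open>cmod \<zeta> < 1\<close> have "1 / 2 * (1 - cmod (w n)) \<le> cmod (w n) - cmod \<zeta>" by (simp add: field_simps)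
        also have "\<dots> \<le> dist (w n) \<zeta>" unfolding dist_norm by (rule norm_triangle_ineq2)
        finally show "indicator (?B n) \<zeta> * (cmod (g \<zeta>))\<^sup>2 = 0" by simp
      qed
      then show "(\<lambda>n. indicator (?B n) \<zeta> * (cmod (g \<zeta>))\<^sup>2) \<longlonglongrightarrow> 0"
        by (rule tendsto_eventually)
    qed
  qed simp
  have bound: "(cmod (LINT \<zeta>|nu. g \<zeta> * cnj (test_fun k (w n) \<zeta>)))\<^sup>2 \<le> K * ?I n" for n
  proof -
    define c where "c = (1 - (cmod (w n))\<^sup>2) / (2 * sqrt (real k + 1))"
    note d = one_minus_norm_square_bounds[OF w(1)[of n]]
    have "(LINT \<zeta>|nu. g \<zeta> * cnj (test_fun k (w n) \<zeta>)) = (LINT \<zeta>|nu. of_real c * (g \<zeta> * cnj (kern k (w n) \<zeta>)))"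
      by (rule Bochner_Integration.integral_cong[OF refl])
         (simp only: test_fun_def c_def[symmetric] complex_cnj_mult complex_cnj_complex_of_real mult.left_commute)
    also have "\<dots> = of_real c * ucoeff k g (w n)"
      unfolding ucoeff_def by (rule integral_mult_right_zero)
    finally have "(cmod (LINT \<zeta>|nu. g \<zeta> * cnj (test_fun k (w n) \<zeta>)))\<^sup>2 = c\<^sup>2 * (cmod (ucoeff k g (w n)))\<^sup>2"
      by (simp only: norm_mult norm_of_real power_mult_distrib power2_abs)
    also have "\<dots> \<le> (1 - cmod (w n))\<^sup>2 * (K / (1 - cmod (w n))\<^sup>2 * ?I n)"
    proof (rule mult_mono)
      have "c \<le> 2 * (1 - cmod (w n)) / (2 * 1)"
        unfolding c_def using d by (intro frac_le) auto
      moreover have "0 \<le> c" using d by (simp add: c_def)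
      ultimately show "c\<^sup>2 \<le> (1 - cmod (w n))\<^sup>2" by (intro power_mono) auto
      show "(cmod (ucoeff k g (w n)))\<^sup>2 \<le> K / (1 - cmod (w n))\<^sup>2 * ?I n"
        unfolding K_def by (rule ucoeff_local_bound[OF g w(1)]) auto
    qed auto
    also have "\<dots> = K * ?I n" using d by simp
    finally show ?thesis .
  qed
  have "(\<lambda>n. K * ?I n) \<longlonglongrightarrow> 0"
    using tendsto_mult_right_zero[of ?I sequentially K] I by simp
  then have "(\<lambda>n. (cmod (LINT \<zeta>|nu. g \<zeta> * cnj (test_fun k (w n) \<zeta>)))\<^sup>2) \<longlonglongrightarrow> 0"
    by (rule tendsto_sandwich[OF _ _ tendsto_const, rotated 2]) (use bound in auto)
  then have "(\<lambda>n. sqrt ((cmod (LINT \<zeta>|nu. g \<zeta> * cnj (test_fun k (w n) \<zeta>)))\<^sup>2)) \<longlonglongrightarrow> sqrt 0"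
    by (rule tendsto_real_sqrt)
  then show ?thesis by (simp add: tendsto_norm_zero_iff)
qed

section \<open>Necessity of vanishing density\<close>

context finite_disc_measure
begin

lemma not_vanishing_density_sequence:
  assumes "\<not> vanishing_density t"
  obtains \<epsilon> w where "0 < \<epsilon>" "\<And>n. w n \<in> disc" "\<And>n. \<epsilon> < dens t (w n)" "(\<lambda>n::nat. cmod (w n)) \<longlonglongrightarrow> 1"
proof -
  obtain \<epsilon> where \<epsilon>: "0 < \<epsilon>" "\<And>R. R < 1 \<Longrightarrow> \<exists>w\<in>disc. R < cmod w \<and> \<epsilon> < dens t w"
    using assms unfolding vanishing_density_def by (meson not_le)
  have "\<exists>w\<in>disc. 1 - inverse (real (Suc n)) < cmod w \<and> \<epsilon> < dens t w" for n
    by (rule \<epsilon>(2)) simp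
  then obtain w where w: "\<And>n. w n \<in> disc" "\<And>n. 1 - inverse (real (Suc n)) < cmod (w n)" "\<And>n. \<epsilon> < dens t (w n)"
    by metis
  have lim: "(\<lambda>n. 1 - inverse (real (Suc n))) \<longlonglongrightarrow> 1"
    using tendsto_diff[OF tendsto_const LIMSEQ_inverse_real_of_nat, of 1] by simp
  have "(\<lambda>n. cmod (w n)) \<longlonglongrightarrow> 1"
  proof (rule tendsto_sandwich[OF _ _ lim tendsto_const])
    show "\<forall>\<^sub>F n in sequentially. 1 - inverse (real (Suc n)) \<le> cmod (w n)"
      using w(2) by (simp add: less_imp_le)
    show "\<forall>\<^sub>F n in sequentially. cmod (w n) \<le> 1"
      using w(1) by (simp add: in_disc less_imp_le)
  qed
  with \<epsilon>(1) w that show ?thesis by blast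
qed

text \<open>Chebyshev's inequality, scaled so that the denominator of the density appears.\<close>

lemma integral_ge_measure_ball:
  assumes h: "integrable \<mu> (\<lambda>z. (cmod (h z))\<^sup>2)" and w: "w \<in> disc" and t: "0 < t" "t \<le> 1"
    and le: "\<And>z. z \<in> disc \<Longrightarrow> cmod (z - w) \<le> t * (1 - cmod w) \<Longrightarrow> c / (1 - cmod w) \<le> cmod (h z)" and c: "0 \<le> c"
  shows "c\<^sup>2 * dens t w \<le> (LINT z|\<mu>. (cmod (h z))\<^sup>2)"
proof -
  let ?B = "ball w (t * (1 - cmod w))"
  have w1: "0 < 1 - cmod w" using w by (simp add: in_disc)
  have B: "?B \<in> sets \<mu>" by (intro ball_in_sets_mu ball_disc w t)
  have sub: "?B \<inter> disc = ?B" using ball_disc[OF w t(2)] by blast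
  have "(LINT z|\<mu>. (c / (1 - cmod w))\<^sup>2 * indicator ?B z) \<le> (LINT z|\<mu>. (cmod (h z))\<^sup>2)"
  proof (rule integral_mono[OF _ h])
    show "integrable \<mu> (\<lambda>z. (c / (1 - cmod w))\<^sup>2 * indicator ?B z)"
      using B by (intro integrable_mult_right integrable_const_bound[where B=1]) auto
    fix z assume z: "z \<in> space \<mu>"
    show "(c / (1 - cmod w))\<^sup>2 * indicator ?B z \<le> (cmod (h z))\<^sup>2"
    proof (cases "z \<in> ?B")
      case True
      then have "c / (1 - cmod w) \<le> cmod (h z)"
        using z by (intro le) (auto simp: dist_norm norm_minus_commute)
      then have "(c / (1 - cmod w))\<^sup>2 \<le> (cmod (h z))\<^sup>2"
        using c w1 by (intro power_mono) auto
      then show ?thesis using True by simp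
    qed simp
  qed
  then show ?thesis
    by (simp add: dens_def power_divide sub)
qed

text \<open>The normalized kernels at w n have norm 1 and tend to 0 pointwise on the disc. Fatou's
  lemma therefore bounds the squared norm of one of them in \<open>\<mu>\<close> by the lower limit
  of its squared distances to the later ones, which the Cauchy property makes small; a density above
  \<open>\<epsilon>\<close> contradicts this.\<close>

lemma vanishing_carleson_imp_vanishing_density:
  assumes vc: "vanishing_carleson \<mu>"
  shows "vanishing_density (1 / 2)"
proof (rule ccontr)
  assume "\<not> vanishing_density (1 / 2)"
  then obtain \<epsilon> w where \<epsilon>: "0 < \<epsilon>" and w: "\<And>n. w n \<in> disc" and dens: "\<And>n. \<epsilon> < dens (1 / 2) (w n)"
    and lim: "(\<lambda>n::nat. cmod (w n)) \<longlonglongrightarrow> 1"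
    by (rule not_vanishing_density_sequence) blast
  define u where "u n \<zeta> = of_real (1 - (cmod (w n))\<^sup>2) * kern 0 (w n) \<zeta>" for n \<zeta>
  have ub: "u n \<in> bergman" for n
    unfolding u_def[abs_def] by (intro bergman_cmult kern_bergman w)
  have um: "u n \<in> borel_measurable borel" for n
    unfolding u_def[abs_def] by measurable
  have uA: "u n \<in> A2" for n by (intro bergman_A2 ub um)
  have "norm_A2 (u n) \<le> 1" for n
  proof -
    have "(norm_A2 (u n))\<^sup>2 = (1 - (cmod (w n))\<^sup>2)\<^sup>2 * (LINT \<zeta>|nu. (cmod (kern 0 (w n) \<zeta>))\<^sup>2)"
      unfolding A2_bergman(2)[OF uA] u_def norm_mult norm_of_real power_mult_distrib power2_abs
      by (rule integral_mult_right_zero)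
    also have "\<dots> = 1"
      unfolding integral_kern_0[OF w] using one_minus_norm_square_bounds(4)[OF w, of n] by simp
    finally show ?thesis by (simp add: power2_le_imp_le[of _ 1])
  qed
  with uA vc obtain r :: "nat \<Rightarrow> nat" where r: "strict_mono r"
    and cauchy: "\<And>\<epsilon>. 0 < \<epsilon> \<Longrightarrow> \<exists>N. \<forall>m\<ge>N. \<forall>n\<ge>N. norm_L2 \<mu> (\<lambda>z. u (r m) z - u (r n) z) < \<epsilon>"
    unfolding vanishing_carleson_def by meson
  have car: "integrable \<mu> (\<lambda>z. (cmod (f z))\<^sup>2)" if "f \<in> A2" for f
    using vc that unfolding vanishing_carleson_def carleson_def by blast
  have [measurable]: "u n \<in> borel_measurable \<mu>" for n
    by (intro borel_measurable_mu_continuous bergmanD ub)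
  have diffA: "(\<lambda>z. u m z - u n z) \<in> A2" for m n
    by (intro bergman_A2 bergman_diff ub borel_measurable_diff um)
  \<comment> \<open>On the ball of the density the normalized kernel is at least (1/9) / (1 - |w|),
    since |1 - cnj w * z| \<le> 3 * (1 - |w|) there; 81 is the square of 9.\<close>
  define \<kappa> where "\<kappa> = \<epsilon> / 81"
  have \<kappa>: "0 < \<kappa>" using \<epsilon> by (simp add: \<kappa>_def)
  obtain N where N: "\<And>m n. m \<ge> N \<Longrightarrow> n \<ge> N \<Longrightarrow> norm_L2 \<mu> (\<lambda>z. u (r m) z - u (r n) z) < sqrt \<kappa>"
    using cauchy[of "sqrt \<kappa>"] \<kappa> by auto
  have u0: "(\<lambda>n. u (r n) z) \<longlonglongrightarrow> 0" if z: "z \<in> disc" for z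
  proof (rule Lim_null_comparison)
    have z1: "0 < 1 - cmod z" using z by (simp add: in_disc)
    show "\<forall>\<^sub>F n in sequentially. norm (u (r n) z) \<le> (1 - (cmod (w (r n)))\<^sup>2) * (1 / (1 - cmod z)\<^sup>2)"
    proof (rule always_eventually, rule allI)
      fix n
      have "cmod (1 - cnj (w (r n)) * z) = cmod (1 - cnj z * w (r n))"
        by (metis complex_cnj_cnj complex_cnj_diff complex_cnj_mult complex_cnj_one complex_mod_cnj mult.commute)
      then have "1 - cmod z \<le> cmod (1 - cnj (w (r n)) * z)"
        using one_minus_cnj_mult_bounds(1)[OF z w] by simp
      then have "1 / (cmod (1 - cnj (w (r n)) * z))\<^sup>2 \<le> 1 / (1 - cmod z)\<^sup>2"
        using z1 by (intro divide_left_mono power_mono mult_pos_pos zero_less_power) auto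
      then show "norm (u (r n) z) \<le> (1 - (cmod (w (r n)))\<^sup>2) * (1 / (1 - cmod z)\<^sup>2)"
        unfolding u_def norm_mult norm_of_real cmod_kern_0
        using one_minus_norm_square_bounds(4)[OF w, of "r n"] by (simp only: abs_of_pos mult_left_mono less_imp_le)
    qed
    have "(\<lambda>n. cmod (w (r n))) \<longlonglongrightarrow> 1"
      using LIMSEQ_subseq_LIMSEQ[OF lim r] by (simp add: o_def)
    then have "(\<lambda>n. (1 - (cmod (w (r n)))\<^sup>2) * (1 / (1 - cmod z)\<^sup>2)) \<longlonglongrightarrow> (1 - 1\<^sup>2) * (1 / (1 - cmod z)\<^sup>2)"
      by (intro tendsto_intros)
    then show "(\<lambda>n. (1 - (cmod (w (r n)))\<^sup>2) * (1 / (1 - cmod z)\<^sup>2)) \<longlonglongrightarrow> 0" by simp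
  qed
  have "(\<integral>\<^sup>+z. ennreal ((cmod (u (r N) z))\<^sup>2) \<partial>\<mu>) = (\<integral>\<^sup>+z. liminf (\<lambda>n. ennreal ((cmod (u (r N) z - u (r n) z))\<^sup>2)) \<partial>\<mu>)"
  proof (rule nn_integral_cong)
    fix z assume "z \<in> space \<mu>"
    then have "(\<lambda>n. ennreal ((cmod (u (r N) z - u (r n) z))\<^sup>2)) \<longlonglongrightarrow> ennreal ((cmod (u (r N) z - 0))\<^sup>2)"
      by (intro tendsto_intros u0) simp
    then have "(\<lambda>n. ennreal ((cmod (u (r N) z - u (r n) z))\<^sup>2)) \<longlonglongrightarrow> ennreal ((cmod (u (r N) z))\<^sup>2)"
      by (simp only: diff_zero)
    then show "ennreal ((cmod (u (r N) z))\<^sup>2) = liminf (\<lambda>n. ennreal ((cmod (u (r N) z - u (r n) z))\<^sup>2))"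
      by (rule lim_imp_Liminf[OF sequentially_bot, symmetric])
  qed
  also have "\<dots> \<le> liminf (\<lambda>n. \<integral>\<^sup>+z. ennreal ((cmod (u (r N) z - u (r n) z))\<^sup>2) \<partial>\<mu>)"
    by (rule nn_integral_liminf) measurable
  also have "\<dots> \<le> liminf (\<lambda>n. ennreal \<kappa>)"
  proof (rule Liminf_mono, rule eventually_sequentiallyI[of N])
    fix n assume "N \<le> n"
    then have "norm_L2 \<mu> (\<lambda>z. u (r N) z - u (r n) z) < sqrt \<kappa>" by (intro N) auto
    then have "(LINT z|\<mu>. (cmod (u (r N) z - u (r n) z))\<^sup>2) < \<kappa>"
      unfolding norm_L2_def by simp
    then show "(\<integral>\<^sup>+z. ennreal ((cmod (u (r N) z - u (r n) z))\<^sup>2) \<partial>\<mu>) \<le> ennreal \<kappa>"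
      by (subst nn_integral_eq_integral[OF car[OF diffA]]) (auto intro: ennreal_leI)
  qed
  finally have "(\<integral>\<^sup>+z. ennreal ((cmod (u (r N) z))\<^sup>2) \<partial>\<mu>) \<le> ennreal \<kappa>"
    by (simp add: Liminf_const)
  then have upper: "(LINT z|\<mu>. (cmod (u (r N) z))\<^sup>2) \<le> \<kappa>"
    using \<kappa> by (subst (asm) nn_integral_eq_integral[OF car[OF uA]]) (auto simp: ennreal_le_iff)
  have "(1 / 9)\<^sup>2 * dens (1 / 2) (w (r N)) \<le> (LINT z|\<mu>. (cmod (u (r N) z))\<^sup>2)"
  proof (rule integral_ge_measure_ball[OF car[OF uA] w])
    fix z assume z: "z \<in> disc" "cmod (z - w (r N)) \<le> 1 / 2 * (1 - cmod (w (r N)))"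
    define \<delta> where "\<delta> = 1 - cmod (w (r N))"
    note d = one_minus_norm_square_bounds[OF w[of "r N"], folded \<delta>_def]
    have "cmod (z - w (r N)) \<le> 1 - cmod (w (r N))"
      by (rule order_trans[OF z(2)]) (use d(3) in \<open>simp add: \<delta>_def\<close>)
    then have "cmod (1 - cnj (w (r N)) * z) \<le> 3 * \<delta>"
      unfolding \<delta>_def by (rule cmod_one_minus_cnj_le[OF w])
    moreover have "0 < cmod (1 - cnj (w (r N)) * z)"
      using one_minus_cnj_mult_bounds(2)[OF w z(1)] by simp
    ultimately have "\<delta> / (3 * \<delta>)\<^sup>2 \<le> (1 - (cmod (w (r N)))\<^sup>2) / (cmod (1 - cnj (w (r N)) * z))\<^sup>2"
      using d by (intro frac_le power_mono zero_less_power) auto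
    also have "\<dots> = cmod (u (r N) z)"
      unfolding u_def norm_mult norm_of_real cmod_kern_0 using d by simp
    finally show "1 / 9 / (1 - cmod (w (r N))) \<le> cmod (u (r N) z)"
      using d(3) by (simp add: \<delta>_def[symmetric] power2_eq_square)
  qed auto
  then have "dens (1 / 2) (w (r N)) \<le> \<epsilon>"
    using upper by (simp add: \<kappa>_def power2_eq_square)
  with dens[of "r N"] show False by simp
qed

text \<open>If the density does not vanish, the forms at (p n, p n) stay above a fixed
  \<open>\<kappa>\<close> for polynomials p n tending weakly to 0. Compactness allows T (p n) to be
  replaced, along a subsequence, by one fixed function with loss \<open>\<kappa>\<close> / 2, and
  its inner products with p n must tend to 0.\<close>

lemma Tk_bounded_compact_imp_vanishing_density:
  assumes Tk: "Tk_bounded_compact \<mu> k"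
  shows "vanishing_density (gap k / (2 * (4 * real k + 6)))"
proof (rule ccontr)
  \<comment> \<open>Chosen so that (4 * k + 6) * t = \<open>gap k\<close> / 2, the condition for the
    lower bound on the test functions.\<close>
  define t where "t = gap k / (2 * (4 * real k + 6))"
  have t: "0 < t" "(4 * real k + 6) * t \<le> gap k / 2" "t \<le> 1 / 2"
  proof -
    show "0 < t" using gap_pos by (simp add: t_def)
    show "(4 * real k + 6) * t \<le> gap k / 2" by (simp add: t_def field_simps)
    have "gap k / (2 * (4 * real k + 6)) \<le> 1 / 2"
      using gap_le_1 gap_pos[of k] by (intro frac_le) auto
    then show "t \<le> 1 / 2" by (simp add: t_def)
  qed
  assume "\<not> vanishing_density (gap k / (2 * (4 * real k + 6)))"
  then have "\<not> vanishing_density t" by (simp add: t_def)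
  then obtain \<epsilon> w where \<epsilon>: "0 < \<epsilon>" and w: "\<And>n. w n \<in> disc" and dens: "\<And>n. \<epsilon> < dens t (w n)"
    and lim: "(\<lambda>n::nat. cmod (w n)) \<longlonglongrightarrow> 1"
    by (rule not_vanishing_density_sequence) blast
  from Tk obtain T where T1: "\<forall>f\<in>A2. T f \<in> A2"
    and T2: "\<forall>fs. (\<forall>n. fs n \<in> A2 \<and> norm_A2 (fs n) \<le> 1) \<longrightarrow> (\<exists>r :: nat \<Rightarrow> nat. strict_mono r \<and>
             (\<forall>\<epsilon>>0. \<exists>N. \<forall>m\<ge>N. \<forall>n\<ge>N. norm_A2 (\<lambda>z. T (fs (r m)) z - T (fs (r n)) z) < \<epsilon>))"
    and T3: "\<forall>p q. integrable \<mu> (Tk_integrand k (poly p) (poly q)) \<and>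
          inner_A2 (T (poly p)) (poly q) = integral\<^sup>L \<mu> (Tk_integrand k (poly p) (poly q))"
    unfolding Tk_bounded_compact_def by (elim exE conjE) (rule that)
  have TA: "T f \<in> A2" if "f \<in> A2" for f
    using T1 that by simp
  have Ti: "integrable \<mu> (Tk_integrand k (poly p) (poly q))"
    "inner_A2 (T (poly p)) (poly q) = integral\<^sup>L \<mu> (Tk_integrand k (poly p) (poly q))" for p q
    using T3 by simp_all
  define s where "s = sqrt (real k + 1)"
  have s: "1 \<le> s" "s\<^sup>2 = real k + 1" by (simp_all add: s_def add_nonneg_pos)
  \<comment> \<open>As 1 - |z|^2 is at least half of 1 - |w n| on the ball, an error
    \<open>gap k\<close> / 16 costs at most half of the lower bound for the test function. The
    factor 1 / (n+1) makes the polynomials inherit weak convergence to 0.\<close>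
  define \<eta> where "\<eta> n = gap k / 16 * inverse (real (Suc n))" for n
  have \<eta>: "0 < \<eta> n" "\<eta> n \<le> gap k / 16" "\<eta> n \<le> 1 / 2" for n
  proof -
    show "0 < \<eta> n" using gap_pos by (simp add: \<eta>_def)
    have "inverse (real (Suc n)) \<le> 1" by (simp add: field_simps)
    then have "\<eta> n \<le> gap k / 16 * 1"
      unfolding \<eta>_def using gap_pos[of k] by (intro mult_left_mono) auto
    then show "\<eta> n \<le> gap k / 16" "\<eta> n \<le> 1 / 2" using gap_le_1[of k] by auto
  qed
  have "\<exists>p. \<forall>z\<in>disc. cmod (poly p z - test_fun k (w n) z) < \<eta> n" for n
    using poly_approx_kern[OF w \<eta>(1)] unfolding test_fun_def by metis
  then obtain p where p: "\<And>n z. z \<in> disc \<Longrightarrow> cmod (poly (p n) z - test_fun k (w n) z) < \<eta> n"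
    by metis
  have pm [measurable]: "poly p \<in> borel_measurable borel" for p :: "complex poly"
    by (intro borel_measurable_continuous_onI continuous_intros)
  have pA: "poly p \<in> A2" for p by (intro bergman_A2 bergman_poly pm)
  have hb: "(\<lambda>z. poly (p n) z - test_fun k (w n) z) \<in> bergman" for n
    by (intro bergman_diff bergman_poly test_fun_bergman w)
  have h\<eta>: "(LINT z|nu. (cmod (poly (p n) z - test_fun k (w n) z))\<^sup>2) \<le> (\<eta> n)\<^sup>2" for n
    by (rule L2_le_sup[OF hb]) (rule less_imp_le[OF p])
  have p1: "(LINT z|nu. (cmod (poly (p n) z))\<^sup>2) \<le> 1" for n
  proof -
    have "(LINT z|nu. (cmod ((poly (p n) z - test_fun k (w n) z) + test_fun k (w n) z))\<^sup>2)
        \<le> 2 * (LINT z|nu. (cmod (poly (p n) z - test_fun k (w n) z))\<^sup>2) + 2 * (LINT z|nu. (cmod (test_fun k (w n) z))\<^sup>2)"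
      by (intro integral_L2_add_le bergmanD hb test_fun_bergman w)
    also have "\<dots> \<le> 2 * (1 / 2)\<^sup>2 + 2 * (1 / 4)"
      using h\<eta>[of n] power_mono[OF \<eta>(3) less_imp_le[OF \<eta>(1)], of n 2] test_fun_norm[OF w, of k n] by linarith
    finally show ?thesis by (simp add: power2_eq_square)
  qed
  have pn1: "norm_A2 (poly (p n)) \<le> 1" for n
    using p1[of n] unfolding A2_bergman(2)[OF pA, symmetric] by (simp add: power2_le_imp_le[of _ 1])
  have int_eq: "Tk_integrand k (poly q) (poly q) z = of_real ((cmod (ucoeff k (poly q) z))\<^sup>2)" if "z \<in> space \<mu>" for q z
    unfolding complex_norm_square using that by (intro Tk_integrand_eq pm) simp
  have intF: "integrable \<mu> (\<lambda>z. (cmod (ucoeff k (poly q) z))\<^sup>2)" for q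
  proof -
    have "integrable \<mu> (\<lambda>z. complex_of_real ((cmod (ucoeff k (poly q) z))\<^sup>2))"
      using Ti(1)[of q q] by (subst Bochner_Integration.integrable_cong[OF refl int_eq[symmetric]])
    then show ?thesis by (simp only: complex_of_real_integrable_eq)
  qed
  have inner_eq: "inner_A2 (T (poly q)) (poly q) = of_real (LINT z|\<mu>. (cmod (ucoeff k (poly q) z))\<^sup>2)" for q
    unfolding Ti(2) integral_complex_of_real[symmetric] by (rule Bochner_Integration.integral_cong[OF refl int_eq])
  \<comment> \<open>The lower bound \<open>gap k\<close> / 4 for test functions, halved by the
    polynomial approximation; the factor sqrt (k+1) \<ge> 1 is dropped.\<close>
  define \<kappa> where "\<kappa> = (gap k / 8)\<^sup>2 * \<epsilon>"
  have \<kappa>: "0 < \<kappa>" using \<epsilon> gap_pos[of k] by (simp add: \<kappa>_def)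
  have lower: "\<kappa> < cmod (inner_A2 (T (poly (p n))) (poly (p n)))" for n
  proof -
    define \<delta> where "\<delta> = 1 - cmod (w n)"
    have \<delta>: "0 < \<delta>" using w[of n] by (simp add: \<delta>_def in_disc)
    have "(gap k / 8)\<^sup>2 * dens t (w n) \<le> (LINT z|\<mu>. (cmod (ucoeff k (poly (p n)) z))\<^sup>2)"
    proof (rule integral_ge_measure_ball[OF intF w t(1)])
      show "t \<le> 1" using t by simp
      show "0 \<le> gap k / 8" using gap_pos[of k] by simp
      fix z assume z: "z \<in> disc" "cmod (z - w n) \<le> t * (1 - cmod (w n))"
      have 1: "s * gap k / (4 * \<delta>) \<le> cmod (ucoeff k (test_fun k (w n)) z)"
        unfolding s_def \<delta>_def by (rule ucoeff_test_fun_ge[OF w z less_imp_le[OF t(1)] t(2)])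
      note dz = one_minus_norm_square_bounds[OF z(1)]
      have "t * \<delta> \<le> 1 / 2 * \<delta>"
        using t \<delta> by (intro mult_right_mono) auto
      with z(2) have "cmod (z - w n) \<le> \<delta> / 2" by (simp add: \<delta>_def)
      moreover have "cmod z \<le> cmod (w n) + cmod (z - w n)" by (rule norm_triangle_sub)
      moreover have "cmod (w n) = 1 - \<delta>" by (simp add: \<delta>_def)
      ultimately have half: "\<delta> / 2 \<le> 1 - (cmod z)\<^sup>2"
        using dz(1) by (smt (verit) field_sum_of_halves)
      have "(cmod (ucoeff k (\<lambda>z. poly (p n) z - test_fun k (w n) z) z))\<^sup>2 \<le> (\<eta> n)\<^sup>2 * ((real k + 1) / (1 - (cmod z)\<^sup>2)\<^sup>2)"
        by (rule order_trans[OF ucoeff_cauchy_schwarz[OF hb z(1)] mult_right_mono[OF h\<eta>]]) simp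
      also have "\<dots> = (\<eta> n * s / (1 - (cmod z)\<^sup>2))\<^sup>2"
        by (simp add: power_mult_distrib power_divide s)
      finally have "cmod (ucoeff k (\<lambda>z. poly (p n) z - test_fun k (w n) z) z) \<le> \<eta> n * s / (1 - (cmod z)\<^sup>2)"
      proof (rule power2_le_imp_le)
        show "0 \<le> \<eta> n * s / (1 - (cmod z)\<^sup>2)"
          using \<eta>(1)[of n] s dz by (intro divide_nonneg_pos mult_nonneg_nonneg) auto
      qed
      also have "\<dots> \<le> (gap k / 16 * s) / (\<delta> / 2)"
        using \<eta>(1,2)[of n] s half \<delta> gap_pos[of k] by (intro frac_le mult_right_mono) auto
      also have "\<dots> = s * gap k / (8 * \<delta>)" by simp
      finally have 2: "cmod (ucoeff k (poly (p n)) z - ucoeff k (test_fun k (w n)) z) \<le> s * gap k / (8 * \<delta>)"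
        unfolding ucoeff_diff[OF bergman_poly test_fun_bergman[OF w] z(1)] .
      have 3: "s * gap k / (4 * \<delta>) = 2 * (s * gap k / (8 * \<delta>))" using \<delta> by (simp add: field_simps)
      have "cmod (ucoeff k (test_fun k (w n)) z) \<le> cmod (ucoeff k (poly (p n)) z) + cmod (ucoeff k (poly (p n)) z - ucoeff k (test_fun k (w n)) z)"
        by (metis norm_minus_commute norm_triangle_sub)
      moreover have "b \<le> y" if "2 * b \<le> x" "x \<le> y + d" "d \<le> b" for b x y d :: real
        using that by linarith
      ultimately have "s * gap k / (8 * \<delta>) \<le> cmod (ucoeff k (poly (p n)) z)"
        using 1 2 unfolding 3 by blast
      moreover have "1 * gap k / (8 * \<delta>) \<le> s * gap k / (8 * \<delta>)"
        using s \<delta> gap_pos[of k] by (intro divide_right_mono mult_right_mono) auto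
      ultimately show "gap k / 8 / (1 - cmod (w n)) \<le> cmod (ucoeff k (poly (p n)) z)"
        by (simp add: \<delta>_def)
    qed
    moreover have "\<kappa> < (gap k / 8)\<^sup>2 * dens t (w n)"
      unfolding \<kappa>_def using dens gap_pos[of k] by (intro mult_strict_left_mono zero_less_power) auto
    moreover have "(LINT z|\<mu>. (cmod (ucoeff k (poly (p n)) z))\<^sup>2) \<le> cmod (inner_A2 (T (poly (p n))) (poly (p n)))"
      unfolding inner_eq norm_of_real by simp
    ultimately show ?thesis by linarith
  qed
  text \<open>Membership in \<open>A2\<close> only makes the square of the modulus measurable outside the disc,
    but a nonzero inner product with a polynomial can only come from a measurable function.\<close>
  have Tm [measurable]: "T (poly (p n)) \<in> borel_measurable borel" for n
  proof -
    let ?f = "\<lambda>z. T (poly (p n)) z * cnj (poly (p n) z)"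
    have "integral\<^sup>L dA ?f \<noteq> 0"
      using lower[of n] \<kappa> unfolding inner_A2_def by auto
    then have "integrable dA ?f"
      using not_integrable_integral_eq by blast
    then have [measurable]: "?f \<in> borel_measurable borel"
      using borel_measurable_integrable[of dA ?f] by (simp cong: measurable_cong_sets)
    have "p n \<noteq> 0" using lower[of n] \<kappa> by (auto simp: inner_A2_def)
    then have fin: "finite {z. poly (p n) z = 0}" by (rule poly_roots_finite)
    have "(\<lambda>z. ?f z / cnj (poly (p n) z)) \<in> borel_measurable borel" by measurable
    then show ?thesis
      by (rule measurable_discrete_difference[OF _ countable_finite[OF fin]]) auto
  qed
  have Tb: "T (poly (p n)) \<in> bergman" for n by (intro A2_bergman TA pA)
  obtain r :: "nat \<Rightarrow> nat" where r: "strict_mono r"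
    and cauchy: "\<And>\<epsilon>. 0 < \<epsilon> \<Longrightarrow> \<exists>N. \<forall>m\<ge>N. \<forall>n\<ge>N. norm_A2 (\<lambda>z. T (poly (p (r m))) z - T (poly (p (r n))) z) < \<epsilon>"
    using spec[OF T2, of "\<lambda>n. poly (p n)"] pA pn1 by auto
  obtain N where N: "\<And>m n. m \<ge> N \<Longrightarrow> n \<ge> N \<Longrightarrow> norm_A2 (\<lambda>z. T (poly (p (r m))) z - T (poly (p (r n))) z) < \<kappa> / 2"
    using cauchy[of "\<kappa> / 2"] \<kappa> by auto
  let ?g = "T (poly (p (r N)))"
  \<comment> \<open>The fixed function T (p (r N)) replaces T (p (r n)); as p (r n) lies in the unit
    ball, Cauchy-Schwarz bounds the loss by the distance of the two images.\<close>
  have big: "\<kappa> / 2 < cmod (LINT z|nu. ?g z * cnj (poly (p (r n)) z))" if n: "n \<ge> N" for n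
  proof -
    let ?h = "T (poly (p (r n)))" and ?q = "poly (p (r n))"
    have dA: "(\<lambda>z. ?g z - ?h z) \<in> A2"
      by (intro bergman_A2 bergman_diff Tb) measurable
    have "inner_A2 ?h ?q = (LINT z|nu. ?h z * cnj (?q z))"
      unfolding inner_A2_def by (rule integral_dA_eq_nu) measurable
    then have 1: "\<kappa> < cmod (LINT z|nu. ?h z * cnj (?q z))" using lower[of "r n"] by simp
    have "(LINT z|nu. ?g z * cnj (?q z)) - (LINT z|nu. ?h z * cnj (?q z)) = (LINT z|nu. (?g z - ?h z) * cnj (?q z))"
      unfolding left_diff_distrib
      by (intro Bochner_Integration.integral_diff[symmetric] integrable_bergman_mult Tb bergman_poly)
    then have "(cmod ((LINT z|nu. ?g z * cnj (?q z)) - (LINT z|nu. ?h z * cnj (?q z))))\<^sup>2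
        \<le> (LINT z|nu. (cmod (?g z - ?h z))\<^sup>2) * (LINT z|nu. (cmod (?q z))\<^sup>2)"
      by (simp only:) (intro Cauchy_Schwarz_L2 bergmanD bergman_diff Tb bergman_poly)
    also have "\<dots> \<le> (LINT z|nu. (cmod (?g z - ?h z))\<^sup>2) * 1"
      by (intro mult_left_mono p1 Bochner_Integration.integral_nonneg) auto
    also have "\<dots> = (norm_A2 (\<lambda>z. ?g z - ?h z))\<^sup>2"
      using A2_bergman(2)[OF dA] by simp
    also have "\<dots> \<le> (\<kappa> / 2)\<^sup>2"
      using N[OF order_refl n] by (intro power_mono) (auto simp: norm_A2_def)
    finally have "cmod ((LINT z|nu. ?g z * cnj (?q z)) - (LINT z|nu. ?h z * cnj (?q z))) \<le> \<kappa> / 2"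
      by (rule power2_le_imp_le) (use \<kappa> in simp)
    then show ?thesis
      using 1 norm_triangle_ineq2[of "LINT z|nu. ?h z * cnj (?q z)" "LINT z|nu. ?g z * cnj (?q z)"]
      by (simp add: norm_minus_commute)
  qed
  have limw: "(\<lambda>n. cmod (w (r n))) \<longlonglongrightarrow> 1"
    using LIMSEQ_subseq_LIMSEQ[OF lim r] by (simp add: o_def)
  have l1: "(\<lambda>n. LINT z|nu. ?g z * cnj (test_fun k (w (r n)) z)) \<longlonglongrightarrow> 0"
    by (rule test_fun_weak_limit[OF Tb w limw])
  define c where "c = (LINT z|nu. (cmod (?g z))\<^sup>2)"
  have c: "0 \<le> c" unfolding c_def by (intro Bochner_Integration.integral_nonneg) auto
  have "\<eta> \<longlonglongrightarrow> gap k / 16 * 0"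
    unfolding \<eta>_def by (intro tendsto_intros LIMSEQ_inverse_real_of_nat)
  then have l\<eta>: "(\<lambda>n. sqrt c * \<eta> (r n)) \<longlonglongrightarrow> 0"
    using tendsto_mult[OF tendsto_const LIMSEQ_subseq_LIMSEQ[OF _ r], of \<eta> 0 "sqrt c"] by (simp add: o_def)
  have l2: "(\<lambda>n. LINT z|nu. ?g z * cnj (poly (p (r n)) z - test_fun k (w (r n)) z)) \<longlonglongrightarrow> 0"
  proof (rule Lim_null_comparison[OF always_eventually l\<eta>], rule allI)
    fix n
    have "(cmod (LINT z|nu. ?g z * cnj (poly (p (r n)) z - test_fun k (w (r n)) z)))\<^sup>2
        \<le> c * (LINT z|nu. (cmod (poly (p (r n)) z - test_fun k (w (r n)) z))\<^sup>2)"
      unfolding c_def by (intro Cauchy_Schwarz_L2 bergmanD Tb hb)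
    also have "\<dots> \<le> c * (\<eta> (r n))\<^sup>2" by (intro mult_left_mono h\<eta> c)
    also have "\<dots> = (sqrt c * \<eta> (r n))\<^sup>2" using c by (simp add: power_mult_distrib)
    finally show "cmod (LINT z|nu. ?g z * cnj (poly (p (r n)) z - test_fun k (w (r n)) z)) \<le> sqrt c * \<eta> (r n)"
      by (rule power2_le_imp_le) (use c \<eta>(1)[of "r n"] in simp)
  qed
  have "(LINT z|nu. ?g z * cnj (poly (p (r n)) z)) =
      (LINT z|nu. ?g z * cnj (test_fun k (w (r n)) z)) + (LINT z|nu. ?g z * cnj (poly (p (r n)) z - test_fun k (w (r n)) z))" for n
  proof -
    have "(LINT z|nu. ?g z * cnj (poly (p (r n)) z)) =
      (LINT z|nu. ?g z * cnj (test_fun k (w (r n)) z) + ?g z * cnj (poly (p (r n)) z - test_fun k (w (r n)) z))"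
      by (rule Bochner_Integration.integral_cong[OF refl]) (simp add: algebra_simps)
    then show ?thesis
      by (simp only:) (intro Bochner_Integration.integral_add integrable_bergman_mult Tb hb test_fun_bergman w)
  qed
  then have "(\<lambda>n. LINT z|nu. ?g z * cnj (poly (p (r n)) z)) \<longlonglongrightarrow> 0"
    using tendsto_add[OF l1 l2] by simp
  then have "(\<lambda>n. cmod (LINT z|nu. ?g z * cnj (poly (p (r n)) z))) \<longlonglongrightarrow> 0"
    by (rule tendsto_norm_zero)
  then have "\<forall>\<^sub>F n in sequentially. cmod (LINT z|nu. ?g z * cnj (poly (p (r n)) z)) < \<kappa> / 2"
    using \<kappa> by (intro order_tendstoD(2)) auto
  then obtain n0 where "\<And>n. n \<ge> n0 \<Longrightarrow> cmod (LINT z|nu. ?g z * cnj (poly (p (r n)) z)) < \<kappa> / 2"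
    unfolding eventually_sequentially by blast
  from this[of "max n0 N"] big[of "max n0 N"] show False by simp
qed

end

section \<open>The characterisation\<close>

theorem theorem4p7:
  fixes \<mu> :: "complex measure" and k :: nat
  assumes "sets \<mu> = sets (restrict_space borel disc)"
    and "finite_measure \<mu>"
  shows "Tk_bounded_compact \<mu> k \<longleftrightarrow> vanishing_carleson \<mu>"
proof -
  interpret finite_disc_measure \<mu>
    using assms by (simp add: finite_disc_measure_def finite_disc_measure_axioms_def)
  have t: "0 < gap k / (2 * (4 * real k + 6))" "gap k / (2 * (4 * real k + 6)) < 1"
    using gap_pos[of k] gap_le_1[of k] by (simp_all add: divide_less_eq)
  show ?thesis
  proof
    assume "Tk_bounded_compact \<mu> k"
    then show "vanishing_carleson \<mu>"
      using vanishing_density_imp_vanishing_carleson[OF Tk_bounded_compact_imp_vanishing_density t] by simp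
  next
    assume "vanishing_carleson \<mu>"
    then have "vanishing_density (1 / 2)"
      by (rule vanishing_carleson_imp_vanishing_density)
    then show "Tk_bounded_compact \<mu> k"
      by (rule vanishing_density_imp_Tk_bounded_compact) simp_all
  qed
qed

end
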